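(* Let $z, w, a, E$ be indeterminates and let $T=T(w,a)$ denote the regular isotopy version of the Dubrovnik polynomial in the variables $w,a$. There exists a unique regular isotopy invariant of classical unoriented links $D[T]:\mathcal{L}^u\to \mathbb{Z}[z, w^{\pm 1}, a^{\pm 1}, E^{\pm 1}]$ satisfying the following two rules: (1) For every unoriented Conway quadruple $L_+, L_-, L_0, L_\infty$ whose specified crossing involves two different components of the link, $$D[T](L_+) - D[T](L_-) = z\,\big( D[T](L_0) - D[T](L_\infty)\big).$$ (2) For every union $\mathcal{K}^r=\sqcup_{i=1}^r K_i$ of $r$ unlinked knots in $\mathcal{L}^u$, $r\geq 1$, $$D[T](\mathcal{K}^r) = E^{1-r}\, T(\mathcal{K}^r).$$
   Context: $\mathcal{L}^u$ is the set of (non-empty) classical unoriented link diagrams in the plane. Regular isotopy is the equivalence relation on diagrams generated by planar isotopy and Reidemeister moves II and III; a regular isotopy invariant is a function on diagrams constant on regular isotopy classes. For a crossing, swinging the overcrossing arc counterclockwise sweeps two of the four local regions; joining these two regions is the $A$-smoothing, joining the other two is the $B$-smoothing. A crossing (drawn in the plane as an X) is of positive type if its $A$-smoothing is horizontal (one arc on top and one arc at the bottom) and of negative type if its $A$-smoothing is vertical. An unoriented Conway quadruple $L_+,L_-,L_0,L_\infty$ consists of four unoriented diagrams identical except near one specified crossing, which is of positive type in $L_+$, switched in $L_-$, and replaced in $L_0$ and $L_\infty$ by, respectively, the $A$-smoothing (horizontal) and the $B$-smoothing (vertical) of the crossing of $L_+$. A union of $r$ unlinked knots $\mathcal{K}^r=\sqcup_{i=1}^r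 K_i$ is an $r$-component link diagram representing a split link whose $r$ split components are (possibly non-trivial) knots $K_1,\dots,K_r$. $T(w,a)\in\mathbb{Z}[w^{\pm1},a^{\pm1}]$, the (known) regular isotopy version of the Dubrovnik polynomial, is the regular isotopy invariant of unoriented links determined by: (T1) $T(L_+)-T(L_-)=w\,(T(L_0)-T(L_\infty))$ for every unoriented Conway quadruple (any crossing); (T2) $T(\text{diagram with a positive curl})=a\,T(\text{diagram without the curl})$ and $T(\text{diagram with a negative curl})=a^{-1}T(\text{diagram without the curl})$, where a curl is a Reidemeister I kink, and its sign is the sign of its crossing for either orientation of the strand; (T3) $T=1$ on the standard crossingless unknot diagram. It follows that $T(U)=a^{wr(U)}$ for a diagram $U$ of the unknot, where $wr$ is the writhe, and $T(\mathcal{K}^r)=\delta^{r-1}\prod_{i=1}^r T(K_i)$ with $\delta=\frac{a-a^{-1}}{w}+1$. *)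

theory Defs
  imports "HOL-Library.Poly_Mapping" "HOL-Library.Product_Plus"
begin

section \<open>Unoriented link diagrams in the plane\<close>

text \<open>
  A diagram in general position with respect to the height function is cut by horizontal lines
  into slices, read from bottom to top. Every slice contains a single local minimum
  (\<open>Cup\<close>), local maximum (\<open>Cap\<close>) or crossing (drawn as an X), together with vertical
  strands; \<open>(s, i)\<close> has exactly \<open>i\<close> strands to the left of the singular piece \<open>s\<close>.
  Every planar isotopy class of link diagrams is represented in this way, and two such
  representations describe planar isotopic diagrams iff they are related by the moves
  \<open>planar_move\<close> below (Freyd--Yetter, Turaev).

  The overcrossing strand runs from the lower right to the upper left in a crossing \<open>Pos\<close>,
  and from the lower left to the upper right in a crossing \<open>Neg\<close>. Swinging it
  counterclockwise sweeps the left and the right region in the case of \<open>Pos\<close>, so that the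
  A-smoothing is horizontal, and the top and the bottom region in the case of \<open>Neg\<close>, so
  that the A-smoothing is vertical.
\<close>

datatype crossing = Pos | Neg

datatype piece = Cup | Cap | Cross crossing

type_synonym slice = "piece \<times> nat"

fun switch :: "crossing \<Rightarrow> crossing" where
  "switch Pos = Neg"
| "switch Neg = Pos"

fun ins :: "piece \<Rightarrow> nat" where
  "ins Cup = 0"
| "ins Cap = 2"
| "ins (Cross c) = 2"

fun outs :: "piece \<Rightarrow> nat" where
  "outs Cup = 2"
| "outs Cap = 0"
| "outs (Cross c) = 2"

text \<open>Number of strands at the top, starting with no strands at the bottom.\<close>

definition width :: "slice list \<Rightarrow> nat" where
  "width ss = fold (\<lambda>(s, i) n. n - ins s + outs s) ss 0"

definition is_link_diagram :: "slice list \<Rightarrow> bool" where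
  "is_link_diagram ss \<longleftrightarrow>
     ss \<noteq> [] \<and>
     (\<forall>k < length ss. snd (ss ! k) + ins (fst (ss ! k)) \<le> width (take k ss)) \<and>
     width ss = 0"

typedef link_diagram = "{ss. is_link_diagram ss}"
  morphisms slices Diagram
  by (intro exI[of _ "[(Cup, 0), (Cap, 0)]"])
     (auto simp: is_link_diagram_def width_def less_Suc_eq)


section \<open>Components\<close>

text \<open>
  The point \<open>(k, p)\<close> is the intersection of the \<open>p\<close>-th strand (counted from the left,
  starting with 0) with the horizontal line below slice \<open>k\<close>. Two points are adjacent if an arc
  of the link runs between them within one slice; at a crossing the arcs go straight through.
\<close>

definition points :: "slice list \<Rightarrow> (nat \<times> nat) set" where
  "points ss = {(k, p). k \<le> length ss \<and> p < width (take k ss)}"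

inductive slice_arc :: "nat \<Rightarrow> slice \<Rightarrow> nat \<times> nat \<Rightarrow> nat \<times> nat \<Rightarrow> bool" for k where
  left: "p < i \<Longrightarrow> slice_arc k (s, i) (k, p) (Suc k, p)"
| right: "i \<le> p \<Longrightarrow> slice_arc k (s, i) (k, p + ins s) (Suc k, p + outs s)"
| cup: "slice_arc k (Cup, i) (Suc k, i) (Suc k, i + 1)"
| cap: "slice_arc k (Cap, i) (k, i) (k, i + 1)"
| cross1: "slice_arc k (Cross c, i) (k, i) (Suc k, i + 1)"
| cross2: "slice_arc k (Cross c, i) (k, i + 1) (Suc k, i)"

definition adjacent :: "slice list \<Rightarrow> nat \<times> nat \<Rightarrow> nat \<times> nat \<Rightarrow> bool" where
  "adjacent ss x y \<longleftrightarrow>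
     x \<in> points ss \<and> y \<in> points ss \<and> (\<exists>k < length ss. slice_arc k (ss ! k) x y)"

definition same_component :: "link_diagram \<Rightarrow> nat \<times> nat \<Rightarrow> nat \<times> nat \<Rightarrow> bool" where
  "same_component L = equivclp (adjacent (slices L))"

definition components :: "link_diagram \<Rightarrow> (nat \<times> nat) set set" where
  "components L = points (slices L) // {(x, y). same_component L x y}"

definition is_knot_diagram :: "link_diagram \<Rightarrow> bool" where
  "is_knot_diagram L \<longleftrightarrow> card (components L) = 1"


section \<open>Planar isotopy and Reidemeister moves\<close>

text \<open>
  \<open>commute\<close> exchanges the heights of two pieces that lie side by side, \<open>zigzag1\<close> and
  \<open>zigzag2\<close> cancel a local maximum against an adjacent local minimum, and \<open>turn_cup\<close> and
  \<open>turn_cap\<close> rotate a crossing so that a local extremum of one of its strands passes through it.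
  The same strand stays on top there, but its slope at the crossing, and with it the type of the
  crossing, changes.
\<close>

inductive planar_move :: "slice list \<Rightarrow> slice list \<Rightarrow> bool" where
  commute: "i \<le> j \<Longrightarrow> planar_move [(s, i), (t, j + outs s)] [(t, j + ins s), (s, i)]"
| zigzag1: "planar_move [(Cup, i), (Cap, i + 1)] []"
| zigzag2: "planar_move [(Cup, i + 1), (Cap, i)] []"
| turn_cup: "planar_move [(Cup, i), (Cross c, i + 1)] [(Cup, i + 1), (Cross (switch c), i)]"
| turn_cap: "planar_move [(Cross c, i + 1), (Cap, i)] [(Cross (switch c), i), (Cap, i + 1)]"

text \<open>
  Up to planar isotopy, a kink is a curl to the right or to the left of an upward strand. Both
  passages through its crossing are upward. So a curl is negative if its crossing is \<open>Pos\<close>, and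
  positive if its crossing is \<open>Neg\<close>.
\<close>

inductive curl :: "crossing \<Rightarrow> slice list \<Rightarrow> bool" for c where
  curl_right: "curl c [(Cup, i + 1), (Cross c, i), (Cap, i + 1)]"
| curl_left: "curl c [(Cup, i), (Cross c, i + 1), (Cap, i)]"

inductive reidemeister1 :: "slice list \<Rightarrow> slice list \<Rightarrow> bool" where
  "curl c ss \<Longrightarrow> reidemeister1 ss []"

inductive reidemeister2 :: "slice list \<Rightarrow> slice list \<Rightarrow> bool" where
  "reidemeister2 [(Cross c, i), (Cross (switch c), i)] []"

text \<open>
  The side condition of the third move says that the over/under relation between its three
  strands is not cyclic, i.e. one strand is on top and one is at the bottom.
\<close>

inductive reidemeister3 :: "slice list \<Rightarrow> slice list \<Rightarrow> bool" where
  "y = x \<or> y = z \<Longrightarrow>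
     reidemeister3 [(Cross x, i), (Cross y, i + 1), (Cross z, i)]
                   [(Cross z, i + 1), (Cross y, i), (Cross x, i + 1)]"

definition local_move ::
  "(slice list \<Rightarrow> slice list \<Rightarrow> bool) \<Rightarrow> link_diagram \<Rightarrow> link_diagram \<Rightarrow> bool" where
  "local_move R L L' \<longleftrightarrow>
     (\<exists>us ss ss' vs. R ss ss' \<and> slices L = us @ ss @ vs \<and> slices L' = us @ ss' @ vs)"

definition regular_isotopic :: "link_diagram \<Rightarrow> link_diagram \<Rightarrow> bool" where
  "regular_isotopic =
     equivclp (local_move (sup planar_move (sup reidemeister2 reidemeister3)))"

definition isotopic :: "link_diagram \<Rightarrow> link_diagram \<Rightarrow> bool" where
  "isotopic =
     equivclp (local_move (sup planar_move (sup reidemeister1 (sup reidemeister2 reidemeister3))))"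

definition regular_isotopy_invariant :: "(link_diagram \<Rightarrow> 'a) \<Rightarrow> bool" where
  "regular_isotopy_invariant f \<longleftrightarrow> (\<forall>L L'. regular_isotopic L L' \<longrightarrow> f L = f L')"


section \<open>Conway quadruples and unions of unlinked knots\<close>

text \<open>
  The specified crossing is slice \<open>k\<close>. Every crossing of a diagram can be turned into the
  position required here by a planar isotopy.
\<close>

definition conway_quadruple ::
  "nat \<Rightarrow> link_diagram \<Rightarrow> link_diagram \<Rightarrow> link_diagram \<Rightarrow> link_diagram \<Rightarrow> bool" where
  "conway_quadruple k Lp Lm L0 Linf \<longleftrightarrow>
     (\<exists>us i vs. length us = k \<and>
        slices Lp = us @ [(Cross Pos, i)] @ vs \<and>
        slices Lm = us @ [(Cross Neg, i)] @ vs \<and>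
        slices L0 = us @ [(Cap, i), (Cup, i)] @ vs \<and>
        slices Linf = us @ vs)"

definition mixed_crossing :: "link_diagram \<Rightarrow> nat \<Rightarrow> bool" where
  "mixed_crossing L k \<longleftrightarrow>
     (\<exists>c i. k < length (slices L) \<and> slices L ! k = (Cross c, i) \<and>
        \<not> same_component L (k, i) (k, i + 1))"

text \<open>
  Stacking closed diagrams on top of each other is the split union. A diagram represents a split
  link with knots as split components iff Reidemeister moves (including the first) transform it
  into a split union of knot diagrams.
\<close>

definition unlinked_knots :: "nat \<Rightarrow> link_diagram \<Rightarrow> bool" where
  "unlinked_knots r L \<longleftrightarrow>
     (\<exists>Ks S. length Ks = r \<and> (\<forall>K \<in> set Ks. is_knot_diagram K) \<and>
        slices S = concat (map slices Ks) \<and> isotopic L S)"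

definition unknot :: link_diagram where
  "unknot = Diagram [(Cup, 0), (Cap, 0)]"


section \<open>The rings of values and the Dubrovnik polynomial\<close>

text \<open>
  Laurent polynomials are finitely supported functions from exponents to integer coefficients
  with the convolution product. The exponents are those of \<open>w, a\<close> and of \<open>z, w, a, E\<close>,
  respectively; only the exponent of \<open>z\<close> is restricted to natural numbers.
\<close>

type_synonym poly_wa = "(int \<times> int) \<Rightarrow>\<^sub>0 int"
type_synonym poly_zwaE = "(nat \<times> int \<times> int \<times> int) \<Rightarrow>\<^sub>0 int"

definition indet_w :: poly_wa where
  "indet_w = Poly_Mapping.single (1, 0) 1"

definition a_pow :: "int \<Rightarrow> poly_wa" where
  "a_pow n = Poly_Mapping.single (0, n) 1"

definition indet_z :: poly_zwaE where
  "indet_z = Poly_Mapping.single (1, 0, 0, 0) 1"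

definition E_pow :: "int \<Rightarrow> poly_zwaE" where
  "E_pow n = Poly_Mapping.single (0, 0, 0, n) 1"

text \<open>The inclusion of the smaller ring into the larger one.\<close>

definition embed_wa :: "poly_wa \<Rightarrow> poly_zwaE" where
  "embed_wa p =
     (\<Sum>(i, j) \<in> Poly_Mapping.keys p.
        Poly_Mapping.single (0, i, j, 0) (Poly_Mapping.lookup p (i, j)))"

definition is_dubrovnik :: "(link_diagram \<Rightarrow> poly_wa) \<Rightarrow> bool" where
  "is_dubrovnik T \<longleftrightarrow>
     regular_isotopy_invariant T \<and>
     (\<forall>k Lp Lm L0 Linf. conway_quadruple k Lp Lm L0 Linf \<longrightarrow>
        T Lp - T Lm = indet_w * (T L0 - T Linf)) \<and>
     (\<forall>L L'. local_move (\<lambda>ss ss'. curl Neg ss \<and> ss' = []) L L' \<longrightarrow> T L = a_pow 1 * T L') \<and>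
     (\<forall>L L'. local_move (\<lambda>ss ss'. curl Pos ss \<and> ss' = []) L L' \<longrightarrow> T L = a_pow (-1) * T L') \<and>
     T unknot = 1"

end

theory Submission
  imports Defs "HOL-Combinatorics.Stirling" "HOL-Combinatorics.Permutations"
begin

text \<open>
  Existence is shown by a state sum. For a diagram \<open>L\<close> with \<open>c\<close> components let
  \<open>D L = (\<Sum>k. (z / w) ^ (c - k) * e k * (\<Sum>\<pi>. (\<Prod>B \<in> \<pi>. T (L restricted to B))))\<close>, where \<open>\<pi>\<close> ranges over the
  partitions of the set of components into \<open>k\<close> blocks and
  \<open>e k = (\<Prod>i = 1..<k. delta / E - i * z * delta / w)\<close>. The partitions that separate the two strands of a
  mixed crossing cancel in \<open>D L\<^sub>+ - D L\<^sub>-\<close>, and to the others the skein relation of \<open>T\<close> applies. These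
  correspond to the partitions of the components of the smoothings, which are one fewer; this turns
  the factor \<open>w\<close> into \<open>z\<close>. As the arcs laid on top of one another span all tangles without bottom ends
  modulo the skein relations, \<open>T\<close> is multiplicative under split unions up to the factor \<open>delta\<close>. So the
  value on unlinked knots reduces to an identity for Stirling numbers.

  For uniqueness, consider the difference of two invariants. It does not change when mixed crossings
  are switched, up to its values on diagrams with fewer components. After such switches, one component
  of the link lies above the others and can be moved away from them. Hence the difference is determined
  by its values on unlinked knots, where it vanishes.
\<close>

section \<open>Tangles as lists of slices\<close>

text \<open>Components are a global feature of a list of slices, whereas all moves and skein
  relations are local. Components are therefore handled through colourings of the strands: a
  colouring is checked slice by slice, a local move induces a bijection of colourings, and a block
  of a partition is the sublink of one colour. Partitions into \<open>k\<close> blocks are counted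
  as surjective colourings by \<open>k\<close> colours, up to \<open>k!\<close> renamings, and the
  number of components enters only through the number of colourings by truth values. At a mixed
  crossing, the rest of the link joins each lower end to the diagonally opposite upper end. Hence
  both smoothings merge the same two components, which is what makes the partitions of the
  smoothings correspond to each other. The rules for \<open>T\<close> do not state its value on
  split unions. Multiplicativity must be derived from the skein relation, and for this a diagram is
  read from the bottom upwards, so that the part already read is a tangle with open ends at the top
  only.\<close>

fun fits :: "nat \<Rightarrow> slice list \<Rightarrow> bool" where
  "fits n [] \<longleftrightarrow> True"
| "fits n ((s, i) # ss) \<longleftrightarrow> i + ins s \<le> n \<and> fits (n - ins s + outs s) ss"

fun outw :: "nat \<Rightarrow> slice list \<Rightarrow> nat" where
  "outw n [] = n"
| "outw n ((s, i) # ss) = outw (n - ins s + outs s) ss"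

abbreviation closed :: "slice list \<Rightarrow> bool" where
  "closed ss \<equiv> fits 0 ss \<and> outw 0 ss = 0"

lemma fits_append [simp]: "fits n (us @ vs) \<longleftrightarrow> fits n us \<and> fits (outw n us) vs"
  by (induction us arbitrary: n) auto

lemma outw_append [simp]: "outw n (us @ vs) = outw (outw n us) vs"
  by (induction us arbitrary: n) auto

lemma outw_eq_fold: "outw n ss = fold (\<lambda>(s, i) n. n - ins s + outs s) ss n"
  by (induction ss arbitrary: n) auto

lemma width_eq_outw: "width ss = outw 0 ss"
  by (simp add: width_def outw_eq_fold)

lemma fits_iff_nth:
  "fits n ss \<longleftrightarrow> (\<forall>k < length ss. snd (ss ! k) + ins (fst (ss ! k)) \<le> outw n (take k ss))"
proof (induction ss arbitrary: n)
  case (Cons a ss)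
  obtain s i where a: "a = (s, i)" by force
  have *: "(\<forall>k < length (a # ss). P k) \<longleftrightarrow> P 0 \<and> (\<forall>k < length ss. P (Suc k))" for P
    by (auto simp: less_Suc_eq_0_disj)
  show ?case unfolding * using Cons a by simp
qed auto

lemma is_link_diagram_iff: "is_link_diagram ss \<longleftrightarrow> ss \<noteq> [] \<and> closed ss"
  by (auto simp: is_link_diagram_def fits_iff_nth width_eq_outw)

text \<open>Writing a width as \<open>m + ins s\<close> avoids the truncated subtraction of the
  defining equations; \<open>m\<close> is the number of strands that run past the piece. Many proofs
  below first bring a width into this form.\<close>

lemma fits_Cons_add: "fits (m + ins s) ((s, i) # ss) \<longleftrightarrow> i \<le> m \<and> fits (m + outs s) ss"
  and outw_Cons_add: "outw (m + ins s) ((s, i) # ss) = outw (m + outs s) ss"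
  by simp_all

lemma fits_Cons_piece [simp]:
  "fits n ((Cup, i) # ss) \<longleftrightarrow> i \<le> n \<and> fits (Suc (Suc n)) ss"
  "fits n ((Cap, i) # ss) \<longleftrightarrow> Suc (Suc i) \<le> n \<and> fits (n - 2) ss"
  "fits n ((Cross c, i) # ss) \<longleftrightarrow> Suc (Suc i) \<le> n \<and> fits n ss"
  by (auto simp: Suc_diff_Suc numeral_2_eq_2 dest: less_imp_Suc_add)

lemma outw_Cons_piece [simp]:
  "outw n ((Cup, i) # ss) = outw (Suc (Suc n)) ss"
  "outw n ((Cap, i) # ss) = outw (n - 2) ss"
  "Suc (Suc i) \<le> n \<Longrightarrow> outw n ((Cross c, i) # ss) = outw n ss"
  by (auto simp: Suc_diff_Suc numeral_2_eq_2 dest: less_imp_Suc_add)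

lemma fits_ConsE:
  assumes "fits n (a # ss)"
  obtains s i m where "a = (s, i)" "n = m + ins s" "i \<le> m" "fits (m + outs s) ss"
proof -
  obtain s i where a: "a = (s, i)" by force
  with assms have "n = (n - ins s) + ins s" "i \<le> n - ins s" "fits (n - ins s + outs s) ss" by auto
  with a that show ?thesis by blast
qed

declare fits.simps(2) [simp del] outw.simps(2) [simp del]

lemma fits_more: "fits n ss \<Longrightarrow> fits (n + e) ss \<and> outw (n + e) ss = outw n ss + e"
proof (induction ss arbitrary: n)
  case (Cons a ss)
  from Cons.prems obtain s i m where a: "a = (s, i)" "n = m + ins s" "i \<le> m" "fits (m + outs s) ss"
    by (rule fits_ConsE)
  have e: "m + ins s + e = (m + e) + ins s" "m + outs s + e = m + e + outs s" by simp_all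
  show ?case unfolding a(1,2) e(1) using Cons.IH[OF a(4)] a(3)
    unfolding fits_Cons_add outw_Cons_add e(2) by simp
qed auto

definition shift :: "nat \<Rightarrow> slice list \<Rightarrow> slice list" where
  "shift d = map (\<lambda>(s, i). (s, i + d))"

lemma shift_simps [simp]:
  "shift d [] = []" "shift d ((s, i) # ss) = (s, i + d) # shift d ss"
  "shift d (us @ vs) = shift d us @ shift d vs" "shift 0 ss = ss"
  by (auto simp: shift_def)

lemma fits_shift: "fits n ss \<Longrightarrow> fits (d + n) (shift d ss) \<and> outw (d + n) (shift d ss) = d + outw n ss"
proof (induction ss arbitrary: n)
  case (Cons a ss)
  from Cons.prems obtain s i m where a: "a = (s, i)" "n = m + ins s" "i \<le> m" "fits (m + outs s) ss"
    by (rule fits_ConsE)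
  have e: "d + (m + ins s) = (d + m) + ins s" "d + (m + outs s) = (d + m) + outs s" by simp_all
  show ?case unfolding a(1,2) e(1) shift_simps using Cons.IH[OF a(4)] a(3)
    unfolding fits_Cons_add outw_Cons_add e(2) by simp
qed auto

section \<open>Regular isotopy of tangles with fixed ends\<close>

definition reg_move :: "slice list \<Rightarrow> slice list \<Rightarrow> bool" where
  "reg_move = sup planar_move (sup reidemeister2 reidemeister3)"

lemma reg_move_iff: "reg_move l r \<longleftrightarrow> planar_move l r \<or> reidemeister2 l r \<or> reidemeister3 l r"
  by (simp add: reg_move_def)

text \<open>Both sides of a move are required to fit. This matters for moves with an empty side: the
  empty tangle fits every width, its partner only a width with enough strands.\<close>

inductive teq :: "nat \<Rightarrow> slice list \<Rightarrow> slice list \<Rightarrow> bool" for n where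
  teq_refl [simp]: "teq n a a"
| teq_sym: "teq n a b \<Longrightarrow> teq n b a"
| teq_trans: "teq n a b \<Longrightarrow> teq n b c \<Longrightarrow> teq n a c"
| teq_move: "reg_move l r \<Longrightarrow> fits n (us @ l @ vs) \<Longrightarrow> fits n (us @ r @ vs) \<Longrightarrow>
    teq n (us @ l @ vs) (us @ r @ vs)"

declare teq_trans [trans]

lemma switch_switch [simp]: "switch (switch c) = c"
  by (cases c) auto

lemma reg_move_outw: "reg_move l r \<Longrightarrow> fits n l \<Longrightarrow> outw n l = outw n r"
  by (auto simp: reg_move_iff fits.simps(2) outw.simps(2) elim!: planar_move.cases reidemeister2.cases reidemeister3.cases)

lemma teq_outw: "teq n a b \<Longrightarrow> outw n a = outw n b"
proof (induction rule: teq.induct)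
  case (teq_move l r us vs)
  then show ?case using reg_move_outw[of l r] by simp
qed auto

lemma teq_fits: "teq n a b \<Longrightarrow> fits n a \<longleftrightarrow> fits n b"
  by (induction rule: teq.induct) blast+

lemma teq_append: "teq n a b \<Longrightarrow> fits (outw n a) vs \<Longrightarrow> teq n (a @ vs) (b @ vs)"
proof (induction rule: teq.induct)
  case (teq_trans a b c)
  then show ?case by (metis teq_outw teq.teq_trans)
next
  case (teq_sym a b)
  then show ?case by (metis teq_outw teq.teq_sym)
next
  case (teq_move l r us ws)
  have *: "outw n (us @ r @ ws) = outw n (us @ l @ ws)"
    using teq_move by (simp add: reg_move_outw[of l r])
  show ?case using teq.teq_move[of l r n us "ws @ vs"] teq_move * by simp
qed auto

lemma teq_prepend: "teq (outw n us) a b \<Longrightarrow> fits n us \<Longrightarrow> teq n (us @ a) (us @ b)"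
proof (induction rule: teq.induct)
  case (teq_trans a b c)
  then show ?case by (metis teq.teq_trans)
next
  case (teq_sym a b)
  then show ?case by (metis teq.teq_sym)
next
  case (teq_move l r ws vs)
  show ?case using teq.teq_move[of l r n "us @ ws" "vs"] teq_move by simp
qed auto

lemma teq_Cons:
  assumes "teq (n - ins s + outs s) a b" "i + ins s \<le> n"
  shows "teq n ((s, i) # a) ((s, i) # b)"
  using teq_prepend[of n "[(s, i)]" a b] assms by (simp add: fits.simps(2) outw.simps(2))

lemma teq_ctx: "teq (outw n us) a b \<Longrightarrow> fits n (us @ a @ vs) \<Longrightarrow> teq n (us @ a @ vs) (us @ b @ vs)"
  by (auto intro!: teq_prepend teq_append)

lemma teq_local: "reg_move l r \<Longrightarrow> fits n l \<Longrightarrow> fits n r \<Longrightarrow> teq n l r"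
  using teq_move[of l r n "[]" "[]"] by simp

lemma teq_commute:
  assumes "i \<le> j" "j + ins s + ins t \<le> n"
  shows "teq n [(s, i), (t, j + outs s)] [(t, j + ins s), (s, i)]"
  using assms by (intro teq_local) (auto simp: fits.simps(2) reg_move_iff intro: planar_move.intros)

lemma teq_zigzag1: "i < n \<Longrightarrow> teq n [(Cup, i), (Cap, Suc i)] []"
  using planar_move.zigzag1[of i] by (intro teq_local) (auto simp: reg_move_iff)

lemma teq_zigzag2: "i < n \<Longrightarrow> teq n [(Cup, Suc i), (Cap, i)] []"
  using planar_move.zigzag2[of i] by (intro teq_local) (auto simp: reg_move_iff)

lemma teq_turn_cup:
  "i < n \<Longrightarrow> teq n [(Cup, i), (Cross c, Suc i)] [(Cup, Suc i), (Cross (switch c), i)]"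
  using planar_move.turn_cup[of i c] by (intro teq_local) (auto simp: reg_move_iff)

lemma teq_turn_cap:
  "i + 2 < n \<Longrightarrow> teq n [(Cross c, Suc i), (Cap, i)] [(Cross (switch c), i), (Cap, Suc i)]"
  using planar_move.turn_cap[of c i] by (intro teq_local) (auto simp: reg_move_iff)

lemma teq_r2: "i + 2 \<le> n \<Longrightarrow> teq n [(Cross c, i), (Cross (switch c), i)] []"
  by (intro teq_local) (auto simp: reg_move_iff reidemeister2.simps)

lemma teq_r3:
  assumes "y = x \<or> y = z" "i + 2 < n"
  shows "teq n [(Cross x, i), (Cross y, Suc i), (Cross z, i)]
    [(Cross z, Suc i), (Cross y, i), (Cross x, Suc i)]"
  using assms by (intro teq_local) (auto simp: reg_move_iff reidemeister3.simps)

text \<open>A piece to the right of a whole tangle is raised past it. Its position changes because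
  the tangle on its left changes its width from \<open>m\<close> to
  \<open>outw m xs\<close>.\<close>

lemma teq_commute_left:
  assumes "fits m xs" "m + j + ins t \<le> n"
  shows "teq n ((t, m + j) # xs) (xs @ [(t, outw m xs + j)])"
  using assms
proof (induction xs arbitrary: m n)
  case (Cons a xs)
  from Cons.prems(1) obtain s i m' where a: "a = (s, i)" "m = m' + ins s" "i \<le> m'"
    "fits (m' + outs s) xs" by (rule fits_ConsE)
  obtain e where n: "n = m' + ins s + j + ins t + e" using Cons.prems a le_Suc_ex by blast
  have ct: "teq n [(t, m + j), (s, i)] [(s, i), (t, m' + outs s + j)]"
    using teq_commute[of i "m' + j" s t n] a n by (auto intro: teq_sym simp: ac_simps)
  have w: "outw n [(s, i), (t, m' + outs s + j)] = m' + outs s + (j + outs t + e)"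
  proof -
    have "n = (m' + (j + ins t + e)) + ins s"
      "m' + (j + ins t + e) + outs s = m' + outs s + j + e + ins t" using n by simp_all
    then have "outw n [(s, i), (t, m' + outs s + j)] = m' + outs s + j + e + outs t"
      by (simp only: outw_Cons_add outw.simps(1))
    then show ?thesis by simp
  qed
  have "teq n ((t, m + j) # a # xs) ((s, i) # (t, m' + outs s + j) # xs)"
  proof -
    have "fits (outw n [(t, m + j), (s, i)]) xs"
      unfolding teq_outw[OF ct] w using fits_more[OF a(4)] by blast
    from teq_append[OF ct this] a show ?thesis by simp
  qed
  also have "teq n \<dots> ([(s, i)] @ xs @ [(t, outw (m' + outs s) xs + j)])"
    using teq_Cons[OF Cons.IH[OF a(4), of "n - ins s + outs s"], of i] a n by simp
  finally show ?case using a by (simp add: outw_Cons_add)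
qed auto

text \<open>The mirror case: the piece keeps its position, and the tangle on its right is displaced,
  by \<open>outs t\<close> while it is above the piece and by \<open>ins t\<close> once it is
  below.\<close>

lemma teq_commute_right:
  assumes "fits w xs" "j + ins t + w \<le> n"
  shows "teq n ((t, j) # shift (j + outs t) xs) (shift (j + ins t) xs @ [(t, j)])"
  using assms
proof (induction xs arbitrary: w n)
  case (Cons a xs)
  from Cons.prems(1) obtain s i w' where a: "a = (s, i)" "w = w' + ins s" "i \<le> w'"
    "fits (w' + outs s) xs" by (rule fits_ConsE)
  obtain e where n: "n = j + ins t + (w' + ins s) + e" using Cons.prems a le_Suc_ex by blast
  have ct: "teq n [(t, j), (s, i + (j + outs t))] [(s, i + (j + ins t)), (t, j)]"
    using teq_commute[of j "i + j" t s n] a n by (auto simp: ac_simps)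
  have w: "outw n [(t, j), (s, i + (j + outs t))] = j + outs t + (w' + outs s) + e"
  proof -
    have "n = (j + w' + ins s + e) + ins t"
      "j + w' + ins s + e + outs t = (j + w' + e + outs t) + ins s" using n by simp_all
    then have "outw n [(t, j), (s, i + (j + outs t))] = j + w' + e + outs t + outs s"
      by (simp only: outw_Cons_add outw.simps(1))
    then show ?thesis by simp
  qed
  have "teq n ((t, j) # shift (j + outs t) (a # xs))
    ((s, i + (j + ins t)) # (t, j) # shift (j + outs t) xs)"
  proof -
    have "fits (outw n [(t, j), (s, i + (j + outs t))]) (shift (j + outs t) xs)"
      unfolding w using fits_more[OF fits_shift[OF a(4), THEN conjunct1]] by blast
    from teq_append[OF ct this] a show ?thesis by simp
  qed
  also have "teq n \<dots> ([(s, i + (j + ins t))] @ shift (j + ins t) xs @ [(t, j)])"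
    using teq_Cons[OF Cons.IH[OF a(4), of "n - ins s + outs s"], of "i + (j + ins t)"] a n by simp
  finally show ?case using a by simp
qed auto

text \<open>The strand at position \<open>p\<close> moves to position \<open>q\<close> and back, on top of all others.\<close>

definition over_right :: "nat \<Rightarrow> nat \<Rightarrow> slice list" where
  "over_right p q = map (\<lambda>j. (Cross Neg, j)) [p..<q]"

definition over_left :: "nat \<Rightarrow> nat \<Rightarrow> slice list" where
  "over_left q p = map (\<lambda>j. (Cross Pos, j)) (rev [p..<q])"

lemma fits_crosses:
  "(\<forall>j \<in> set js. j + 2 \<le> n) \<Longrightarrow>
    fits n (map (\<lambda>j. (Cross c, j)) js) \<and> outw n (map (\<lambda>j. (Cross c, j)) js) = n"
  by (induction js) auto

lemma fits_over_right [simp]: "q < n \<or> q \<le> p \<Longrightarrow> fits n (over_right p q)"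
  and outw_over_right [simp]: "q < n \<or> q \<le> p \<Longrightarrow> outw n (over_right p q) = n"
  using fits_crosses[of "[p..<q]" n Neg] by (auto simp: over_right_def)

lemma fits_over_left [simp]: "q < n \<or> q \<le> p \<Longrightarrow> fits n (over_left q p)"
  and outw_over_left [simp]: "q < n \<or> q \<le> p \<Longrightarrow> outw n (over_left q p) = n"
  using fits_crosses[of "rev [p..<q]" n Pos] by (auto simp: over_left_def)

lemma over_right_same [simp]: "over_right p p = []" by (simp add: over_right_def)
lemma over_left_same [simp]: "over_left p p = []" by (simp add: over_left_def)

lemma over_right_split: "p \<le> i \<Longrightarrow> i \<le> q \<Longrightarrow> over_right p q = over_right p i @ over_right i q"
  unfolding over_right_def by (metis map_append le_Suc_ex upt_add_eq_append)

lemma over_left_split: "p \<le> i \<Longrightarrow> i \<le> q \<Longrightarrow> over_left q p = over_left q i @ over_left i p"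
  unfolding over_left_def map_append[symmetric] rev_append[symmetric]
  by (metis le_Suc_ex upt_add_eq_append)

lemma over_right_Suc [simp]: "over_right p (Suc p) = [(Cross Neg, p)]" by (simp add: over_right_def)
lemma over_left_Suc [simp]: "over_left (Suc p) p = [(Cross Pos, p)]" by (simp add: over_left_def)

lemma shift_crosses: "shift d (map (\<lambda>j. (Cross c, j)) js) = map (\<lambda>j. (Cross c, j)) (map (\<lambda>j. j + d) js)"
  by (simp add: shift_def o_def)

lemma map_add_upt_right: "map (\<lambda>j. j + d) [p..<q] = [p + d..<q + d]"
  by (induction q) auto

lemma shift_over_right [simp]: "shift d (over_right p q) = over_right (p + d) (q + d)"
  unfolding over_right_def shift_crosses map_add_upt_right ..

lemma shift_over_left [simp]: "shift d (over_left q p) = over_left (q + d) (p + d)"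
  unfolding over_left_def shift_crosses by (simp add: rev_map map_add_upt_right flip: rev_map)

lemma over_right_left:
  assumes "p \<le> q" "q < n"
  shows "teq n (over_right p q @ over_left q p) []"
  using assms
proof (induction "q - p" arbitrary: q)
  case (Suc d)
  then obtain q' where q: "q = Suc q'" "p \<le> q'" by (cases q) auto
  have "teq n (over_right p q @ over_left q p) (over_right p q' @ [] @ over_left q' p)"
    using teq_ctx[of n "over_right p q'" "[(Cross Neg, q'), (Cross Pos, q')]" "[]" "over_left q' p"]
      Suc.prems q teq_r2[of q' n Neg]
    by (simp add: over_right_split[of p q' "Suc q'"] over_left_split[of p q' "Suc q'"])
  also have "teq n \<dots> []" using Suc q by simp
  finally show ?case .
qed auto

lemma over_left_right:
  assumes "p \<le> q" "q < n"
  shows "teq n (over_left q p @ over_right p q) []"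
  using assms
proof (induction "q - p" arbitrary: p)
  case (Suc d)
  then have p: "p < q" by auto
  have "teq n (over_left q p @ over_right p q) (over_left q (Suc p) @ [] @ over_right (Suc p) q)"
    using teq_ctx[of n "over_left q (Suc p)" "[(Cross Pos, p), (Cross Neg, p)]" "[]" "over_right (Suc p) q"]
      Suc.prems p teq_r2[of p n Pos]
    by (simp add: over_right_split[of p "Suc p" q] over_left_split[of p "Suc p" q])
  also have "teq n \<dots> []" using Suc p by simp
  finally show ?case .
qed auto

text \<open>The strand on top passes a single piece: a turn and the second move for an extremum, the
  third move for a crossing. The side condition of the third move holds for every \<open>c\<close>,
  because both crossings of the strand on top are \<open>Neg\<close>.\<close>

lemma over_right_slide_local:
  assumes "i + ins s < n"
  shows "teq n ((s, Suc i) # over_right i (i + outs s)) (over_right i (i + ins s) @ [(s, i)])"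
proof (cases s)
  case Cup
  have *: "over_right i (Suc (Suc i)) = [(Cross Neg, i), (Cross Neg, Suc i)]"
    by (simp add: over_right_def)
  have "teq n ([] @ [(Cup, Suc i), (Cross Neg, i)] @ [(Cross Neg, Suc i)])
      ([] @ [(Cup, i), (Cross Pos, Suc i)] @ [(Cross Neg, Suc i)])"
    using teq_turn_cup[of i n Pos] assms Cup by (intro teq_ctx) (auto intro: teq_sym)
  also have "teq n \<dots> ([(Cup, i)] @ [(Cross Pos, Suc i), (Cross Neg, Suc i)] @ [])" by simp
  also have "teq n \<dots> ([(Cup, i)] @ [] @ [])"
    using teq_r2[of "Suc i" "n + 2" Pos] assms Cup by (intro teq_ctx) auto
  finally show ?thesis using Cup * by simp
next
  case Cap
  have *: "over_right i (Suc (Suc i)) = [(Cross Neg, i), (Cross Neg, Suc i)]"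
    by (simp add: over_right_def)
  have "teq n ([(Cross Neg, i)] @ [(Cross Neg, Suc i), (Cap, i)] @ [])
      ([(Cross Neg, i)] @ [(Cross Pos, i), (Cap, Suc i)] @ [])"
    using teq_turn_cap[of i n Neg] assms Cap by (intro teq_ctx) auto
  also have "teq n \<dots> ([] @ [(Cross Neg, i), (Cross Pos, i)] @ [(Cap, Suc i)])" by simp
  also have "teq n \<dots> ([] @ [] @ [(Cap, Suc i)])"
    using teq_r2[of i n Neg] assms Cap by (intro teq_ctx) auto
  finally show ?thesis using Cap * by (auto intro: teq_sym)
next
  case (Cross c)
  have *: "over_right i (Suc (Suc i)) = [(Cross Neg, i), (Cross Neg, Suc i)]"
    by (simp add: over_right_def)
  show ?thesis using teq_r3[of Neg Neg c i n] assms Cross * by (auto intro: teq_sym)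
qed

text \<open>Only the stretch next to \<open>i\<close> really meets the piece. The stretch before it
  lies to the left of the piece and the stretch after it to the right, and both merely exchange
  heights with the piece.\<close>

lemma over_right_slide:
  assumes "p \<le> i" "i \<le> q" "q + ins s < n"
  shows "teq n ((s, Suc i) # over_right p (q + outs s)) (over_right p (q + ins s) @ [(s, i)])"
proof -
  obtain m where n: "n = m + ins s" and q: "q < m"
    using assms le_Suc_ex[of "ins s" n] by (auto simp: ac_simps)
  have "teq n ((s, Suc i) # over_right p (q + outs s))
    ((s, Suc i) # over_right p i @ over_right i (i + outs s) @ over_right (i + outs s) (q + outs s))"
    using assms over_right_split[of p i "q + outs s"] over_right_split[of i "i + outs s" "q + outs s"]
    by simp
  also have "teq n \<dots> (over_right p i @ (s, Suc i) # over_right i (i + outs s) @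
      over_right (i + outs s) (q + outs s))"
    using teq_append[OF teq_commute_left[of "Suc i" "over_right p i" 0 s n],
        of "over_right i (i + outs s) @ over_right (i + outs s) (q + outs s)"] assms n q
    by (simp add: fits_Cons_add outw_Cons_add)
  also have "teq n \<dots> (over_right p i @ (over_right i (i + ins s) @ [(s, i)]) @
      over_right (i + outs s) (q + outs s))"
    using teq_ctx[of n "over_right p i" "(s, Suc i) # over_right i (i + outs s)"
        "over_right i (i + ins s) @ [(s, i)]"] over_right_slide_local[of i s n] assms n q
    by (simp add: fits_Cons_add outw_Cons_add)
  also have "teq n \<dots> ((over_right p i @ over_right i (i + ins s)) @
      ((s, i) # shift (i + outs s) (over_right 0 (q - i))))" using assms by (simp add: ac_simps)
  also have "teq n \<dots> ((over_right p i @ over_right i (i + ins s)) @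
      (shift (i + ins s) (over_right 0 (q - i)) @ [(s, i)]))"
  proof (intro teq_prepend teq_commute_right[of "n - (i + ins s)"])
    have "q - i < n - (i + ins s)" using assms by linarith
    then show "fits (n - (i + ins s)) (over_right 0 (q - i))" by simp
  qed (use assms in auto)
  also have "\<dots> = over_right p (q + ins s) @ [(s, i)]"
    using assms over_right_split[of p i "q + ins s"] over_right_split[of i "i + ins s" "q + ins s"]
    by (simp add: ac_simps)
  finally show ?thesis .
qed

text \<open>Conjugation of \<open>over_right_slide\<close>: passages to the left and to the right
  are inverse to each other by \<open>over_right_left\<close> and
  \<open>over_left_right\<close>.\<close>

lemma over_left_slide:
  assumes "p \<le> i" "i \<le> q" "q + ins s < n"
  shows "teq n (over_left (q + ins s) p @ [(s, Suc i)]) ((s, i) # over_left (q + outs s) p)"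
proof -
  let ?L = "over_left (q + ins s) p" and ?L' = "over_left (q + outs s) p"
  let ?R = "over_right p (q + ins s)" and ?R' = "over_right p (q + outs s)"
  obtain m where n: "n = m + ins s" and q: "q < m" "Suc i \<le> m"
    using assms le_Suc_ex[of "ins s" n] by (auto simp: ac_simps)
  have "teq n ((?L @ [(s, Suc i)]) @ []) ((?L @ [(s, Suc i)]) @ (?R' @ ?L'))"
    using assms n q teq_sym[OF over_right_left[of p "q + outs s" "m + outs s"]]
    by (intro teq_prepend) (auto simp: fits_Cons_add outw_Cons_add)
  also have "teq n \<dots> (?L @ ((s, Suc i) # ?R') @ ?L')" by simp
  also have "teq n \<dots> (?L @ (?R @ [(s, i)]) @ ?L')"
    using assms n q over_right_slide[of p i q s n]
    by (intro teq_ctx) (auto simp: fits_Cons_add outw_Cons_add)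
  also have "teq n \<dots> ((?L @ ?R) @ ((s, i) # ?L'))" by simp
  also have "teq n \<dots> ([] @ ((s, i) # ?L'))"
    using assms n q over_left_right[of p "q + ins s" n]
    by (intro teq_append) (auto simp: fits_Cons_add outw_Cons_add)
  finally show ?thesis by simp
qed

section \<open>Skein functions are determined by their value on the unknot\<close>

text \<open>A total extension to slice lists, so that values can be rewritten along
  \<open>teq\<close>. The default value 0 also applies to the empty list, which is not a link
  diagram.\<close>

definition on_list :: "(link_diagram \<Rightarrow> 'r::zero) \<Rightarrow> slice list \<Rightarrow> 'r" where
  "on_list F ss = (if is_link_diagram ss then F (Diagram ss) else 0)"

lemma slices_Diagram [simp]: "is_link_diagram ss \<Longrightarrow> slices (Diagram ss) = ss"
  by (simp add: Diagram_inverse)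

lemma is_link_diagram_slices [simp]: "is_link_diagram (slices L)"
  using slices by blast

lemma on_list_slices [simp]: "on_list F (slices L) = F L"
  by (simp add: on_list_def slices_inverse)

text \<open>A move must not lead to the empty list. It cannot, since a move with an empty side needs
  a strand to act on, and with no strands at the bottom this strand comes from the context.\<close>

lemma reg_move_nonempty:
  assumes "reg_move l r" "fits 0 (us @ l @ vs)"
  shows "us @ l @ vs \<noteq> []" "us @ r @ vs \<noteq> []"
  using assms
  by (auto simp: reg_move_iff elim!: planar_move.cases reidemeister2.cases reidemeister3.cases)

lemma curl_nonempty:
  assumes "curl c l" "fits 0 (us @ l @ vs)"
  shows "us @ l @ vs \<noteq> []" "us @ vs \<noteq> []"
  using assms by (auto elim!: curl.cases)

lemma curl_outw: "curl c l \<Longrightarrow> fits n l \<Longrightarrow> outw n l = n"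
  by (auto elim!: curl.cases)

lemma teq_regular_isotopic:
  assumes "teq 0 a b" "closed a"
  shows "(a = [] \<longleftrightarrow> b = []) \<and> (a \<noteq> [] \<longrightarrow> regular_isotopic (Diagram a) (Diagram b))"
  using assms
proof (induction rule: teq.induct)
  case (teq_sym a b)
  then have "closed a" using teq_fits teq_outw by metis
  with teq_sym show ?case unfolding regular_isotopic_def using equivclp_sym by metis
next
  case (teq_trans a b c)
  then have "closed b" using teq_fits teq_outw by metis
  from teq_trans.IH(1)[OF teq_trans.prems] teq_trans.IH(2)[OF this] show ?case
    by (auto simp: regular_isotopic_def intro: equivclp_trans)
next
  case (teq_move l r us vs)
  have "closed (us @ r @ vs)"
    using teq_move reg_move_outw[OF teq_move(1), of "outw 0 us"] by auto
  then have ld: "is_link_diagram (us @ l @ vs)" "is_link_diagram (us @ r @ vs)"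
    using reg_move_nonempty[OF teq_move(1,2)] teq_move(4) by (simp_all only: is_link_diagram_iff simp_thms)
  have "local_move (sup planar_move (sup reidemeister2 reidemeister3))
      (Diagram (us @ l @ vs)) (Diagram (us @ r @ vs))"
    unfolding local_move_def slices_Diagram[OF ld(1)] slices_Diagram[OF ld(2)]
    using teq_move(1) unfolding reg_move_def by blast
  then show ?case unfolding regular_isotopic_def using reg_move_nonempty[OF teq_move(1,2)] by auto
qed (auto simp: regular_isotopic_def)

lemma on_list_teq:
  assumes "regular_isotopy_invariant F" "teq 0 a b"
  shows "on_list F a = on_list F b"
proof (cases "is_link_diagram a")
  case True
  then show ?thesis
    using assms teq_regular_isotopic[OF assms(2)] teq_fits[OF assms(2)] teq_outw[OF assms(2)]
    by (auto simp: on_list_def is_link_diagram_iff regular_isotopy_invariant_def)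
next
  case False
  then have "\<not> is_link_diagram b"
    using teq_regular_isotopic[OF assms(2)] teq_fits[OF assms(2)] teq_outw[OF assms(2)]
    by (auto simp: is_link_diagram_iff)
  with False show ?thesis by (simp add: on_list_def)
qed

text \<open>The rules of the Dubrovnik polynomial without its value at the unknot, so that
  differences of such functions and their restrictions to one summand of a split union are covered.
  The inverse of \<open>w\<close> makes it possible to isolate a smoothing in a skein
  relation.\<close>

locale skein_function =
  fixes G :: "link_diagram \<Rightarrow> 'r::comm_ring_1" and w wi a ai :: 'r
  assumes inv: "regular_isotopy_invariant G"
    and skein: "\<And>k Lp Lm L0 Linf. conway_quadruple k Lp Lm L0 Linf \<Longrightarrow>
      G Lp - G Lm = w * (G L0 - G Linf)"
    and curl_Neg: "\<And>L L'. local_move (\<lambda>ss ss'. curl Neg ss \<and> ss' = []) L L' \<Longrightarrow> G L = a * G L'"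
    and curl_Pos: "\<And>L L'. local_move (\<lambda>ss ss'. curl Pos ss \<and> ss' = []) L L' \<Longrightarrow> G L = ai * G L'"
    and w: "w * wi = 1"
begin

abbreviation g :: "slice list \<Rightarrow> 'r" where
  "g \<equiv> on_list G"

fun framing :: "crossing \<Rightarrow> 'r" where
  "framing Neg = a"
| "framing Pos = ai"

lemma w_cancel: "w * x = 0 \<Longrightarrow> x = 0"
  using w by (metis mult.assoc mult.commute mult.right_neutral mult_zero_right)

lemma g_teq: "teq 0 x y \<Longrightarrow> g x = g y"
  by (rule on_list_teq[OF inv])

lemma g_teq_ctx:
  "teq (outw 0 us) x y \<Longrightarrow> fits 0 (us @ x @ vs) \<Longrightarrow> g (us @ x @ vs) = g (us @ y @ vs)"
  by (intro g_teq teq_ctx)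

lemma g_skein:
  assumes "closed (us @ (Cross c, i) # vs)"
  shows "g (us @ (Cross Pos, i) # vs) - g (us @ (Cross Neg, i) # vs)
    = w * (g (us @ (Cap, i) # (Cup, i) # vs) - g (us @ vs))"
proof -
  from assms have i: "Suc (Suc i) \<le> outw 0 us" "us \<noteq> []" by auto
  then have "Suc (Suc (outw 0 us - 2)) = outw 0 us" by arith
  with assms i have ld: "is_link_diagram (us @ (Cross Pos, i) # vs)" "is_link_diagram (us @ (Cross Neg, i) # vs)"
     "is_link_diagram (us @ (Cap, i) # (Cup, i) # vs)" "is_link_diagram (us @ vs)"
    by (auto simp: is_link_diagram_iff)
  then have "conway_quadruple (length us) (Diagram (us @ (Cross Pos, i) # vs))
    (Diagram (us @ (Cross Neg, i) # vs)) (Diagram (us @ (Cap, i) # (Cup, i) # vs)) (Diagram (us @ vs))"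
    by (auto simp: conway_quadruple_def)
  from skein[OF this] show ?thesis using ld by (simp add: on_list_def)
qed

lemma g_curl:
  assumes "curl c l" "closed (us @ l @ vs)"
  shows "g (us @ l @ vs) = framing c * g (us @ vs)"
proof -
  have ld: "is_link_diagram (us @ l @ vs)" "is_link_diagram (us @ vs)"
    using assms curl_nonempty[OF assms(1), of us vs] curl_outw[OF assms(1), of "outw 0 us"]
    by (auto simp: is_link_diagram_iff)
  have "local_move (\<lambda>ss ss'. curl c ss \<and> ss' = []) (Diagram (us @ l @ vs)) (Diagram (us @ vs))"
    unfolding local_move_def using ld assms
    by (intro exI[of _ us] exI[of _ l] exI[of _ "[]"] exI[of _ vs]) auto
  then have "G (Diagram (us @ l @ vs)) = framing c * G (Diagram (us @ vs))"
    by (cases c) (simp_all only: framing.simps curl_Neg curl_Pos)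
  with ld show ?thesis by (simp only: on_list_def if_True)
qed

text \<open>A crossing set directly on a cup is a kink in a form that \<open>curl\<close> does not
  list. Turning the cap of a listed curl through its crossing leads to this form; the turn changes
  the type of the crossing, which accounts for \<open>switch c\<close>.\<close>

lemma teq_cup_cross:
  assumes "i \<le> n"
  shows "teq n ((Cup, i) # [(Cup, i), (Cross (switch c), Suc i), (Cap, i)]) [(Cup, i), (Cross c, i)]"
proof -
  have "teq n ([(Cup, i), (Cup, i)] @ [(Cross (switch c), Suc i), (Cap, i)] @ [])
     ([(Cup, i), (Cup, i)] @ [(Cross c, i), (Cap, Suc i)] @ [])"
    using teq_turn_cap[of i "Suc (Suc (Suc (Suc n)))" "switch c"] assms by (intro teq_ctx) auto
  also have "teq n \<dots> ([] @ [(Cup, i), (Cup, i)] @ [(Cross c, i), (Cap, Suc i)])" by simp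
  also have "teq n \<dots> ([] @ [(Cup, i), (Cup, i + 2)] @ [(Cross c, i), (Cap, Suc i)])"
    using teq_commute[of i i Cup Cup n] assms by (intro teq_ctx) (auto intro: teq_sym)
  also have "teq n \<dots> ([(Cup, i)] @ [(Cup, i + 2), (Cross c, i)] @ [(Cap, Suc i)])" by simp
  also have "teq n \<dots> ([(Cup, i)] @ [(Cross c, i), (Cup, i + 2)] @ [(Cap, Suc i)])"
    using teq_commute[of i i "Cross c" Cup "n + 2"] assms by (intro teq_ctx) (auto intro: teq_sym)
  also have "teq n \<dots> ([(Cup, i), (Cross c, i)] @ [(Cup, Suc (Suc i)), (Cap, Suc i)] @ [])" by simp
  also have "teq n \<dots> ([(Cup, i), (Cross c, i)] @ [] @ [])"
    using teq_zigzag2[of "Suc i" "n + 2"] assms by (intro teq_ctx) auto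
  finally show ?thesis by simp
qed

lemma g_cup_cross:
  assumes "closed (us @ (Cup, i) # (Cross c, i) # vs)"
  shows "g (us @ (Cup, i) # (Cross c, i) # vs) = framing (switch c) * g (us @ (Cup, i) # vs)"
proof -
  let ?c = "[(Cup, i), (Cross (switch c), Suc i), (Cap, i)]"
  have "g (us @ [(Cup, i), (Cross c, i)] @ vs) = g (us @ ((Cup, i) # ?c) @ vs)"
    using assms teq_cup_cross[of i "outw 0 us" c] by (intro g_teq_ctx) (auto intro: teq_sym)
  also have "\<dots> = framing (switch c) * g ((us @ [(Cup, i)]) @ vs)"
    using g_curl[of "switch c" ?c "us @ [(Cup, i)]" vs] assms curl.curl_left[of "switch c" i] by auto
  finally show ?thesis by simp
qed

lemma teq_cross_cap:
  assumes "i + 2 \<le> n"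
  shows "teq n ([(Cup, i), (Cross (switch c), Suc i), (Cap, i)] @ [(Cap, i)]) [(Cross c, i), (Cap, i)]"
proof -
  have "teq n ([] @ [(Cup, i), (Cross (switch c), Suc i)] @ [(Cap, i), (Cap, i)])
     ([] @ [(Cup, Suc i), (Cross c, i)] @ [(Cap, i), (Cap, i)])"
    using teq_turn_cup[of i n "switch c"] assms by (intro teq_ctx) auto
  also have "teq n \<dots> ([(Cup, Suc i), (Cross c, i)] @ [(Cap, i), (Cap, i)] @ [])" by simp
  also have "teq n \<dots> ([(Cup, Suc i), (Cross c, i)] @ [(Cap, i + 2), (Cap, i)] @ [])"
    using teq_commute[of i i Cap Cap "n + 2"] assms by (intro teq_ctx) auto
  also have "teq n \<dots> ([(Cup, Suc i)] @ [(Cross c, i), (Cap, i + 2)] @ [(Cap, i)])" by simp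
  also have "teq n \<dots> ([(Cup, Suc i)] @ [(Cap, i + 2), (Cross c, i)] @ [(Cap, i)])"
    using teq_commute[of i i "Cross c" Cap "n + 2"] assms by (intro teq_ctx) auto
  also have "teq n \<dots> ([] @ [(Cup, Suc i), (Cap, Suc (Suc i))] @ [(Cross c, i), (Cap, i)])" by simp
  also have "teq n \<dots> ([] @ [] @ [(Cross c, i), (Cap, i)])"
    using teq_zigzag1[of "Suc i" n] assms by (intro teq_ctx) auto
  finally show ?thesis by simp
qed

lemma g_cross_cap:
  assumes "closed (us @ (Cross c, i) # (Cap, i) # vs)"
  shows "g (us @ (Cross c, i) # (Cap, i) # vs) = framing (switch c) * g (us @ (Cap, i) # vs)"
proof -
  let ?c = "[(Cup, i), (Cross (switch c), Suc i), (Cap, i)]"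
  have "g (us @ [(Cross c, i), (Cap, i)] @ vs) = g (us @ (?c @ [(Cap, i)]) @ vs)"
    using assms teq_cross_cap[of i "outw 0 us" c] by (intro g_teq_ctx) (auto intro: teq_sym)
  also have "\<dots> = framing (switch c) * g (us @ (Cap, i) # vs)"
    using g_curl[of "switch c" ?c us "(Cap, i) # vs"] assms curl.curl_left[of "switch c" i] by auto
  finally show ?thesis by simp
qed

end

text \<open>An arc laid on top of \<open>m\<close> strands, from position \<open>p\<close> to the rightmost position. Stacks of such
  arcs span the skein module of tangles without strands at the bottom.\<close>

definition arc :: "nat \<Rightarrow> nat \<Rightarrow> slice list" where
  "arc m p = (Cup, m) # over_left m p"

inductive std :: "nat \<Rightarrow> slice list \<Rightarrow> bool" where
  std_Nil: "std 0 []"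
| std_arc: "std m u \<Longrightarrow> p \<le> m \<Longrightarrow> std (m + 2) (u @ arc m p)"

lemma fits_arc [simp]: "fits m (arc m p)" and outw_arc [simp]: "outw m (arc m p) = Suc (Suc m)"
  by (simp_all add: arc_def)

lemma std_fits: "std n u \<Longrightarrow> fits 0 u \<and> outw 0 u = n"
  by (induction rule: std.induct) auto

text \<open>The arc acts only on positions to the right of the piece, so this is a mere exchange of
  heights.\<close>

lemma arc_commute_left:
  assumes "j \<le> p" "p \<le> m"
  shows "teq (m + ins t) (arc (m + ins t) (p + ins t) @ [(t, j)]) ((t, j) # arc (m + outs t) (p + outs t))"
proof -
  let ?xs = "arc (m - j) (p - j)"
  have "shift (j + e) ?xs = arc (m + e) (p + e)" for e
    using assms by (simp add: arc_def add.assoc[symmetric])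
  with teq_commute_right[of "m - j" ?xs j t "m + ins t"] assms show ?thesis
    by (auto intro: teq_sym)
qed

text \<open>Here the piece lies under the arc, which is on top of everything and can be pulled
  across it. \<open>Suc j\<close> becomes \<open>j\<close> because the left end of the arc is then
  no longer to the left of the piece.\<close>

lemma arc_slide:
  assumes "p \<le> j" "j \<le> m"
  shows "teq (m + ins t) (arc (m + ins t) p @ [(t, Suc j)]) ((t, j) # arc (m + outs t) p)"
proof -
  have "teq (m + ins t) (((Cup, m + ins t) # over_left (m + ins t) p) @ [(t, Suc j)])
     ((Cup, m + ins t) # (t, j) # over_left (m + outs t) p)"
    using over_left_slide[of p j m t "m + ins t + 2"] assms
      teq_Cons[of "m + ins t" Cup "over_left (m + ins t) p @ [(t, Suc j)]" _ "m + ins t"]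
    by simp
  also have "teq (m + ins t) \<dots> ([] @ [(Cup, m + ins t), (t, j)] @ over_left (m + outs t) p)" by simp
  also have "teq (m + ins t) \<dots> ([] @ [(t, j), (Cup, m + outs t)] @ over_left (m + outs t) p)"
  proof (intro teq_ctx)
    show "fits (m + ins t) ([] @ [(Cup, m + ins t), (t, j)] @ over_left (m + outs t) p)"
      using fits_Cons_add[of "m + 2" t j "over_left (m + outs t) p"] assms by (simp add: ac_simps)
  qed (use teq_commute[of j m t Cup "m + ins t"] assms in \<open>auto intro: teq_sym\<close>)
  finally show ?thesis by (simp add: arc_def)
qed

text \<open>A cap between a strand and the left end of the arc next to it straightens the arc: that
  strand now runs to the right above all others. Each step turns the cap through the last crossing
  of the arc, which changes \<open>Pos\<close> into \<open>Neg\<close>.\<close>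

lemma arc_cap:
  assumes "q \<le> m"
  shows "teq (Suc m) (arc (Suc m) (Suc q) @ [(Cap, q)]) (over_right q m)"
  using assms
proof (induction "m - q" arbitrary: q)
  case 0
  then show ?case using teq_zigzag2[of m "Suc m"] by (simp add: arc_def)
next
  case (Suc d)
  from Suc.hyps(2) have q: "q < m" "Suc q \<le> m" "d = m - Suc q" by linarith+
  have "arc (Suc m) (Suc q) @ [(Cap, q)] = arc (Suc m) (Suc (Suc q)) @ [(Cross Pos, Suc q), (Cap, q)] @ []"
    using over_left_split[of "Suc q" "Suc (Suc q)" "Suc m"] q by (simp add: arc_def)
  also have "teq (Suc m) \<dots> (arc (Suc m) (Suc (Suc q)) @ [(Cross Neg, q), (Cap, Suc q)] @ [])"
    using teq_turn_cap[of q "Suc m + 2" Pos] q by (intro teq_ctx) auto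
  also have "teq (Suc m) \<dots> ((arc (Suc m) (Suc (Suc q)) @ [(Cross Neg, q)]) @ [(Cap, Suc q)])" by simp
  also have "teq (Suc m) \<dots> (((Cross Neg, q) # arc (Suc m) (Suc (Suc q))) @ [(Cap, Suc q)])"
  proof (rule teq_append)
    have "m = Suc (m - 1)" using q by auto
    then show "teq (Suc m) (arc (Suc m) (Suc (Suc q)) @ [(Cross Neg, q)])
        ((Cross Neg, q) # arc (Suc m) (Suc (Suc q)))"
      using arc_commute_left[of q q "m - 1" "Cross Neg"] q by simp
  qed (use q in auto)
  also have "teq (Suc m) \<dots> ((Cross Neg, q) # over_right (Suc q) m)"
    using teq_Cons[OF _ , of "Suc m" "Cross Neg" "arc (Suc m) (Suc (Suc q)) @ [(Cap, Suc q)]"]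
      Suc.hyps(1)[OF q(3,2)] q by (simp add: Suc_diff_Suc)
  also have "\<dots> = over_right q m"
    using over_right_split[of q "Suc q" m] q by simp
  finally show ?case .
qed

lemma set_over_left: "set (over_left q p) = (\<lambda>j. (Cross Pos, j)) ` {p..<q}"
  by (simp add: over_left_def)

lemma set_over_right: "set (over_right p q) = (\<lambda>j. (Cross Neg, j)) ` {p..<q}"
  by (simp add: over_right_def)

section \<open>Reducing a tangle to stacks of arcs, slice by slice\<close>

context skein_function
begin

text \<open>Vanishing is tested below stacks of arcs only. The empty stack is the only one without
  ends, so \<open>vanishes 0 vs\<close> is just \<open>g vs = 0\<close>.\<close>

definition vanishes :: "nat \<Rightarrow> slice list \<Rightarrow> bool" where
  "vanishes n vs \<longleftrightarrow> (\<forall>u. std n u \<longrightarrow> g (u @ vs) = 0)"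

text \<open>Dual form of the statement that a stack followed by the slice \<open>x\<close> is a
  combination of stacks: it speaks of the continuations that kill all stacks, so no linear
  combinations have to be formed. An empty \<open>vs\<close> must be excluded, since for a cap on a
  single arc it would compare the unknot with the default value of the empty list.\<close>

definition absorbs :: "nat \<Rightarrow> slice \<Rightarrow> bool" where
  "absorbs n x \<longleftrightarrow> (\<forall>vs. vs \<noteq> [] \<longrightarrow> fits n (x # vs) \<longrightarrow> outw n (x # vs) = 0 \<longrightarrow>
     vanishes (outw n [x]) vs \<longrightarrow> vanishes n (x # vs))"

lemma vanishesD: "vanishes n vs \<Longrightarrow> std n u \<Longrightarrow> g (u @ vs) = 0"
  by (simp add: vanishes_def)

lemma absorbsD:
  assumes "absorbs n x" "vanishes m vs" "outw n [x] = m" "vs \<noteq> []" "fits n [x]" "fits m vs" "outw m vs = 0"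
  shows "vanishes n (x # vs)"
  using assms outw_append[of n "[x]" vs] fits_append[of n "[x]" vs] by (simp add: absorbs_def)

lemma vanishes_arc:
  assumes "vanishes (Suc (Suc n)) vs" "p \<le> n"
  shows "vanishes n (arc n p @ vs)"
  unfolding vanishes_def
proof (intro allI impI)
  fix u assume "std n u"
  with std_arc[of n u p] assms(2) have "std (Suc (Suc n)) (u @ arc n p)" by simp
  from vanishesD[OF assms(1) this] show "g (u @ arc n p @ vs) = 0" by simp
qed

lemma vanishes_crosses:
  assumes "\<And>x. x \<in> set xs \<Longrightarrow> (\<exists>c i. x = (Cross c, i)) \<and> absorbs n x"
    and "vanishes n vs" "fits n vs" "outw n vs = 0" "vs \<noteq> []" "fits n xs"
  shows "vanishes n (xs @ vs) \<and> fits n (xs @ vs) \<and> outw n (xs @ vs) = 0"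
  using assms
proof (induction xs)
  case (Cons x xs)
  from Cons.prems(1)[of x] obtain c i where x: "x = (Cross c, i)" and a: "absorbs n x" by auto
  have "vanishes n (xs @ vs)" "fits n (xs @ vs)" "outw n (xs @ vs) = 0"
    using Cons.IH Cons.prems x by auto
  moreover from this have "vanishes n (x # xs @ vs)"
    using absorbsD[OF a, of n "xs @ vs"] Cons.prems x by auto
  ultimately show ?case using Cons.prems x by auto
qed auto

lemma g_std_teq:
  assumes "std m u" "teq m x y" "fits m (x @ vs)"
  shows "g (u @ x @ vs) = g (u @ y @ vs)"
  using assms std_fits[OF assms(1)] by (intro g_teq_ctx) auto

text \<open>As both smoothings vanish, the type of the crossing does not matter, and the more
  convenient type can be chosen in each case below.\<close>

lemma vanishes_skein:
  assumes "std n u" "closed (u @ (Cross c, i) # vs)" "vanishes n ((Cap, i) # (Cup, i) # vs)"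
    "vanishes n vs" "g (u @ (Cross c, i) # vs) = 0"
  shows "g (u @ (Cross c', i) # vs) = 0"
proof -
  have "g (u @ (Cross Pos, i) # vs) - g (u @ (Cross Neg, i) # vs) = 0"
    using g_skein[OF assms(2)] vanishesD[OF assms(3,1)] vanishesD[OF assms(4,1)] by simp
  with assms(5) show ?thesis by (cases c; cases c') auto
qed

text \<open>The hypothesis is supplied by an induction on the number of ends of a stack:
  \<open>m\<close> ends remain when the topmost arc is removed.\<close>

context
  fixes m :: nat
  assumes IH: "\<And>t j. j + ins t \<le> m \<Longrightarrow> absorbs m (t, j)"
begin

lemma IH_crosses:
  assumes "vanishes m vs" "fits m vs" "outw m vs = 0" "vs \<noteq> []" "fits m xs"
    "\<forall>x \<in> set xs. \<exists>c i. x = (Cross c, i) \<and> i + 2 \<le> m"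
  shows "vanishes m (xs @ vs)"
  using vanishes_crosses[of xs m vs] assms IH by fastforce

text \<open>If the slice can be moved below the topmost arc, the induction hypothesis absorbs it
  into the smaller stack, and the arc is put back on top of the result.\<close>

lemma vanishes_arc_slide:
  assumes u: "std m u" and p: "p \<le> m" and p': "p' \<le> m'"
    and eq: "teq m (arc m p @ [x]) (x' # arc m' p')" and x': "outw m [x'] = m'" "fits m [x']"
    and vs: "vs \<noteq> []" "fits (m + 2) (x # vs)" "outw (m + 2) (x # vs) = 0"
      "vanishes (outw (m + 2) [x]) vs"
  shows "g (u @ arc m p @ x # vs) = 0"
proof -
  obtain t j where t: "x' = (t, j)" by force
  have tj: "j + ins t \<le> m" using x' t by (simp add: fits.simps)
  have w: "outw (m + 2) [x] = m' + 2"
    using teq_outw[OF eq] x' outw_append[of m "[x']" "arc m' p'"] by simp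
  have vs': "fits (m' + 2) vs" "outw (m' + 2) vs = 0" "vanishes (m' + 2) vs"
    using vs w fits_append[of "m + 2" "[x]" vs] outw_append[of "m + 2" "[x]" vs] by simp_all
  then have "vanishes m' (arc m' p' @ vs)" using vanishes_arc p' by simp
  then have "vanishes m (x' # arc m' p' @ vs)"
    using absorbsD[OF IH[OF tj], of m' "arc m' p' @ vs"] t x' vs' vs by simp
  from vanishesD[OF this u] have "g (u @ (x' # arc m' p') @ vs) = 0" by simp
  moreover have "g (u @ (arc m p @ [x]) @ vs) = g (u @ (x' # arc m' p') @ vs)"
  proof (rule g_std_teq[OF u eq])
    show "fits m ((arc m p @ [x]) @ vs)" using vs(2) by simp
  qed
  ultimately show ?thesis by simp
qed

text \<open>The ends of the topmost arc are at the positions \<open>p\<close> and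
  \<open>m + 1\<close>; the condition on \<open>j\<close> says that the piece touches neither of
  them.\<close>

lemma vanishes_far:
  assumes u: "std m u" and p: "p \<le> m"
    and j: "j + ins t \<le> p \<or> p < j \<and> j + ins t \<le> Suc m"
    and vs: "vs \<noteq> []" "fits (m + 2) ((t, j) # vs)" "outw (m + 2) ((t, j) # vs) = 0"
      "vanishes (outw (m + 2) [(t, j)]) vs"
  shows "g (u @ arc m p @ (t, j) # vs) = 0"
  using j
proof
  assume j: "j + ins t \<le> p"
  obtain p0 where p0: "p = p0 + ins t" "j \<le> p0" using j le_Suc_ex[of "j + ins t" p] by (auto simp: ac_simps)
  obtain m0 where m0: "m = m0 + ins t" "p0 \<le> m0" using p0 p le_Suc_ex[of p m] by (auto simp: ac_simps)
  show ?thesis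
    using arc_commute_left[of j p0 m0 t] p0 m0 p
      vanishes_arc_slide[OF u p _ _ _ _ vs, of "p0 + outs t" "m0 + outs t" "(t, j)"]
    by (simp add: fits_Cons_add outw_Cons_add)
next
  assume j: "p < j \<and> j + ins t \<le> Suc m"
  obtain j0 where j0: "j = Suc j0" "p \<le> j0" using j by (cases j) auto
  obtain m0 where m0: "m = m0 + ins t" "j0 \<le> m0" using j0 j le_Suc_ex[of "j0 + ins t" m] by (auto simp: ac_simps)
  show ?thesis
    using arc_slide[of p j0 m0 t] j0 m0 p
      vanishes_arc_slide[OF u p _ _ _ _ vs, of p "m0 + outs t" "(t, j0)"]
    by (simp add: fits_Cons_add outw_Cons_add)
qed

lemma std_m2_cases:
  assumes "std (Suc (Suc m)) v"
  obtains u p where "std m u" "p \<le> m" "v = u @ arc m p"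
  using assms by (cases rule: std.cases) auto

lemma absorbs_cup:
  assumes "j \<le> m + 2"
  shows "absorbs (Suc (Suc m)) (Cup, j)"
  unfolding absorbs_def
proof (intro allI impI, unfold vanishes_def, intro allI impI)
  fix vs v
  assume vs: "vs \<noteq> []" "fits (Suc (Suc m)) ((Cup, j) # vs)" "outw (Suc (Suc m)) ((Cup, j) # vs) = 0"
    "\<forall>u. std (outw (Suc (Suc m)) [(Cup, j)]) u \<longrightarrow> g (u @ vs) = 0" and v: "std (Suc (Suc m)) v"
  have van: "vanishes (Suc (Suc (Suc (Suc m)))) vs" using vs(4) by (simp add: vanishes_def)
  from v obtain u p where u: "std m u" "p \<le> m" "v = u @ arc m p" by (rule std_m2_cases)
  show "g (v @ (Cup, j) # vs) = 0"
  proof (cases "j = m + 2")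
    \<comment> \<open>A cup to the right of all strands is itself a new topmost arc.\<close>
    case True
    then show ?thesis
      using vanishesD[OF vanishes_arc[OF van, of "Suc (Suc m)"] v] by (simp add: arc_def)
  next
    case False
    then have "j + ins Cup \<le> p \<or> p < j \<and> j + ins Cup \<le> Suc m" using assms by auto
    from vanishes_far[OF u(1,2) this, of vs] vs van u show ?thesis by simp
  qed
qed

lemma vanishes_cap_left:
  assumes "std m u" "q < m" "vs \<noteq> []" "fits m vs" "outw m vs = 0" "vanishes m vs"
  shows "g (u @ arc m (Suc q) @ (Cap, q) # vs) = 0"
proof -
  obtain m1 where m: "m = Suc m1" using assms by (cases m) auto
  have "g (u @ (arc m (Suc q) @ [(Cap, q)]) @ vs) = g (u @ over_right q m1 @ vs)"
    using assms m arc_cap[of q m1] by (intro g_std_teq[OF assms(1)]) auto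
  also have "\<dots> = 0"
    using assms m by (intro vanishesD[OF IH_crosses assms(1)]) (auto simp: set_over_right)
  finally show ?thesis by simp
qed

text \<open>A circle next to a strand is one smoothing of a crossing between the two. With either
  crossing type the strand has a curl, and the other smoothing is the strand alone, so the skein
  relation leaves \<open>w\<close> times the value in question.\<close>

lemma vanishes_circle:
  assumes "std m u" "vs \<noteq> []" "fits m vs" "outw m vs = 0" "vanishes m vs"
  shows "g (u @ (Cup, m) # (Cap, m) # vs) = 0"
proof (cases m)
  \<comment> \<open>With no strand beside the circle, the crossing is placed on the first cup of the
    continuation.\<close>
  case 0
  with assms(1) have u: "u = []" by (cases rule: std.cases) auto
  obtain vs' where vs': "vs = (Cup, 0) # vs'"
    using assms 0 by (cases vs; cases "hd vs"; cases "fst (hd vs)") auto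
  have cl: "closed ([(Cup, 0)] @ (Cross Pos, 0) # vs')" using assms 0 vs' by simp
  have z: "g ((Cup, 0) # vs') = 0" using vanishesD[OF assms(5,1)] u vs' by simp
  have "g ([] @ (Cup, 0) # (Cross c, 0) # vs') = 0" for c
    using g_cup_cross[of "[]" 0 c vs'] cl z by simp
  then show ?thesis using g_skein[OF cl] z u 0 vs' w_cancel by simp
next
  case (Suc q)
  have fu: "fits 0 u" "outw 0 u = m" using std_fits[OF assms(1)] by auto
  have z: "g (u @ vs) = 0" using vanishesD[OF assms(5,1)] .
  have cl: "closed ((u @ [(Cup, m)]) @ (Cross c, q) # (Cap, m) # vs)" for c using assms fu Suc by simp
  have *: "g ((u @ [(Cup, m)]) @ (Cross c, q) # (Cap, m) # vs) = 0" for c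
    using g_curl[OF curl.curl_right[of c q], of u vs] cl z Suc by simp
  have "g ((u @ [(Cup, m)]) @ (Cap, q) # (Cup, q) # (Cap, m) # vs) = g (u @ [(Cup, q), (Cap, m)] @ vs)"
    using g_teq_ctx[of u "[(Cup, m), (Cap, q)]" "[]" "[(Cup, q), (Cap, m)] @ vs"]
      teq_zigzag2[of q m] assms fu Suc by simp
  also have "\<dots> = g (u @ [] @ vs)"
    using teq_zigzag1[of q m] assms fu Suc by (intro g_teq_ctx) auto
  finally have "w * g ((u @ [(Cup, m)]) @ (Cap, m) # vs) = 0"
    using g_skein[OF cl] * z by (simp add: algebra_simps)
  then show ?thesis using w_cancel by simp
qed

lemma absorbs_cap:
  assumes "j \<le> m"
  shows "absorbs (Suc (Suc m)) (Cap, j)"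
  unfolding absorbs_def
proof (intro allI impI, unfold vanishes_def, intro allI impI)
  fix vs v
  assume vs: "vs \<noteq> []" "fits (Suc (Suc m)) ((Cap, j) # vs)" "outw (Suc (Suc m)) ((Cap, j) # vs) = 0"
    "\<forall>u. std (outw (Suc (Suc m)) [(Cap, j)]) u \<longrightarrow> g (u @ vs) = 0" and v: "std (Suc (Suc m)) v"
  have van: "vanishes m vs" "fits m vs" "outw m vs = 0" using vs by (simp_all add: vanishes_def)
  from v obtain u p where u: "std m u" "p \<le> m" "v = u @ arc m p" by (rule std_m2_cases)
  have fu: "fits 0 u" "outw 0 u = m" using std_fits[OF u(1)] by auto
  \<comment> \<open>The cap misses both ends of the arc, joins its left end to the neighbour on the
    left or on the right, closes the arc up, or joins its right end to a neighbour.\<close>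
  consider "j + ins Cap \<le> p \<or> p < j \<and> j + ins Cap \<le> Suc m" | "p = Suc j" | "p = j" "j < m"
    | "p = m" "j = m" | "p < j" "j = m" using assms u(2) by fastforce
  then show "g (v @ (Cap, j) # vs) = 0"
  proof cases
    case 1
    from vanishes_far[OF u(1,2) this, of vs] vs van u show ?thesis by simp
  next
    case 2
    then show ?thesis using vanishes_cap_left[OF u(1), of j vs] van vs u by simp
  next
    case 3
    \<comment> \<open>The cap joins the left end of the arc to the strand that the arc has crossed
      last, so this last crossing is a kink.\<close>
    have "u @ arc m p @ (Cap, j) # vs = (u @ arc m (Suc j)) @ (Cross Pos, j) # (Cap, j) # vs"
      using over_left_split[of j "Suc j" m] 3 by (simp add: arc_def)
    then have "g (u @ arc m p @ (Cap, j) # vs) = framing (switch Pos) * g (u @ arc m (Suc j) @ (Cap, j) # vs)"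
      using g_cross_cap[of "u @ arc m (Suc j)" Pos j vs] 3 van fu by simp
    with vanishes_cap_left[OF u(1) 3(2) vs(1) van(2,3,1)] u show ?thesis by simp
  next
    case 4
    then show ?thesis using vanishes_circle[OF u(1) vs(1) van(2,3,1)] u by (simp add: arc_def)
  next
    case 5
    then obtain q where q: "m = Suc q" "p \<le> q" by (cases m) auto
    \<comment> \<open>The cap is lowered along the right end of the arc to the first crossing of the
      arc, with which it forms a curl.\<close>
    have "teq (m + 2) ((Cap, m) # over_left q p) (over_left q p @ [(Cap, m)])"
      using teq_commute_left[of m "over_left q p" 0 Cap "m + 2"] q by simp
    then have eq: "teq (m + 2) (over_left q p @ [(Cap, m)]) ((Cap, m) # over_left q p)" by (rule teq_sym)
    have "g (v @ (Cap, j) # vs) = g ((u @ [(Cup, m), (Cross Pos, q)]) @ (over_left q p @ [(Cap, m)]) @ vs)"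
      using over_left_split[of p q m] 5 q u by (simp add: arc_def)
    also have "\<dots> = g ((u @ [(Cup, m), (Cross Pos, q)]) @ ((Cap, m) # over_left q p) @ vs)"
      using eq fu q van by (intro g_teq_ctx) auto
    also have "\<dots> = framing Pos * g (u @ over_left q p @ vs)"
      using g_curl[OF curl.curl_right[of Pos q], of u "over_left q p @ vs"] fu q van by simp
    also have "g (u @ over_left q p @ vs) = 0"
      using van q vs by (intro vanishesD[OF IH_crosses u(1)]) (auto simp: set_over_left)
    finally show ?thesis by simp
  qed
qed

lemma vanishes_cap_cup:
  assumes "j \<le> m" "fits (m + 2) vs" "outw (m + 2) vs = 0" "vs \<noteq> []" "vanishes (m + 2) vs"
  shows "vanishes (m + 2) ((Cap, j) # (Cup, j) # vs)"
proof -
  have "vanishes m ((Cup, j) # vs)"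
    using absorbsD[OF IH[of j Cup], of "m + 2" vs] assms by simp
  then show ?thesis
    using absorbsD[OF absorbs_cap[of j], of m "(Cup, j) # vs"] assms by simp
qed

text \<open>For each stack one type \<open>c\<close> suffices, because the smoothings are absorbed
  already: the cap by the preceding case, the cup by the hypothesis on \<open>m\<close>.\<close>

lemma absorbs_crossI:
  assumes "j \<le> m"
    and "\<And>u p vs. std m u \<Longrightarrow> p \<le> m \<Longrightarrow> vs \<noteq> [] \<Longrightarrow> fits (m + 2) vs \<Longrightarrow> outw (m + 2) vs = 0 \<Longrightarrow>
      vanishes (m + 2) vs \<Longrightarrow> \<exists>c. g (u @ arc m p @ (Cross c, j) # vs) = 0"
  shows "absorbs (Suc (Suc m)) (Cross d, j)"
  unfolding absorbs_def
proof (intro allI impI)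
  fix vs
  assume vs: "vs \<noteq> []" "fits (Suc (Suc m)) ((Cross d, j) # vs)" "outw (Suc (Suc m)) ((Cross d, j) # vs) = 0"
    "vanishes (outw (Suc (Suc m)) [(Cross d, j)]) vs"
  then have vs': "fits (m + 2) vs" "outw (m + 2) vs = 0" "vanishes (m + 2) vs" using assms(1) by auto
  show "vanishes (Suc (Suc m)) ((Cross d, j) # vs)"
    unfolding vanishes_def
  proof (intro allI impI)
    fix v assume v: "std (Suc (Suc m)) v"
    then obtain u p where u: "std m u" "p \<le> m" "v = u @ arc m p" by (rule std_m2_cases)
    obtain c where "g (u @ arc m p @ (Cross c, j) # vs) = 0"
      using assms(2)[OF u(1,2) vs(1) vs'] by blast
    then show "g (v @ (Cross d, j) # vs) = 0"
      using vanishes_skein[OF v, of c j vs d] vanishes_cap_cup[OF assms(1) vs'(1,2) vs(1) vs'(3)]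
        vs' std_fits[OF v] u assms(1) by simp
  qed
qed

lemma absorbs_cross_inner:
  assumes "j < m"
  shows "absorbs (Suc (Suc m)) (Cross d, j)"
proof (rule absorbs_crossI)
  fix u p vs
  assume u: "std m u" "p \<le> m" and vs: "vs \<noteq> []" "fits (m + 2) vs" "outw (m + 2) vs = 0"
    "vanishes (m + 2) vs"
  consider "j + 2 \<le> p \<or> p < j \<and> j + 2 \<le> Suc m" | "p = Suc j" | "p = j"
    using assms by fastforce
  then show "\<exists>c. g (u @ arc m p @ (Cross c, j) # vs) = 0"
  proof cases
    case 1
    then show ?thesis using vanishes_far[OF u, of j "Cross Pos" vs] vs assms by (intro exI[of _ Pos]) auto
  next
    case 2
    \<comment> \<open>A crossing of this type extends the arc by one step to the left.\<close>
    have "arc m p @ (Cross Pos, j) # vs = arc m j @ vs"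
      using over_left_split[of j "Suc j" m] 2 u by (simp add: arc_def)
    moreover have "g (u @ arc m j @ vs) = 0"
      using vanishesD[OF vanishes_arc u(1)] vs assms by simp
    ultimately have "g (u @ arc m p @ (Cross Pos, j) # vs) = 0" by (simp only:)
    then show ?thesis ..
  next
    case 3
    \<comment> \<open>A crossing of this type undoes the last step of the arc.\<close>
    have "g (u @ arc m p @ (Cross Neg, j) # vs)
        = g ((u @ arc m (Suc j)) @ [(Cross Pos, j), (Cross Neg, j)] @ vs)"
      using over_left_split[of j "Suc j" m] 3 assms by (simp add: arc_def)
    also have "\<dots> = g ((u @ arc m (Suc j)) @ [] @ vs)"
      using std_fits[OF u(1)] teq_r2[of j "m + 2" Pos] assms vs by (intro g_teq_ctx) auto
    also have "\<dots> = 0"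
      using vanishesD[OF vanishes_arc u(1)] vs assms by simp
    finally show ?thesis by blast
  qed
qed (use assms in simp)

text \<open>The remaining position is the one at the right end of the arc. It depends on the inner
  positions: after the new crossing has been cancelled against the first one of the arc, the other
  crossings of the arc no longer belong to a standard arc and have to be absorbed one by
  one.\<close>

lemma absorbs_cross:
  assumes "j \<le> m"
  shows "absorbs (Suc (Suc m)) (Cross d, j)"
proof (cases "j < m")
  case False
  with assms have j: "j = m" by simp
  show ?thesis
  proof (rule absorbs_crossI)
    fix u p vs
    assume u: "std m u" "p \<le> m" and vs: "vs \<noteq> []" "fits (m + 2) vs" "outw (m + 2) vs = 0"
      "vanishes (m + 2) vs"
    have fu: "fits 0 u" "outw 0 u = m" using std_fits[OF u(1)] by auto
    show "\<exists>c. g (u @ arc m p @ (Cross c, j) # vs) = 0"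
    proof (cases "p = m")
      case True
      have "g (u @ arc m p @ vs) = 0" using vanishesD[OF vanishes_arc u(1)] vs u by simp
      then have "g (u @ arc m p @ (Cross Pos, j) # vs) = 0"
        using g_cup_cross[of u m Pos vs] True vs j fu by (simp add: arc_def)
      then show ?thesis ..
    next
      case False
      then obtain q where q: "m = Suc q" "p \<le> q" using u by (cases m) auto
      have "teq (m + 2) ((Cross Pos, m) # over_left q p) (over_left q p @ [(Cross Pos, m)])"
        using teq_commute_left[of m "over_left q p" 0 "Cross Pos" "m + 2"] q by simp
      then have eq: "teq (m + 2) (over_left q p @ [(Cross Pos, m)]) ((Cross Pos, m) # over_left q p)"
        by (rule teq_sym)
      have "g (u @ arc m p @ (Cross Pos, j) # vs)
          = g ((u @ [(Cup, m), (Cross Pos, q)]) @ (over_left q p @ [(Cross Pos, m)]) @ vs)"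
        using over_left_split[of p q m] j q u by (simp add: arc_def)
      also have "\<dots> = g ((u @ [(Cup, m), (Cross Pos, q)]) @ ((Cross Pos, m) # over_left q p) @ vs)"
        using eq fu q vs by (intro g_teq_ctx) auto
      also have "\<dots> = g (u @ [(Cup, m), (Cross Pos, q)] @ ((Cross Pos, m) # over_left q p) @ vs)"
        by simp
      \<comment> \<open>Turning the cup moves the first crossing of the arc to the position of the
        new one and gives it the opposite type, so that the two cancel.\<close>
      also have "\<dots> = g (u @ [(Cup, q), (Cross Neg, m)] @ ((Cross Pos, m) # over_left q p) @ vs)"
        using teq_turn_cup[of q m Neg] fu q vs by (intro g_teq_ctx) (auto intro: teq_sym)
      also have "\<dots> = g ((u @ [(Cup, q)]) @ [(Cross Neg, m), (Cross Pos, m)] @ over_left q p @ vs)"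
        by simp
      also have "\<dots> = g ((u @ [(Cup, q)]) @ [] @ over_left q p @ vs)"
        using teq_r2[of m "m + 2" Neg] fu q vs by (intro g_teq_ctx) auto
      also have "\<dots> = 0"
      proof -
        have "vanishes (m + 2) (over_left q p @ vs) \<and> fits (m + 2) (over_left q p @ vs) \<and>
            outw (m + 2) (over_left q p @ vs) = 0"
          using vs q absorbs_cross_inner by (intro vanishes_crosses) (auto simp: set_over_left)
        then have "vanishes m ((Cup, q) # over_left q p @ vs)"
          using absorbsD[OF IH[of q Cup], of "m + 2" "over_left q p @ vs"] vs q by simp
        from vanishesD[OF this u(1)] show ?thesis by simp
      qed
      finally show ?thesis by blast
    qed
  qed (rule assms)
qed (rule absorbs_cross_inner)

end

lemma absorbs_all: "j + ins t \<le> n \<Longrightarrow> absorbs n (t, j)"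
proof (induction n arbitrary: t j rule: less_induct)
  case (less n)
  consider "n = 0" | "n = 1" | m where "n = Suc (Suc m)" by (metis One_nat_def not0_implies_Suc)
  then show ?case
  proof cases
    case 1
    then have "t = Cup" "j = 0" using less.prems by (cases t; auto)+
    moreover have "u = []" if "std 0 u" for u using that by (cases rule: std.cases) auto
    moreover have "g ((Cup, 0) # vs) = 0" if "vanishes 2 vs" for vs
      using vanishesD[OF that, of "arc 0 0"] std_arc[of 0 "[]" 0] std_Nil by (simp add: arc_def numeral_2_eq_2)
    ultimately show ?thesis
      using 1 unfolding absorbs_def vanishes_def
      by (metis append_Nil add_0 numeral_2_eq_2 outw.simps(1) outw_Cons_piece(1))
  next
    case 2
    have "\<not> std 1 u" for u by (auto elim: std.cases)
    then show ?thesis using 2 by (auto simp: absorbs_def vanishes_def)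
  next
    case (3 m)
    have IH: "absorbs m (t, j)" if "j + ins t \<le> m" for t j using less.IH[of m] 3 that by auto
    show ?thesis
      using absorbs_cup[of m j] absorbs_cap[of m j] absorbs_cross[of m j] IH less.prems 3
      by (cases t) auto
  qed
qed

lemma vanishes_all:
  assumes "G unknot = 0" "vs \<noteq> []" "fits n vs" "outw n vs = 0"
  shows "vanishes n vs"
  using assms(2-)
proof (induction vs arbitrary: n)
  case (Cons x vs)
  obtain t j where x: "x = (t, j)" by force
  show ?case
  proof (cases "vs = []")
    case True
    \<comment> \<open>The last slice can only be a cap, and the only stack below it is a single arc;
      together they are the unknot, whose value enters here.\<close>
    with Cons.prems x have "t = Cap" "n = 2" "j = 0" by (cases t; auto simp: fits.simps)+
    moreover have "v = [(Cup, 0)]" if "std 2 v" for v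
      using that by (cases rule: std.cases) (auto elim: std.cases simp: arc_def)
    moreover have "g [(Cup, 0), (Cap, 0)] = 0"
      using assms(1) by (simp add: on_list_def unknot_def)
    ultimately show ?thesis using True x unfolding vanishes_def by (metis append_Cons append_Nil)
  next
    case False
    with Cons fits_append[of n "[x]" vs] outw_append[of n "[x]" vs]
    have "vanishes (outw n [x]) vs" "fits n [x]" "fits (outw n [x]) vs" "outw (outw n [x]) vs = 0" by auto
    then show ?thesis
      using absorbsD[OF absorbs_all[of j t n]] False x by (simp add: fits.simps)
  qed
qed auto

theorem eq_0_if_unknot_0:
  assumes "G unknot = 0"
  shows "G L = 0"
proof -
  have "is_link_diagram (slices L)" by simp
  then have "vanishes 0 (slices L)" using vanishes_all[OF assms] by (simp add: is_link_diagram_iff)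
  from vanishesD[OF this std_Nil] show ?thesis by simp
qed

end

section \<open>Multiplicativity under split unions\<close>

lemma local_move_stack:
  assumes "local_move R L L'" "closed p" "closed q"
  shows "local_move R (Diagram (p @ slices L @ q)) (Diagram (p @ slices L' @ q))"
proof -
  from assms(1) obtain us l r vs where *: "R l r" "slices L = us @ l @ vs" "slices L' = us @ r @ vs"
    unfolding local_move_def by blast
  have ld: "is_link_diagram (p @ slices L @ q)" "is_link_diagram (p @ slices L' @ q)"
    using assms(2,3) is_link_diagram_slices[of L] is_link_diagram_slices[of L']
    by (auto simp: is_link_diagram_iff simp del: is_link_diagram_slices)
  show ?thesis unfolding local_move_def slices_Diagram[OF ld(1)] slices_Diagram[OF ld(2)]
    using * by (intro exI[of _ "p @ us"] exI[of _ l] exI[of _ r] exI[of _ "vs @ q"]) simp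
qed

lemma equivclp_mono_map:
  assumes "equivclp R x y" "\<And>x y. R x y \<Longrightarrow> S (f x) (f y)"
  shows "equivclp S (f x) (f y)"
  using assms(1)
proof (induction rule: equivclp_induct)
  case (step y z)
  then show ?case using assms(2) by (blast intro: equivclp_into_equivclp)
qed simp

lemma regular_isotopic_stack:
  assumes "regular_isotopic L L'" "closed p" "closed q"
  shows "regular_isotopic (Diagram (p @ slices L @ q)) (Diagram (p @ slices L' @ q))"
  unfolding regular_isotopic_def
  by (rule equivclp_mono_map[where f = "\<lambda>L. Diagram (p @ slices L @ q)",
        OF assms(1)[unfolded regular_isotopic_def]]) (rule local_move_stack[OF _ assms(2,3)])

lemma is_link_diagram_stack:
  assumes "is_link_diagram ss" "closed p" "closed q"
  shows "is_link_diagram (p @ ss @ q)"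
  using assms by (auto simp: is_link_diagram_iff)

context skein_function
begin

text \<open>With the rest of a split union fixed, its value is a skein function of one summand. This
  allows \<open>skein_function_unique\<close> to evaluate the summands one at a time.\<close>

lemma skein_function_stack:
  assumes "closed p" "closed q"
  shows "skein_function (\<lambda>L. g (p @ slices L @ q)) w wi a ai"
proof
  have ld: "is_link_diagram (p @ slices L @ q)" for L by (intro is_link_diagram_stack assms) simp
  then have g: "g (p @ slices L @ q) = G (Diagram (p @ slices L @ q))" for L by (simp add: on_list_def)
  show "regular_isotopy_invariant (\<lambda>L. g (p @ slices L @ q))"
    unfolding regular_isotopy_invariant_def g
    using regular_isotopic_stack[OF _ assms] inv by (auto simp: regular_isotopy_invariant_def)
  show "g (p @ slices L @ q) = a * g (p @ slices L' @ q)"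
    if "local_move (\<lambda>ss ss'. curl Neg ss \<and> ss' = []) L L'" for L L'
    unfolding g using local_move_stack[OF that assms] by (rule curl_Neg)
  show "g (p @ slices L @ q) = ai * g (p @ slices L' @ q)"
    if "local_move (\<lambda>ss ss'. curl Pos ss \<and> ss' = []) L L'" for L L'
    unfolding g using local_move_stack[OF that assms] by (rule curl_Pos)
  show "g (p @ slices Lp @ q) - g (p @ slices Lm @ q) = w * (g (p @ slices L0 @ q) - g (p @ slices Linf @ q))"
    if "conway_quadruple k Lp Lm L0 Linf" for k Lp Lm L0 Linf
  proof -
    from that obtain us i vs where
      "slices Lp = us @ [(Cross Pos, i)] @ vs" "slices Lm = us @ [(Cross Neg, i)] @ vs"
      "slices L0 = us @ [(Cap, i), (Cup, i)] @ vs" "slices Linf = us @ vs"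
      unfolding conway_quadruple_def by blast
    then have "conway_quadruple (length (p @ us)) (Diagram (p @ slices Lp @ q)) (Diagram (p @ slices Lm @ q))
        (Diagram (p @ slices L0 @ q)) (Diagram (p @ slices Linf @ q))"
      unfolding conway_quadruple_def slices_Diagram[OF ld]
      by (intro exI[of _ "p @ us"] exI[of _ i] exI[of _ "vs @ q"]) simp
    then show ?thesis unfolding g by (rule skein)
  qed
qed (rule w)

lemma skein_function_diff:
  assumes "skein_function H w wi a ai"
  shows "skein_function (\<lambda>L. H L - c * G L) w wi a ai"
proof -
  interpret H: skein_function H w wi a ai by fact
  show ?thesis
  proof
    show "regular_isotopy_invariant (\<lambda>L. H L - c * G L)"
      using inv H.inv unfolding regular_isotopy_invariant_def by metis
    show "H L - c * G L = a * (H L' - c * G L')"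
      if "local_move (\<lambda>ss ss'. curl Neg ss \<and> ss' = []) L L'" for L L'
      using curl_Neg[OF that] H.curl_Neg[OF that] by (simp add: algebra_simps)
    show "H L - c * G L = ai * (H L' - c * G L')"
      if "local_move (\<lambda>ss ss'. curl Pos ss \<and> ss' = []) L L'" for L L'
      using curl_Pos[OF that] H.curl_Pos[OF that] by (simp add: algebra_simps)
    show "H Lp - c * G Lp - (H Lm - c * G Lm) = w * (H L0 - c * G L0 - (H Linf - c * G Linf))"
      if "conway_quadruple k Lp Lm L0 Linf" for k Lp Lm L0 Linf
    proof -
      have "H Lp - c * G Lp - (H Lm - c * G Lm) = (H Lp - H Lm) - c * (G Lp - G Lm)"
        by (simp add: algebra_simps)
      then show ?thesis using skein[OF that] H.skein[OF that] by (simp add: algebra_simps)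
    qed
  qed (rule w)
qed

lemma skein_function_unique:
  assumes "skein_function H w wi a ai" "G unknot = 1"
  shows "H L = H unknot * G L"
  using skein_function.eq_0_if_unknot_0[OF skein_function_diff[OF assms(1), of "H unknot"], of L] assms(2)
  by simp

definition delta :: 'r where
  "delta = wi * (a - ai) + 1"

lemma slices_unknot: "slices unknot = [(Cup, 0), (Cap, 0)]"
  by (simp add: unknot_def is_link_diagram_iff)

text \<open>The skein relation at a circle with one crossing: both types give the unknot up to a
  framing factor, and the smoothings are two circles and one circle. This is the origin of
  \<open>delta\<close>.\<close>

lemma g_unknot_unknot:
  assumes "G unknot = 1"
  shows "g (slices unknot @ slices unknot) = delta"
proof -
  have 1: "g [(Cup, 0), (Cap, 0)] = 1" using assms on_list_slices[of G unknot] slices_unknot by simp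
  have cl: "closed ([] @ (Cup, 0) # (Cross c, 0) # [(Cap, 0)])" for c by simp
  have "a - ai = w * (g (slices unknot @ slices unknot) - 1)"
    using g_skein[of "[(Cup, 0)]" Pos 0 "[(Cap, 0)]"] g_cup_cross[OF cl] 1 slices_unknot by simp
  then have "wi * (a - ai) = (w * wi) * (g (slices unknot @ slices unknot) - 1)"
    by (simp add: ac_simps)
  then show ?thesis by (simp add: w delta_def)
qed

text \<open>Uniqueness reduces first the upper and then the lower diagram to the unknot; the
  constant that remains is the value on two circles.\<close>

lemma g_stack:
  assumes "G unknot = 1"
  shows "g (slices K @ slices L) = delta * G K * G L"
proof -
  have cl: "closed (slices K)" for K using is_link_diagram_slices is_link_diagram_iff by blast
  have "skein_function (\<lambda>L. g (slices K @ slices L @ [])) w wi a ai" for K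
    by (rule skein_function_stack) (simp_all add: cl)
  then have 1: "skein_function (\<lambda>L. g (slices K @ slices L)) w wi a ai" for K by simp
  have "skein_function (\<lambda>K. g ([] @ slices K @ slices unknot)) w wi a ai"
    by (rule skein_function_stack) (simp_all add: cl)
  then have 2: "skein_function (\<lambda>K. g (slices K @ slices unknot)) w wi a ai" by simp
  show ?thesis
    unfolding skein_function_unique[OF 1 assms, of K L] skein_function_unique[OF 2 assms, of K]
      g_unknot_unknot[OF assms] ..
qed

lemma g_concat:
  assumes "G unknot = 1" "Ks \<noteq> []"
  shows "g (concat (map slices Ks)) = delta ^ (length Ks - 1) * prod_list (map G Ks)"
  using assms(2)
proof (induction Ks rule: list_nonempty_induct)
  case (cons K Ks)
  have "is_link_diagram (concat (map slices Ks))"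
    using cons(1)
  proof (induction Ks rule: list_nonempty_induct)
    case (cons K Ks)
    then show ?case using is_link_diagram_slices[of K] by (simp add: is_link_diagram_iff del: is_link_diagram_slices)
  qed simp
  then have "g (slices K @ concat (map slices Ks)) = delta * G K * g (concat (map slices Ks))"
    using g_stack[OF assms(1), of K "Diagram (concat (map slices Ks))"] by (simp add: on_list_def)
  with cons show ?case by (cases Ks) (simp_all add: ac_simps)
qed simp

end

section \<open>Colourings and sublinks\<close>

text \<open>A colouring of a tangle is recorded by the lists of colours of the strands above each slice.\<close>

fun core :: "piece \<Rightarrow> 'c list \<Rightarrow> 'c list \<Rightarrow> bool" where
  "core Cup u u' \<longleftrightarrow> u = [] \<and> (\<exists>c. u' = [c, c])"
| "core Cap u u' \<longleftrightarrow> (\<exists>c. u = [c, c]) \<and> u' = []"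
| "core (Cross p) u u' \<longleftrightarrow> (\<exists>c d. u = [c, d] \<and> u' = [d, c])"

fun cstep :: "slice \<Rightarrow> 'c list \<Rightarrow> 'c list \<Rightarrow> bool" where
  "cstep (s, i) st st' \<longleftrightarrow>
     (\<exists>x u u' y. length x = i \<and> st = x @ u @ y \<and> st' = x @ u' @ y \<and> core s u u')"

fun path :: "slice list \<Rightarrow> 'c list \<Rightarrow> 'c list list \<Rightarrow> bool" where
  "path [] st tr \<longleftrightarrow> tr = []"
| "path (a # ss) st tr \<longleftrightarrow> (\<exists>st' tr'. tr = st' # tr' \<and> cstep a st st' \<and> path ss st' tr')"

abbreviation cnt :: "('c \<Rightarrow> bool) \<Rightarrow> 'c list \<Rightarrow> nat" where
  "cnt P x \<equiv> length (filter P x)"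

text \<open>A crossing of a kept strand with a deleted one leaves no trace, because the kept strand
  continues at the same position among the kept strands.\<close>

fun subslice :: "('c \<Rightarrow> bool) \<Rightarrow> slice \<Rightarrow> 'c list \<Rightarrow> 'c list \<Rightarrow> slice list" where
  "subslice P (s, i) st st' =
     (if \<forall>c \<in> set (take (ins s) (drop i st)) \<union> set (take (outs s) (drop i st')). P c
      then [(s, cnt P (take i st))] else [])"

fun sub :: "('c \<Rightarrow> bool) \<Rightarrow> slice list \<Rightarrow> 'c list \<Rightarrow> 'c list list \<Rightarrow> slice list" where
  "sub P (a # ss) st (st' # tr) = subslice P a st st' @ sub P ss st' tr"
| "sub P _ _ _ = []"

abbreviation colours :: "'c list list \<Rightarrow> 'c set" where
  "colours tr \<equiv> \<Union> (set ` set tr)"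

declare cstep.simps [simp del]

lemma cstepI: "core s u u' \<Longrightarrow> cstep (s, length x) (x @ u @ y) (x @ u' @ y)"
  by (auto simp: cstep.simps)

lemma cstepE:
  assumes "cstep (s, i) st st'"
  obtains x u u' y where "i = length x" "st = x @ u @ y" "st' = x @ u' @ y" "core s u u'"
  using assms by (auto simp: cstep.simps)

lemma core_length: "core s u u' \<Longrightarrow> length u = ins s \<and> length u' = outs s"
  by (cases s) auto

text \<open>This is why a slice with a deleted strand can simply be dropped: the widths of the
  sublink still fit together without it.\<close>

lemma core_cnt:
  assumes "core s u u'"
  shows "if \<forall>c \<in> set u \<union> set u'. P c then cnt P u = ins s \<and> cnt P u' = outs s else cnt P u = cnt P u'"
  using assms by (cases s) auto

lemma subslice_local:
  assumes "core s u u'"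
  shows "subslice P (s, length x) (x @ u @ y) (x @ u' @ y)
    = (if \<forall>c \<in> set u \<union> set u'. P c then [(s, cnt P x)] else [])"
  using core_length[OF assms] by simp

lemma path_length: "path ss st tr \<Longrightarrow> length tr = length ss"
  by (induction ss arbitrary: st tr) auto

lemma path_append:
  "path (us @ vs) st tr \<longleftrightarrow>
    (\<exists>t1 t2. tr = t1 @ t2 \<and> path us st t1 \<and> path vs (last (st # t1)) t2)"
proof (induction us arbitrary: st tr)
  case (Cons a us)
  show ?case
  proof
    assume "path ((a # us) @ vs) st tr"
    then obtain st' tr' where 1: "tr = st' # tr'" "cstep a st st'" "path (us @ vs) st' tr'" by auto
    from 1(3) obtain t1 t2 where "tr' = t1 @ t2" "path us st' t1" "path vs (last (st' # t1)) t2"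
      unfolding Cons.IH by blast
    with 1 show "\<exists>t1 t2. tr = t1 @ t2 \<and> path (a # us) st t1 \<and> path vs (last (st # t1)) t2"
      by (intro exI[of _ "st' # t1"] exI[of _ t2]) auto
  next
    assume "\<exists>t1 t2. tr = t1 @ t2 \<and> path (a # us) st t1 \<and> path vs (last (st # t1)) t2"
    then obtain st' t1 t2 where 1: "cstep a st st'" "path us st' t1" "path vs (last (st' # t1)) t2"
      "tr = st' # t1 @ t2" by auto
    from 1(2,3) have "path (us @ vs) st' (t1 @ t2)" unfolding Cons.IH by blast
    with 1 show "path ((a # us) @ vs) st tr" by simp
  qed
qed auto

lemma sub_append:
  "length t1 = length us \<Longrightarrow>
    sub P (us @ vs) st (t1 @ t2) = sub P us st t1 @ sub P vs (last (st # t1)) t2"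
proof (induction us arbitrary: st t1)
  case (Cons a us)
  then show ?case by (cases t1) auto
qed auto

lemma cstep_fits:
  assumes "cstep (s, i) st st'"
  obtains m where "length st = m + ins s" "i \<le> m" "length st' = m + outs s"
proof -
  from assms obtain x u u' y where *: "i = length x" "st = x @ u @ y" "st' = x @ u' @ y" "core s u u'"
    by (rule cstepE)
  show ?thesis using that[of "length x + length y"] * core_length[OF *(4)] by auto
qed

lemma path_fits:
  "path ss st tr \<Longrightarrow> fits (length st) ss \<and> outw (length st) ss = length (last (st # tr))"
proof (induction ss arbitrary: st tr)
  case (Cons a ss)
  obtain s i where a: "a = (s, i)" by force
  with Cons.prems obtain st' tr' where *: "tr = st' # tr'" "cstep (s, i) st st'" "path ss st' tr'" by auto
  from *(2) obtain m where "length st = m + ins s" "i \<le> m" "length st' = m + outs s" by (rule cstep_fits)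
  then show ?case using Cons.IH[OF *(3)] * a by (auto simp: fits_Cons_add outw_Cons_add)
qed auto

lemma sub_fits:
  "path ss st tr \<Longrightarrow>
    fits (cnt P st) (sub P ss st tr) \<and> outw (cnt P st) (sub P ss st tr) = cnt P (last (st # tr))"
proof (induction ss arbitrary: st tr)
  case (Cons a ss)
  obtain s i where a: "a = (s, i)" by force
  with Cons.prems obtain st' tr' where *: "tr = st' # tr'" "cstep (s, i) st st'" "path ss st' tr'" by auto
  from *(2) obtain x u u' y where c: "i = length x" "st = x @ u @ y" "st' = x @ u' @ y" "core s u u'"
    by (rule cstepE)
  have sl: "subslice P a st st' = (if \<forall>c \<in> set u \<union> set u'. P c then [(s, cnt P x)] else [])"
    using subslice_local[OF c(4)] a c by simp
  show ?case
  proof (cases "\<forall>c \<in> set u \<union> set u'. P c")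
    case True
    then have "cnt P st = (cnt P x + cnt P y) + ins s" "cnt P st' = (cnt P x + cnt P y) + outs s"
      using core_cnt[OF c(4), of P] c by simp_all
    then show ?thesis
      using Cons.IH[OF *(3)] True sl * fits_Cons_add[of "cnt P x + cnt P y" s "cnt P x"]
        outw_Cons_add[of "cnt P x + cnt P y" s "cnt P x"]
      by auto
  next
    case False
    then have "cnt P st = cnt P st'" using core_cnt[OF c(4), of P] c by (simp only: if_False) simp
    then show ?thesis using Cons.IH[OF *(3)] False sl * by auto
  qed
qed auto

lemma path_local:
  assumes "length u = ins s"
  shows "path ((s, length x) # ss) (x @ u @ y) tr \<longleftrightarrow>
    (\<exists>u' tr'. core s u u' \<and> tr = (x @ u' @ y) # tr' \<and> path ss (x @ u' @ y) tr')"
proof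
  assume "path ((s, length x) # ss) (x @ u @ y) tr"
  then obtain st' tr' where tr: "tr = st' # tr'" "path ss st' tr'"
    and c: "cstep (s, length x) (x @ u @ y) st'" by auto
  from c obtain x' v v' y' where "length x = length x'" "x @ u @ y = x' @ v @ y'" "st' = x' @ v' @ y'"
    "core s v v'" by (rule cstepE)
  with tr have *: "length x' = length x" "x @ u @ y = x' @ v @ y'"
    "tr = (x' @ v' @ y') # tr'" "core s v v'" "path ss (x' @ v' @ y') tr'" by auto
  moreover have "length v = length u" using core_length[OF *(4)] assms by simp
  ultimately show "\<exists>u' tr'. core s u u' \<and> tr = (x @ u' @ y) # tr' \<and> path ss (x @ u' @ y) tr'"
    by auto
qed (auto intro: cstepI)

lemma path_pieces:
  "path ((Cup, length x) # ss) (x @ y) tr \<longleftrightarrow>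
     (\<exists>c tr'. tr = (x @ c # c # y) # tr' \<and> path ss (x @ c # c # y) tr')"
  "path ((Cap, length x) # ss) (x @ b # c # y) tr \<longleftrightarrow>
     b = c \<and> (\<exists>tr'. tr = (x @ y) # tr' \<and> path ss (x @ y) tr')"
  "path ((Cross p, length x) # ss) (x @ b # c # y) tr \<longleftrightarrow>
     (\<exists>tr'. tr = (x @ c # b # y) # tr' \<and> path ss (x @ c # b # y) tr')"
  subgoal using path_local[of "[]" Cup x ss y tr] by (auto simp del: path.simps)
  subgoal using path_local[of "[b, c]" Cap x ss y tr] by (auto simp del: path.simps)
  subgoal using path_local[of "[b, c]" "Cross p" x ss y tr] by (auto simp del: path.simps)
  done

lemma path_pieces_Suc:
  "path ((Cup, Suc (length x)) # ss) (x @ d # y) tr \<longleftrightarrow>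
     (\<exists>c tr'. tr = (x @ d # c # c # y) # tr' \<and> path ss (x @ d # c # c # y) tr')"
  "path ((Cap, Suc (length x)) # ss) (x @ d # b # c # y) tr \<longleftrightarrow>
     b = c \<and> (\<exists>tr'. tr = (x @ d # y) # tr' \<and> path ss (x @ d # y) tr')"
  "path ((Cross p, Suc (length x)) # ss) (x @ d # b # c # y) tr \<longleftrightarrow>
     (\<exists>tr'. tr = (x @ d # c # b # y) # tr' \<and> path ss (x @ d # c # b # y) tr')"
  using path_pieces[where x = "x @ [d]"] by simp_all

lemma split_at_length:
  assumes "i + k \<le> length st"
  obtains x u y where "st = x @ u @ y" "length x = i" "length u = k"
proof (rule that)
  show "st = take i st @ take k (drop i st) @ drop k (drop i st)"
    by (simp only: append_take_drop_id)
qed (use assms in simp_all)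

lemma split_1:
  assumes "i < length st"
  obtains x b y where "st = x @ b # y" "i = length x"
proof -
  from assms have "i + 1 \<le> length st" by simp
  then obtain x u y where *: "st = x @ u @ y" "length x = i" "length u = 1" by (rule split_at_length)
  then obtain b where "u = [b]" by (auto simp: length_Suc_conv)
  with * that[of x b y] show thesis by simp
qed

lemma split_2:
  assumes "Suc i < length st"
  obtains x b c y where "st = x @ b # c # y" "i = length x"
proof -
  from assms have "i + Suc (Suc 0) \<le> length st" by simp
  then obtain x u y where *: "st = x @ u @ y" "length x = i" "length u = Suc (Suc 0)"
    by (rule split_at_length)
  then obtain b c where "u = [b, c]" by (auto simp: length_Suc_conv)
  with * that[of x b c y] show thesis by simp
qed

lemma split_3:
  assumes "Suc (Suc i) < length st"
  obtains x b c d y where "st = x @ b # c # d # y" "i = length x"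
proof -
  from assms have "i + Suc (Suc (Suc 0)) \<le> length st" by simp
  then obtain x u y where *: "st = x @ u @ y" "length x = i" "length u = Suc (Suc (Suc 0))"
    by (rule split_at_length)
  then obtain b c d where "u = [b, c, d]" by (auto simp: length_Suc_conv)
  with * that[of x b c d y] show thesis by simp
qed

text \<open>Corresponding colourings of the two sides of a local move on tangles. Their sublinks are
  related by \<open>N\<close>.\<close>

definition col_match ::
  "((('c \<Rightarrow> bool) \<Rightarrow> slice list) \<Rightarrow> (('c \<Rightarrow> bool) \<Rightarrow> slice list) \<Rightarrow> bool) \<Rightarrow>
   slice list \<Rightarrow> slice list \<Rightarrow> 'c list \<Rightarrow> 'c list list \<Rightarrow> 'c list list \<Rightarrow> bool" where
  "col_match N l r st t t' \<longleftrightarrow> path l st t \<and> path r st t' \<and> last (st # t') = last (st # t) \<and>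
     colours t \<union> colours t' \<subseteq> set st \<union> set (last (st # t)) \<and>
     N (\<lambda>P. sub P l st t) (\<lambda>P. sub P r st t')"

text \<open>Unique existence in both directions makes the matching extend to a bijection between the
  colourings of any two diagrams that differ by the move; see \<open>col_bij\<close>.\<close>

definition col_equiv ::
  "((('c \<Rightarrow> bool) \<Rightarrow> slice list) \<Rightarrow> (('c \<Rightarrow> bool) \<Rightarrow> slice list) \<Rightarrow> bool) \<Rightarrow>
   nat \<Rightarrow> slice list \<Rightarrow> slice list \<Rightarrow> bool" where
  "col_equiv N n l r \<longleftrightarrow> (\<forall>st. length st = n \<longrightarrow>
     (\<forall>t. path l st t \<longrightarrow> (\<exists>!t'. col_match N l r st t t')) \<and>
     (\<forall>t'. path r st t' \<longrightarrow> (\<exists>!t. col_match N l r st t t')))"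

lemma col_match_sym: "col_match N l r st t t' \<longleftrightarrow> col_match (\<lambda>F F'. N F' F) r l st t' t"
  by (auto simp: col_match_def)

lemma col_equiv_sym:
  assumes "col_equiv N n l r"
  shows "col_equiv (\<lambda>F F'. N F' F) n r l"
proof -
  have "col_match (\<lambda>F F'. N F' F) r l = (\<lambda>st t t'. col_match N l r st t' t)"
    by (auto simp: fun_eq_iff col_match_def)
  with assms show ?thesis unfolding col_equiv_def by simp
qed

text \<open>The parameter \<open>e\<close> consists of the new colours.\<close>

lemma col_equivI:
  fixes N :: "(('c \<Rightarrow> bool) \<Rightarrow> slice list) \<Rightarrow> _"
  assumes "\<And>st. length st = n \<Longrightarrow> \<exists>(C :: 'e \<Rightarrow> bool) A B.
    (\<forall>t. path l st t \<longleftrightarrow> (\<exists>e. C e \<and> t = A e)) \<and> (\<forall>t. path r st t \<longleftrightarrow> (\<exists>e. C e \<and> t = B e)) \<and>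
    (\<forall>e. C e \<longrightarrow> last (st # B e) = last (st # A e) \<and>
       colours (A e) \<union> colours (B e) \<subseteq> set st \<union> set (last (st # A e)) \<and>
       N (\<lambda>P. sub P l st (A e)) (\<lambda>P. sub P r st (B e))) \<and>
    (\<forall>e e'. C e \<longrightarrow> C e' \<longrightarrow> last (st # A e) = last (st # A e') \<longrightarrow> A e = A e' \<and> B e = B e')"
  shows "col_equiv N n l r"
  unfolding col_equiv_def
proof (intro allI impI)
  fix st :: "'c list" assume "length st = n"
  then show "(\<forall>t. path l st t \<longrightarrow> (\<exists>!t'. col_match N l r st t t')) \<and>
    (\<forall>t'. path r st t' \<longrightarrow> (\<exists>!t. col_match N l r st t t'))"
    using assms[of st]
  proof (elim exE conjE meta_impE, goal_cases)
    case (2 C A B)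
    note l = 2(2) and r = 2(3)
    have m1: "col_match N l r st (A e) (B e)" if "C e" for e
      unfolding col_match_def using 2 that by blast
    have m2: "t' = B e" if "col_match N l r st (A e) t'" "C e" for e t'
      using that 2 unfolding col_match_def by metis
    have m3: "t = A e" if "col_match N l r st t (B e)" "C e" for e t
      using that 2 unfolding col_match_def by metis
    show ?case
    proof (intro conjI allI impI)
      fix t assume "path l st t"
      with l obtain e where "C e" "t = A e" by blast
      with m1 m2 show "\<exists>!t'. col_match N l r st t t'" by blast
    next
      fix t assume "path r st t"
      with r obtain e where "C e" "t = B e" by blast
      with m1 m3 show "\<exists>!t'. col_match N l r st t' t" by blast
    qed
  qed
qed

text \<open>When strands are deleted, a regular move either survives as a single regular move or its
  two sides become equal.\<close>

definition same_or_move ::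
  "(('c \<Rightarrow> bool) \<Rightarrow> slice list) \<Rightarrow> (('c \<Rightarrow> bool) \<Rightarrow> slice list) \<Rightarrow> bool" where
  "same_or_move F F' \<longleftrightarrow> (\<forall>P. F P = F' P \<or> reg_move (F P) (F' P))"

text \<open>A kink is formed by one strand, of colour \<open>c\<close>, so it survives in precisely
  those sublinks that keep this colour.\<close>

definition same_or_curl ::
  "crossing \<Rightarrow> (('c \<Rightarrow> bool) \<Rightarrow> slice list) \<Rightarrow> (('c \<Rightarrow> bool) \<Rightarrow> slice list) \<Rightarrow> bool" where
  "same_or_curl p F F' \<longleftrightarrow>
     (\<exists>c. \<forall>P. if P c then curl p (F P) \<and> F' P = [] else F P = F' P)"

section \<open>Colourings under the local moves\<close>

lemma reg_move_intros:
  "i \<le> j \<Longrightarrow> reg_move [(s, i), (t, j + outs s)] [(t, j + ins s), (s, i)]"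
  "reg_move [(Cup, i), (Cap, Suc i)] []"
  "reg_move [(Cup, Suc i), (Cap, i)] []"
  "reg_move [(Cup, i), (Cross c, Suc i)] [(Cup, Suc i), (Cross (switch c), i)]"
  "reg_move [(Cross c, Suc i), (Cap, i)] [(Cross (switch c), i), (Cap, Suc i)]"
  "reg_move [(Cross c, i), (Cross (switch c), i)] []"
  "y = x \<or> y = z \<Longrightarrow> reg_move [(Cross x, i), (Cross y, Suc i), (Cross z, i)]
     [(Cross z, Suc i), (Cross y, i), (Cross x, Suc i)]"
  using planar_move.zigzag1[of i] planar_move.zigzag2[of i] planar_move.turn_cup[of i c]
    planar_move.turn_cap[of c i] reidemeister3.intros[where x = x and y = y and z = z and i = i]
  by (simp_all add: reg_move_iff planar_move.commute reidemeister2.simps)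

text \<open>The parameters are the colours that leave the two pieces. If only one of the pieces
  survives in a sublink, it has the same position on both sides, because a deleted piece does not
  change the number of kept strands.\<close>

lemma col_equiv_commute:
  assumes "i \<le> j" "j + ins s + ins t \<le> n"
  shows "col_equiv (same_or_move :: (('c \<Rightarrow> bool) \<Rightarrow> slice list) \<Rightarrow> _) n
    [(s, i), (t, j + outs s)] [(t, j + ins s), (s, i)]"
proof (rule col_equivI[where ?'e = "'c list \<times> 'c list"])
  fix st :: "'c list" assume st: "length st = n"
  with assms have "i + ins s \<le> length st" by simp
  then obtain x u y' where 1: "st = x @ u @ y'" "length x = i" "length u = ins s"
    by (rule split_at_length)
  then have "(j - i) + ins t \<le> length y'" using st assms by simp
  then obtain y v z where 2: "y' = y @ v @ z" "length y = j - i" "length v = ins t"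
    by (rule split_at_length)
  have x: "st = x @ u @ y @ v @ z" "i = length x" "j = length x + length y" using 1 2 assms(1) by simp_all
  let ?l = "[(s, i), (t, j + outs s)]" and ?r = "[(t, j + ins s), (s, i)]"
  let ?C = "\<lambda>(u', v'). core s u u' \<and> core t v v'"
  let ?A = "\<lambda>(u', v'). [x @ u' @ y @ v @ z, x @ u' @ y @ v' @ z]"
  let ?B = "\<lambda>(u', v'). [x @ u @ y @ v' @ z, x @ u' @ y @ v' @ z]"
  have jo: "j + outs s = length (x @ u' @ y)" if "core s u u'" for u'
    using core_length[OF that] x by simp
  have ji: "j + ins s = length (x @ u @ y)" using 1 x by simp
  have l: "path ?l st t' \<longleftrightarrow> (\<exists>u' v'. core s u u' \<and> core t v v' \<and> t' = ?A (u', v'))" for t'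
  proof -
    have "path [(t, j + outs s)] (x @ u' @ y @ v @ z) tr' \<longleftrightarrow>
        (\<exists>v'. core t v v' \<and> tr' = [x @ u' @ y @ v' @ z])" if "core s u u'" for u' tr'
      using path_local[OF 2(3), of "x @ u' @ y" "[]" z tr'] jo[OF that] by auto
    then show ?thesis
      using path_local[OF 1(3), of x "[(t, j + outs s)]" "y @ v @ z" t'] x by (auto simp del: path.simps(2))
  qed
  have r: "path ?r st t' \<longleftrightarrow> (\<exists>u' v'. core s u u' \<and> core t v v' \<and> t' = ?B (u', v'))" for t'
  proof -
    have 3: "path [(s, i)] (x @ u @ y @ v' @ z) tr' \<longleftrightarrow>
        (\<exists>u'. core s u u' \<and> tr' = [x @ u' @ y @ v' @ z])" for v' tr'
      using path_local[OF 1(3), of x "[]" "y @ v' @ z" tr'] x by auto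
    have "path ?r st t' \<longleftrightarrow>
        (\<exists>v' tr'. core t v v' \<and> t' = (x @ u @ y @ v' @ z) # tr' \<and> path [(s, i)] (x @ u @ y @ v' @ z) tr')"
      unfolding x(1) ji using path_local[OF 2(3), of "x @ u @ y" "[(s, i)]" z t']
      by (simp only: append_assoc)
    then show ?thesis unfolding 3 by auto
  qed
  have mv: "same_or_move (\<lambda>P. sub P ?l st (?A (u', v'))) (\<lambda>P. sub P ?r st (?B (u', v')))"
    if c: "core s u u'" "core t v v'" for u' v'
    unfolding same_or_move_def
  proof
    fix P :: "'c \<Rightarrow> bool"
    let ?p = "\<forall>c \<in> set u \<union> set u'. P c" and ?q = "\<forall>c \<in> set v \<union> set v'. P c"
    let ?s = "if ?p then [(s, cnt P x)] else []"
      and ?t = "\<lambda>w. if ?q then [(t, cnt P x + cnt P w + cnt P y)] else []"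
    have 4: "subslice P (s, i) (x @ u @ y @ z') (x @ u' @ y @ z') = ?s" for z'
      using subslice_local[OF c(1), of P x "y @ z'"] x by simp
    have 5: "subslice P (t, j + outs s) (x @ u' @ y @ v @ z) (x @ u' @ y @ v' @ z) = ?t u'"
      unfolding jo[OF c(1)] using subslice_local[OF c(2), of P "x @ u' @ y" z] by simp
    have 6: "subslice P (t, j + ins s) (x @ u @ y @ v @ z) (x @ u @ y @ v' @ z) = ?t u"
      unfolding ji using subslice_local[OF c(2), of P "x @ u @ y" z] by simp
    have sl: "sub P ?l st (?A (u', v')) = ?s @ ?t u'" and sr: "sub P ?r st (?B (u', v')) = ?t u @ ?s"
      unfolding sub.simps x(1) prod.case 4 5 6 by simp_all
    show "sub P ?l st (?A (u', v')) = sub P ?r st (?B (u', v')) \<or>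
        reg_move (sub P ?l st (?A (u', v'))) (sub P ?r st (?B (u', v')))"
    proof (cases ?p)
      case True
      then have "cnt P u = ins s" "cnt P u' = outs s" using core_cnt[OF c(1), of P] by auto
      then have rm: "reg_move [(s, cnt P x), (t, cnt P x + cnt P u' + cnt P y)]
          [(t, cnt P x + cnt P u + cnt P y), (s, cnt P x)]"
        using reg_move_intros(1)[of "cnt P x" "cnt P x + cnt P y" s t] by (simp add: ac_simps)
      show ?thesis
      proof (cases ?q)
        case q: True
        show ?thesis unfolding sl sr if_P[OF True] if_P[OF q] using rm by simp
      next
        case q: False
        show ?thesis unfolding sl sr if_P[OF True] if_not_P[OF q] by simp
      qed
    next
      case False
      have eq: "cnt P u = cnt P u'" using core_cnt[OF c(1), of P] unfolding if_not_P[OF False] .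
      show ?thesis unfolding sl sr if_not_P[OF False] eq by simp
    qed
  qed
  show "\<exists>(C :: 'c list \<times> 'c list \<Rightarrow> bool) A B. (\<forall>t. path ?l st t \<longleftrightarrow> (\<exists>e. C e \<and> t = A e)) \<and> (\<forall>t. path ?r st t \<longleftrightarrow> (\<exists>e. C e \<and> t = B e)) \<and>
    (\<forall>e. C e \<longrightarrow> last (st # B e) = last (st # A e) \<and>
       colours (A e) \<union> colours (B e) \<subseteq> set st \<union> set (last (st # A e)) \<and>
       same_or_move (\<lambda>P. sub P ?l st (A e)) (\<lambda>P. sub P ?r st (B e))) \<and>
    (\<forall>e e'. C e \<longrightarrow> C e' \<longrightarrow> last (st # A e) = last (st # A e') \<longrightarrow> A e = A e' \<and> B e = B e')"
  proof (rule exI[of _ ?C], rule exI[of _ ?A], rule exI[of _ ?B], intro conjI)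
    show "\<forall>e e'. ?C e \<longrightarrow> ?C e' \<longrightarrow> last (st # ?A e) = last (st # ?A e') \<longrightarrow> ?A e = ?A e' \<and> ?B e = ?B e'"
    proof (clarify, goal_cases)
      case (1 u1 v1 u2 v2)
      then have "length u1 = length u2" "length v1 = length v2" using core_length by metis+
      with 1 show ?case by simp
    qed
    show "\<forall>e. ?C e \<longrightarrow> last (st # ?B e) = last (st # ?A e) \<and>
        colours (?A e) \<union> colours (?B e) \<subseteq> set st \<union> set (last (st # ?A e)) \<and>
        same_or_move (\<lambda>P. sub P ?l st (?A e)) (\<lambda>P. sub P ?r st (?B e))"
      using mv x(1) by (auto simp del: sub.simps)
  qed (simp_all add: l r del: path.simps)
qed

lemmas path_eval = path_pieces path_pieces_Suc

lemma col_equiv_zigzag: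
  assumes "i < n" "l = [(Cup, i), (Cap, Suc i)] \<or> l = [(Cup, Suc i), (Cap, i)]"
  shows "col_equiv (same_or_move :: (('c \<Rightarrow> bool) \<Rightarrow> slice list) \<Rightarrow> _) n l []"
proof (rule col_equivI[where ?'e = 'c], goal_cases)
  case (1 st)
  with assms have "i < length st" by simp
  then obtain x b y where x: "st = x @ b # y" "i = length x" by (rule split_1)
  show ?case
    unfolding x same_or_move_def
    by (rule exI[of _ "\<lambda>e :: 'c. True"], rule exI[of _ "\<lambda>e. [x @ b # b # b # y, x @ b # y]"], rule exI[of _ "\<lambda>e. []"])
      (use assms in \<open>auto simp: path_eval reg_move_intros x  simp del: path.simps(2)\<close>)
qed

lemma col_equiv_turn_cup:
  assumes "i < n"
  shows "col_equiv (same_or_move :: (('c \<Rightarrow> bool) \<Rightarrow> slice list) \<Rightarrow> _) n [(Cup, i), (Cross p, Suc i)] [(Cup, Suc i), (Cross (switch p), i)]"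
proof (rule col_equivI[where ?'e = 'c], goal_cases)
  case (1 st)
  with assms have "i < length st" by simp
  then obtain x b y where x: "st = x @ b # y" "i = length x" by (rule split_1)
  show ?case
    unfolding x same_or_move_def
    by (rule exI[of _ "\<lambda>e :: 'c. True"], rule exI[of _ "\<lambda>e. [x @ e # e # b # y, x @ e # b # e # y]"], rule exI[of _ "\<lambda>e. [x @ b # e # e # y, x @ e # b # e # y]"])
      (use assms in \<open>auto simp: path_eval reg_move_intros x  simp del: path.simps(2)\<close>)
qed

lemma col_equiv_turn_cap:
  assumes "i + 2 < n"
  shows "col_equiv (same_or_move :: (('c \<Rightarrow> bool) \<Rightarrow> slice list) \<Rightarrow> _) n [(Cross p, Suc i), (Cap, i)] [(Cross (switch p), i), (Cap, Suc i)]"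
proof (rule col_equivI[where ?'e = 'c], goal_cases)
  case (1 st)
  with assms have "Suc (Suc i) < length st" by simp
  then obtain x b c d y where x: "st = x @ b # c # d # y" "i = length x" by (rule split_3)
  show ?case
    unfolding x same_or_move_def
    by (rule exI[of _ "\<lambda>e :: 'c. b = d"], rule exI[of _ "\<lambda>e. [x @ b # d # c # y, x @ c # y]"], rule exI[of _ "\<lambda>e. [x @ c # b # d # y, x @ c # y]"])
      (use assms in \<open>auto simp: path_eval reg_move_intros x  simp del: path.simps(2)\<close>)
qed

lemma col_equiv_r2:
  assumes "i + 2 \<le> n"
  shows "col_equiv (same_or_move :: (('c \<Rightarrow> bool) \<Rightarrow> slice list) \<Rightarrow> _) n [(Cross p, i), (Cross (switch p), i)] []"
proof (rule col_equivI[where ?'e = 'c], goal_cases)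
  case (1 st)
  with assms have "Suc i < length st" by simp
  then obtain x b c y where x: "st = x @ b # c # y" "i = length x" by (rule split_2)
  show ?case
    unfolding x same_or_move_def
    by (rule exI[of _ "\<lambda>e :: 'c. True"], rule exI[of _ "\<lambda>e. [x @ c # b # y, x @ b # c # y]"], rule exI[of _ "\<lambda>e. []"])
      (use assms in \<open>auto simp: path_eval reg_move_intros x  simp del: path.simps(2)\<close>)
qed

lemma col_equiv_r3:
  assumes "i + 2 < n" "q = p \<or> q = o3"
  shows "col_equiv (same_or_move :: (('c \<Rightarrow> bool) \<Rightarrow> slice list) \<Rightarrow> _) n [(Cross p, i), (Cross q, Suc i), (Cross o3, i)]
    [(Cross o3, Suc i), (Cross q, i), (Cross p, Suc i)]"
proof (rule col_equivI[where ?'e = 'c], goal_cases)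
  case (1 st)
  with assms have "Suc (Suc i) < length st" by simp
  then obtain x b c d y where x: "st = x @ b # c # d # y" "i = length x" by (rule split_3)
  show ?case
    unfolding x same_or_move_def
    by (rule exI[of _ "\<lambda>e :: 'c. True"], rule exI[of _ "\<lambda>e. [x @ c # b # d # y, x @ c # d # b # y, x @ d # c # b # y]"], rule exI[of _ "\<lambda>e. [x @ b # d # c # y, x @ d # b # c # y, x @ d # c # b # y]"])
      (use assms in \<open>auto simp: path_eval reg_move_intros x  simp del: path.simps(2)\<close>)
qed

lemma curl_intros: "curl p [(Cup, Suc i), (Cross p, i), (Cap, Suc i)]" "curl p [(Cup, i), (Cross p, Suc i), (Cap, i)]"
  using curl.intros[of p i] by simp_all

lemma col_equiv_curl_local:
  assumes "i < n" "l = [(Cup, Suc i), (Cross p, i), (Cap, Suc i)] \<or> l = [(Cup, i), (Cross p, Suc i), (Cap, i)]"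
  shows "col_equiv (same_or_curl p :: (('c \<Rightarrow> bool) \<Rightarrow> slice list) \<Rightarrow> _) n l []"
proof (rule col_equivI[where ?'e = 'c], goal_cases)
  case (1 st)
  with assms have "i < length st" by simp
  then obtain x b y where x: "st = x @ b # y" "i = length x" by (rule split_1)
  show ?case
    unfolding x same_or_curl_def
    by (rule exI[of _ "\<lambda>e :: 'c. True"], rule exI[of _ "\<lambda>e. [x @ b # b # b # y, x @ b # b # b # y, x @ b # y]"], rule exI[of _ "\<lambda>e. []"])
      (use assms in \<open>auto simp: path_eval curl_intros x  intro!: exI[of _ b] simp del: path.simps(2)\<close>)
qed

lemma col_equiv_reg_move:
  assumes "reg_move l r" "fits n l" "fits n r"
  shows "col_equiv (same_or_move :: (('c \<Rightarrow> bool) \<Rightarrow> slice list) \<Rightarrow> _) n l r"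
proof -
  consider "planar_move l r" | "reidemeister2 l r" | "reidemeister3 l r"
    using assms(1) by (auto simp: reg_move_iff)
  then show ?thesis
  proof cases
    case 1
    then show ?thesis
    proof cases
      case (commute i j s t)
      have "j + ins s + ins t \<le> n" using assms(3) commute by (auto simp: fits.simps)
      then show ?thesis using col_equiv_commute[of i j s t n] commute by simp
    qed (use assms in \<open>auto intro!: col_equiv_zigzag[OF _ disjI1[OF refl]] col_equiv_zigzag[OF _ disjI2[OF refl]]
      col_equiv_turn_cup col_equiv_turn_cap\<close>)
  next
    case 2
    then show ?thesis using assms by cases (auto intro!: col_equiv_r2)
  next
    case 3
    then show ?thesis using assms by cases (auto intro!: col_equiv_r3)
  qed
qed

lemma col_equiv_curl:
  assumes "curl p l" "fits n l"
  shows "col_equiv (same_or_curl p :: (('c \<Rightarrow> bool) \<Rightarrow> slice list) \<Rightarrow> _) n l []"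
  using assms(1) by cases (use assms(2) in \<open>auto intro!: col_equiv_curl_local\<close>)

lemma ex_bij_betwI:
  assumes "\<And>x. x \<in> A \<Longrightarrow> \<exists>!y. y \<in> B \<and> R x y" "\<And>y. y \<in> B \<Longrightarrow> \<exists>!x. x \<in> A \<and> R x y"
  shows "\<exists>f. bij_betw f A B \<and> (\<forall>x \<in> A. R x (f x))"
proof -
  define f where "f x = (THE y. y \<in> B \<and> R x y)" for x
  have f: "f x \<in> B" "R x (f x)" if "x \<in> A" for x
    using theI'[OF assms(1)[OF that]] by (auto simp: f_def)
  have "inj_on f A" using f assms(2) by (intro inj_onI) metis
  moreover have "f ` A = B"
  proof (intro set_eqI iffI)
    fix y assume "y \<in> B"
    with assms(2) obtain x where x: "x \<in> A" "R x y" by blast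
    with f assms(1) \<open>y \<in> B\<close> have "f x = y" by blast
    with x(1) show "y \<in> f ` A" by blast
  qed (use f(1) in blast)
  ultimately show ?thesis using f unfolding bij_betw_def by blast
qed

lemma set_last_subset: "set (last (s # tr)) \<subseteq> set s \<union> colours tr"
  by (cases tr rule: rev_cases) auto

lemma col_bij:
  fixes N :: "(('c \<Rightarrow> bool) \<Rightarrow> slice list) \<Rightarrow> _" and st :: "'c list"
  assumes "col_equiv N (outw (length st) us) l r"
  shows "\<exists>f. bij_betw f {tr. path (us @ l @ vs) st tr} {tr. path (us @ r @ vs) st tr} \<and>
    (\<forall>tr. path (us @ l @ vs) st tr \<longrightarrow>
       set st \<union> colours (f tr) = set st \<union> colours tr \<and>
       (\<exists>A F F' B. N F F' \<and> (\<forall>P. sub P (us @ l @ vs) st tr = A P @ F P @ B P \<and>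
          sub P (us @ r @ vs) st (f tr) = A P @ F' P @ B P)))"
proof -
  \<comment> \<open>Two colourings correspond if they agree outside the move and match inside
    it.\<close>
  define R where "R N us l r vs st tr tr' \<longleftrightarrow> (\<exists>t1 t t' t2. tr = t1 @ t @ t2 \<and> tr' = t1 @ t' @ t2 \<and>
      path us st t1 \<and> col_match N l r (last (st # t1)) t t' \<and> path vs (last (last (st # t1) # t)) t2)"
    for N us l r vs and st :: "'c list" and tr tr'
  let ?s = "\<lambda>t1. last (st # t1)"
  have len: "length (?s t1) = outw (length st) us" if "path us st t1" for t1
    using path_fits[OF that] by simp
  have R_sym: "R N us l r vs st tr tr' \<longleftrightarrow> R (\<lambda>F F'. N F' F) us r l vs st tr' tr" for N l r tr tr'
  proof -
    have "R (\<lambda>F F'. N F' F) us r l vs st tr' tr" if "R N us l r vs st tr tr'" for N l r tr tr'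
    proof -
      from that obtain t1 t t' t2 where t: "tr = t1 @ t @ t2" "tr' = t1 @ t' @ t2" "path us st t1"
        "col_match N l r (?s t1) t t'" "path vs (last (?s t1 # t)) t2" unfolding R_def by blast
      from t(4) have "last (?s t1 # t') = last (?s t1 # t)" unfolding col_match_def by blast
      with t show ?thesis unfolding R_def col_match_sym[of N l r] by metis
    qed
    from this[of N l r] this[of "\<lambda>F F'. N F' F" r l] show ?thesis by blast
  qed
  have ex1: "\<exists>!tr'. path (us @ r @ vs) st tr' \<and> R N us l r vs st tr tr'"
    if eq: "col_equiv N (outw (length st) us) l r" and "path (us @ l @ vs) st tr" for N l r tr
  proof -
    from that(2) obtain t1 t t2 where tr: "tr = t1 @ t @ t2" "path us st t1" "path l (?s t1) t"
      "path vs (last (?s t1 # t)) t2" by (auto simp: path_append)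
    from eq len[OF tr(2)] tr(3) obtain t' where t': "col_match N l r (?s t1) t t'"
      and uniq: "\<And>s'. col_match N l r (?s t1) t s' \<Longrightarrow> s' = t'" unfolding col_equiv_def by metis
    show ?thesis
    proof (rule ex1I[of _ "t1 @ t' @ t2"])
      have "path r (?s t1) t'" "last (?s t1 # t') = last (?s t1 # t)"
        using t' by (auto simp: col_match_def)
      with tr t' show "path (us @ r @ vs) st (t1 @ t' @ t2) \<and> R N us l r vs st tr (t1 @ t' @ t2)"
        unfolding R_def path_append by metis
    next
      fix tr' assume "path (us @ r @ vs) st tr' \<and> R N us l r vs st tr tr'"
      then obtain s1 s s' s2 where s: "tr = s1 @ s @ s2" "tr' = s1 @ s' @ s2" "path us st s1"
        "col_match N l r (?s s1) s s'" unfolding R_def by blast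
      have "length s1 = length t1" "length s = length t"
        using s tr path_length unfolding col_match_def by metis+
      then have "s1 = t1" "s = t" "s2 = t2" using s(1) tr(1) by auto
      with s(2,4) uniq show "tr' = t1 @ t' @ t2" by blast
    qed
  qed
  have "\<exists>f. bij_betw f {tr. path (us @ l @ vs) st tr} {tr. path (us @ r @ vs) st tr} \<and>
      (\<forall>tr \<in> {tr. path (us @ l @ vs) st tr}. R N us l r vs st tr (f tr))"
  proof (rule ex_bij_betwI)
    show "\<exists>!tr'. tr' \<in> {tr. path (us @ r @ vs) st tr} \<and> R N us l r vs st tr tr'"
      if "tr \<in> {tr. path (us @ l @ vs) st tr}" for tr
      using ex1[OF assms] that unfolding mem_Collect_eq by blast
    show "\<exists>!tr. tr \<in> {tr. path (us @ l @ vs) st tr} \<and> R N us l r vs st tr tr'"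
      if "tr' \<in> {tr. path (us @ r @ vs) st tr}" for tr'
      using ex1[OF col_equiv_sym[OF assms]] that unfolding mem_Collect_eq R_sym[of N l r] by blast
  qed
  then obtain f where f: "bij_betw f {tr. path (us @ l @ vs) st tr} {tr. path (us @ r @ vs) st tr}"
    "\<forall>tr \<in> {tr. path (us @ l @ vs) st tr}. R N us l r vs st tr (f tr)" by (elim exE conjE)
  have "set st \<union> colours (f tr) = set st \<union> colours tr \<and>
     (\<exists>A F F' B. N F F' \<and> (\<forall>P. sub P (us @ l @ vs) st tr = A P @ F P @ B P \<and>
        sub P (us @ r @ vs) st (f tr) = A P @ F' P @ B P))" if "path (us @ l @ vs) st tr" for tr
  proof -
    have "R N us l r vs st tr (f tr)" using f(2) that by simp
    then obtain t1 t t' t2 where t: "tr = t1 @ t @ t2" "f tr = t1 @ t' @ t2" "path us st t1"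
      "col_match N l r (?s t1) t t'" unfolding R_def by blast
    let ?s = "last (st # t1)"
    have m: "path l ?s t" "path r ?s t'" "last (?s # t') = last (?s # t)"
      "colours t \<subseteq> set ?s \<union> set (last (?s # t))" "colours t' \<subseteq> set ?s \<union> set (last (?s # t))"
      "N (\<lambda>P. sub P l ?s t) (\<lambda>P. sub P r ?s t')" using t(4) unfolding col_match_def by auto
    have aux: "S \<union> U' = S \<union> U"
      if "X \<subseteq> S \<union> c1" "Y \<subseteq> X \<union> c" "Y \<subseteq> X \<union> c'" "c \<subseteq> X \<union> Y" "c' \<subseteq> X \<union> Y"
        "U = c1 \<union> c \<union> c2" "U' = c1 \<union> c' \<union> c2" for S U U' X Y c1 c c' c2 :: "'c set"
      using that by blast
    \<comment> \<open>No colour is confined to the inside of the move, so both diagrams use the same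
      colours. In particular surjective colourings correspond to surjective ones.\<close>
    have cols: "set st \<union> colours (f tr) = set st \<union> colours tr"
    proof (rule aux)
      show "set ?s \<subseteq> set st \<union> colours t1" "set (last (?s # t)) \<subseteq> set ?s \<union> colours t"
        by (rule set_last_subset)+
      show "set (last (?s # t)) \<subseteq> set ?s \<union> colours t'"
        unfolding m(3)[symmetric] by (rule set_last_subset)
      show "colours tr = colours t1 \<union> colours t \<union> colours t2"
        "colours (f tr) = colours t1 \<union> colours t' \<union> colours t2"
        unfolding t(2) unfolding t(1) by (simp_all add: Un_assoc)
    qed (rule m)+
    define B where "B = (\<lambda>P. sub P vs (last (?s # t)) t2)"
    have "sub P (us @ l @ vs) st tr = sub P us st t1 @ sub P l ?s t @ B P"
      "sub P (us @ r @ vs) st (f tr) = sub P us st t1 @ sub P r ?s t' @ B P" for P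
      unfolding t(2) unfolding t(1) B_def sub_append[OF path_length[OF t(3)]]
        sub_append[OF path_length[OF m(1)]] sub_append[OF path_length[OF m(2)]] m(3) by (rule refl)+
    with cols m(6) show ?thesis by (intro conjI exI allI) assumption+
  qed
  with f(1) show ?thesis by blast
qed

section \<open>Recolouring and combining colourings\<close>

lemma core_map: "core s u u' \<Longrightarrow> core s (map f u) (map f u')"
  by (cases s) auto

lemma path_map: "path ss st tr \<Longrightarrow> path ss (map f st) (map (map f) tr)"
proof (induction ss arbitrary: st tr)
  case (Cons a ss)
  obtain s i where a: "a = (s, i)" by force
  with Cons.prems obtain st' tr' where *: "tr = st' # tr'" "cstep (s, i) st st'" "path ss st' tr'" by auto
  from *(2) obtain x u u' y where c: "i = length x" "st = x @ u @ y" "st' = x @ u' @ y" "core s u u'"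
    by (rule cstepE)
  have "cstep (s, i) (map f st) (map f st')"
    using cstepI[OF core_map[OF c(4), of f], of "map f x" "map f y"] c by simp
  then show ?case using Cons.IH[OF *(3)] * a by simp
qed simp

lemma sub_map: "sub P ss (map f st) (map (map f) tr) = sub (\<lambda>c. P (f c)) ss st tr"
proof (induction ss arbitrary: st tr)
  case (Cons a ss)
  obtain s i where a: "a = (s, i)" by force
  show ?case
    using Cons by (cases tr) (auto simp: a take_map drop_map filter_map o_def)
qed simp

lemma core_zip:
  "core s u u' \<Longrightarrow> core s v v' \<Longrightarrow> core s (map2 f u v) (map2 f u' v')"
  by (cases s) auto

lemma cstep_zip:
  assumes "cstep (s, i) st st'" "cstep (s, i) sv sv'" "length st = length sv"
  shows "cstep (s, i) (map2 f st sv) (map2 f st' sv') \<and> length st' = length sv'"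
proof -
  from assms(1) obtain x u u' y where c: "i = length x" "st = x @ u @ y" "st' = x @ u' @ y" "core s u u'"
    by (rule cstepE)
  from assms(2) obtain x2 v v' y2 where d: "i = length x2" "sv = x2 @ v @ y2" "sv' = x2 @ v' @ y2" "core s v v'"
    by (rule cstepE)
  have l: "length x = length x2" "length u = length v" "length u' = length v'" "length y = length y2"
    using c d core_length[OF c(4)] core_length[OF d(4)] assms(3) by auto
  have "cstep (s, length (map2 f x x2)) (map2 f x x2 @ map2 f u v @ map2 f y y2)
     (map2 f x x2 @ map2 f u' v' @ map2 f y y2)"
    by (intro cstepI core_zip c d)
  then show ?thesis using c d l by simp
qed

text \<open>Colours are constant along strands, so a pointwise operation on two colourings gives a
  colouring. It is used with conjunction in a parity argument and with exclusive or in an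
  involution.\<close>

lemma path_zip:
  "path ss st tr \<Longrightarrow> path ss sv ts \<Longrightarrow> length st = length sv \<Longrightarrow>
    path ss (map2 f st sv) (map2 (map2 f) tr ts)"
proof (induction ss arbitrary: st sv tr ts)
  case (Cons a ss)
  obtain s i where a: "a = (s, i)" by force
  with Cons.prems obtain st' tr' where *: "tr = st' # tr'" "cstep (s, i) st st'" "path ss st' tr'" by auto
  from a Cons.prems obtain sv' ts' where **: "ts = sv' # ts'" "cstep (s, i) sv sv'" "path ss sv' ts'" by auto
  show ?case
    using cstep_zip[OF *(2) **(2) Cons.prems(3), of f] Cons.IH[OF *(3) **(3)] * ** a by simp
qed simp

lemma finite_paths:
  assumes "finite C"
  shows "finite {tr. path ss st tr \<and> colours tr \<subseteq> C}"
proof (induction ss arbitrary: st)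
  case (Cons a ss)
  obtain s i where a: "a = (s, i)" by force
  let ?S = "{st'. set st' \<subseteq> C \<and> length st' \<le> length st + 2}"
  have "length st' \<le> length st + 2" if "cstep (s, i) st st'" for st'
  proof -
    from that obtain m where "length st = m + ins s" "i \<le> m" "length st' = m + outs s" by (rule cstep_fits)
    then show ?thesis by (cases s) auto
  qed
  then have "{tr. path (a # ss) st tr \<and> colours tr \<subseteq> C} \<subseteq>
      (\<Union>st' \<in> ?S. (#) st' ` {tr. path ss st' tr \<and> colours tr \<subseteq> C})"
    by (force simp: a)
  moreover have "finite (\<Union>st' \<in> ?S. (#) st' ` {tr. path ss st' tr \<and> colours tr \<subseteq> C})"
    by (intro finite_UN_I finite_imageI Cons.IH finite_lists_length_le[OF assms])
  ultimately show ?case by (rule finite_subset)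
qed simp

lemma path_iff_nth:
  "path ss st tr \<longleftrightarrow> length tr = length ss \<and> (\<forall>k < length ss. cstep (ss ! k) ((st # tr) ! k) ((st # tr) ! Suc k))"
proof (induction ss arbitrary: st tr)
  case (Cons a ss)
  have *: "(\<forall>k < length (a # ss). P k) \<longleftrightarrow> P 0 \<and> (\<forall>k < length ss. P (Suc k))" for P
    by (auto simp: less_Suc_eq_0_disj)
  show ?case unfolding * by (cases tr) (auto simp: Cons.IH)
qed auto

lemma path_take: "path ss st tr \<Longrightarrow> path (take k ss) st (take k tr)"
proof -
  assume "path ss st tr"
  moreover have "(st # take k tr) ! j = (st # tr) ! j" if "j \<le> k" for j
    using that by (cases j) auto
  ultimately show ?thesis unfolding path_iff_nth by auto
qed

lemma path_length_nth:
  assumes "path ss st tr" "k \<le> length ss"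
  shows "length ((st # tr) ! k) = outw (length st) (take k ss)"
proof -
  have "length tr = length ss" using path_length[OF assms(1)] .
  then have "last (st # take k tr) = (st # tr) ! k"
    using assms(2) by (cases k) (auto simp: last_conv_nth nth_Cons split: nat.splits)
  then show ?thesis using path_fits[OF path_take[OF assms(1), of k]] by simp
qed

section \<open>Colourings and components\<close>

definition colour_at :: "'c list list \<Rightarrow> nat \<times> nat \<Rightarrow> 'c" where
  "colour_at tr q = ([] # tr) ! fst q ! snd q"

lemma slice_arc_colour:
  assumes "slice_arc k (s, i) q q'" "cstep (s, i) (([] # tr) ! k) (([] # tr) ! Suc k)"
  shows "colour_at tr q = colour_at tr q'"
proof -
  from assms(2) obtain x u u' y where c: "i = length x" "([] # tr) ! k = x @ u @ y"
    "([] # tr) ! Suc k = x @ u' @ y" "core s u u'" by (rule cstepE)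
  show ?thesis
    using assms(1)
  proof cases
    case (left p)
    then show ?thesis using c unfolding colour_at_def by (simp add: nth_append)
  next
    case (right p)
    have "(x @ v @ y) ! (p + length v) = y ! (p - i)" for v
    proof -
      have "p + length v = length (x @ v) + (p - i)" using right c(1) by simp
      then have "((x @ v) @ y) ! (p + length v) = y ! (p - i)"
        by (simp only: nth_append_length_plus)
      then show ?thesis by simp
    qed
    from this[of u] this[of u'] have "(x @ u @ y) ! (p + ins s) = (x @ u' @ y) ! (p + outs s)"
      using core_length[OF c(4)] by simp
    then show ?thesis using right c unfolding colour_at_def by simp
  next
    case cup
    then show ?thesis using c unfolding colour_at_def by (auto simp: nth_append)
  next
    case cap
    then show ?thesis using c unfolding colour_at_def by (auto simp: nth_append)
  next
    case (cross1 p)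
    then show ?thesis using c unfolding colour_at_def by (auto simp: nth_append)
  next
    case (cross2 p)
    then show ?thesis using c unfolding colour_at_def by (auto simp: nth_append)
  qed
qed

lemma same_component_colour:
  assumes "path (slices L) [] tr" "same_component L q q'"
  shows "colour_at tr q = colour_at tr q'"
  using assms(2) unfolding same_component_def
proof (induction rule: equivclp_induct)
  case (step y z)
  have "colour_at tr u = colour_at tr v" if adj: "adjacent (slices L) u v" for u v
  proof -
    from adj obtain k where k: "k < length (slices L)" "slice_arc k (slices L ! k) u v"
      unfolding adjacent_def by blast
    obtain s i where "slices L ! k = (s, i)" by force
    with k assms(1) show ?thesis unfolding path_iff_nth by (metis slice_arc_colour)
  qed
  with step show ?case by metis
qed simp

lemma mixed_crossingI:
  assumes "path (slices L) [] tr" "slices L ! k = (Cross c, i)" "k < length (slices L)"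
    "([] # tr) ! k ! i \<noteq> ([] # tr) ! k ! Suc i"
  shows "mixed_crossing L k"
  using same_component_colour[OF assms(1), of "(k, i)" "(k, Suc i)"] assms(2-)
  by (auto simp: mixed_crossing_def colour_at_def)

definition colouring_of :: "(nat \<times> nat \<Rightarrow> 'c) \<Rightarrow> slice list \<Rightarrow> 'c list list" where
  "colouring_of f ss = map (\<lambda>k. map (\<lambda>p. f (Suc k, p)) [0..<outw 0 (take (Suc k) ss)]) [0..<length ss]"

lemma colouring_of_nth:
  "k \<le> length ss \<Longrightarrow> ([] # colouring_of f ss) ! k = map (\<lambda>p. f (k, p)) [0..<outw 0 (take k ss)]"
  by (cases k) (auto simp: colouring_of_def)

lemma fits_nthE:
  assumes "fits 0 ss" "k < length ss"
  obtains s i m where "ss ! k = (s, i)" "outw 0 (take k ss) = m + ins s" "i \<le> m"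
    "outw 0 (take (Suc k) ss) = m + outs s"
proof -
  have "ss = take k ss @ ss ! k # drop (Suc k) ss" using assms(2) by (rule id_take_nth_drop)
  with assms(1) have "fits (outw 0 (take k ss)) (ss ! k # drop (Suc k) ss)" by (metis fits_append)
  then obtain s i m where *: "ss ! k = (s, i)" "outw 0 (take k ss) = m + ins s" "i \<le> m"
    by (rule fits_ConsE)
  moreover have "outw 0 (take (Suc k) ss) = m + outs s"
    using * assms(2) outw_Cons_add[of m s i "[]"] by (simp add: take_Suc_conv_app_nth)
  ultimately show ?thesis by (rule that)
qed

lemma path_colouring_of:
  assumes ss: "fits 0 ss" and f: "\<And>q q'. adjacent ss q q' \<Longrightarrow> f q = f q'"
  shows "path ss [] (colouring_of f ss)"
  unfolding path_iff_nth
proof (intro conjI allI impI)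
  fix k assume k: "k < length ss"
  from ss k obtain s i m where s: "ss ! k = (s, i)" "outw 0 (take k ss) = m + ins s" "i \<le> m"
    "outw 0 (take (Suc k) ss) = m + outs s" by (rule fits_nthE)
  have adj: "f q = f q'"
    if "slice_arc k (s, i) q q'" "q \<in> points ss" "q' \<in> points ss" for q q'
    using f[of q q'] that k s(1) unfolding adjacent_def by metis
  have pts: "(k, p) \<in> points ss \<longleftrightarrow> p < m + ins s" "(Suc k, p) \<in> points ss \<longleftrightarrow> p < m + outs s" for p
    using k s by (auto simp: points_def width_eq_outw)
  let ?x = "map (\<lambda>p. f (k, p)) [0..<i]" and ?u = "map (\<lambda>p. f (k, p)) [i..<i + ins s]"
    and ?y = "map (\<lambda>p. f (k, p + ins s)) [i..<m]" and ?u' = "map (\<lambda>p. f (Suc k, p)) [i..<i + outs s]"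
  have upt_append: "[a..<c] = [a..<b] @ [b..<c]" if "a \<le> b" "b \<le> c" for a b c :: nat
    using that upt_add_eq_append[of a b "c - b"] by simp
  have split: "[0..<m + n] = [0..<i] @ [i..<i + n] @ map (\<lambda>p. p + n) [i..<m]" for n
  proof -
    have "map (\<lambda>p. p + n) [i..<m] = [i + n..<m + n]" by (rule map_add_upt_right)
    moreover have "[0..<m + n] = [0..<i] @ [i..<m + n]" "[i..<m + n] = [i..<i + n] @ [i + n..<m + n]"
      using upt_append[of 0 i "m + n"] upt_append[of i "i + n" "m + n"] s(3) by simp_all
    ultimately show ?thesis by simp
  qed
  have "core s ?u ?u'"
  proof (cases s)
    case Cup
    then show ?thesis using adj[OF slice_arc.cup[of k i, folded Cup]] pts s(3) by (simp add: Cup)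
  next
    case Cap
    then show ?thesis using adj[OF slice_arc.cap[of k i, folded Cap]] pts s(3) by (simp add: Cap)
  next
    case (Cross c)
    then show ?thesis
      using adj[OF slice_arc.cross1[of k c i, folded Cross]] adj[OF slice_arc.cross2[of k c i, folded Cross]]
        pts s(3) by (simp add: Cross)
  qed
  then have "cstep (s, length ?x) (?x @ ?u @ ?y) (?x @ ?u' @ ?y)" by (rule cstepI)
  moreover have "?x @ ?u' @ ?y = map (\<lambda>p. f (Suc k, p)) [0..<m + outs s]"
  proof -
    have "f (k, p) = f (Suc k, p)" if "p < i" for p
      using adj[OF slice_arc.left[OF that, of k s]] pts that s(3) by simp
    moreover have "f (k, p + ins s) = f (Suc k, p + outs s)" if "i \<le> p" "p < m" for p
      using adj[OF slice_arc.right[OF that(1), of k s]] pts that by simp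
    ultimately show ?thesis unfolding split by simp
  qed
  moreover have "?x @ ?u @ ?y = map (\<lambda>p. f (k, p)) [0..<m + ins s]" unfolding split by simp
  ultimately show "cstep (ss ! k) (([] # colouring_of f ss) ! k) (([] # colouring_of f ss) ! Suc k)"
    using k s by (simp only: colouring_of_nth less_imp_le Suc_leI length_map length_upt diff_zero)
qed (simp add: colouring_of_def)

lemma adjacent_same_component:
  "adjacent (slices L) q q' \<Longrightarrow> same_component L p q \<longleftrightarrow> same_component L p q'"
  unfolding same_component_def by (metis equivclp_into_equivclp)

lemma path_component:
  defines "tr L q \<equiv> colouring_of (same_component L q) (slices L)"
  shows "path (slices L) [] (tr L q)"
    and "k \<le> length (slices L) \<Longrightarrow>
      ([] # tr L q) ! k = map (\<lambda>p. same_component L q (k, p)) [0..<outw 0 (take k (slices L))]"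
proof -
  have "fits 0 (slices L)" using is_link_diagram_slices[of L] is_link_diagram_iff by blast
  then show "path (slices L) [] (tr L q)"
    unfolding tr_def using adjacent_same_component by (intro path_colouring_of) auto
  show "([] # tr L q) ! k = map (\<lambda>p. same_component L q (k, p)) [0..<outw 0 (take k (slices L))]"
    if "k \<le> length (slices L)"
    unfolding tr_def using that by (rule colouring_of_nth)
qed

text \<open>The witness is the indicator function of the component through the lower left end of the
  crossing.\<close>

lemma mixed_crossing_colouring:
  assumes "mixed_crossing L k"
  obtains c i tr where "slices L ! k = (Cross c, i)" "path (slices L) [] tr" "k < length (slices L)"
    "([] # tr) ! k ! i" "\<not> ([] # tr) ! k ! Suc i"
proof -
  from assms obtain c i where *: "k < length (slices L)" "slices L ! k = (Cross c, i)"
    "\<not> same_component L (k, i) (k, Suc i)" unfolding mixed_crossing_def by auto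
  have "fits 0 (slices L)" using is_link_diagram_slices[of L] is_link_diagram_iff by blast
  from this *(1) obtain s j m where "slices L ! k = (s, j)" "outw 0 (take k (slices L)) = m + ins s" "j \<le> m"
    by (rule fits_nthE)
  with *(2) have "Suc i < outw 0 (take k (slices L))" by auto
  then show ?thesis
    using that[OF *(2) path_component(1)[of L "(k, i)"] *(1)] path_component(2)[of k L "(k, i)"] *
    by (simp add: same_component_def)
qed

text \<open>Nothing lies below the first slice, so it is a cup, and this point is the left one of
  its two ends. It serves as a base point in every diagram.\<close>

lemma point_1_0: "(1, 0) \<in> points (slices L)"
proof -
  have "slices L \<noteq> []" "fits 0 (slices L)" using is_link_diagram_slices[of L] is_link_diagram_iff by blast+
  then obtain s i m where "slices L ! 0 = (s, i)" "outw 0 (take 0 (slices L)) = m + ins s" "i \<le> m"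
    "outw 0 (take (Suc 0) (slices L)) = m + outs s" using fits_nthE[of "slices L" 0] by auto
  then show ?thesis using \<open>slices L \<noteq> []\<close> by (cases s) (auto simp: points_def width_eq_outw Suc_le_eq)
qed

lemma is_knot_diagram_iff:
  "is_knot_diagram L \<longleftrightarrow> (\<forall>q \<in> points (slices L). same_component L (1, 0) q)"
proof
  let ?r = "{(x, y). same_component L x y}" and ?P = "points (slices L)"
  assume "is_knot_diagram L"
  then obtain C where C: "?P // ?r = {C}"
    by (auto simp: is_knot_diagram_def components_def card_1_singleton_iff)
  have "?r `` {(1, 0)} = C" using C point_1_0[of L] quotientI[of "(1, 0)" ?P ?r] by auto
  moreover have "?r `` {q} = C" if "q \<in> ?P" for q using C quotientI[OF that, of ?r] by auto
  ultimately have "?r `` {(1, 0)} = ?r `` {q}" if "q \<in> ?P" for q using that by metis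
  moreover have "q \<in> ?r `` {q}" for q by (simp add: same_component_def)
  ultimately show "\<forall>q \<in> ?P. same_component L (1, 0) q" by blast
next
  let ?r = "{(x, y). same_component L x y}" and ?P = "points (slices L)"
  assume *: "\<forall>q \<in> ?P. same_component L (1, 0) q"
  have "?r `` {q} = ?r `` {(1, 0)}" if "q \<in> ?P" for q
  proof -
    have "same_component L (1, 0) q" using * that by blast
    then show ?thesis unfolding same_component_def by (auto intro: equivclp_trans equivclp_sym)
  qed
  then have "?P // ?r = {?r `` {(1, 0)}}" using point_1_0[of L] unfolding quotient_def by blast
  then show "is_knot_diagram L" by (simp add: is_knot_diagram_def components_def)
qed

lemma knot_colouring:
  assumes "is_knot_diagram L" "path (slices L) [] tr"
  shows "colours tr \<subseteq> {colour_at tr (1, 0)}"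
proof
  fix c assume "c \<in> colours tr"
  then obtain k where k: "k < length tr" "c \<in> set (tr ! k)" by (metis UN_E in_set_conv_nth)
  then obtain p where p: "p < length (tr ! k)" "tr ! k ! p = c" by (metis in_set_conv_nth)
  have "length (tr ! k) = outw 0 (take (Suc k) (slices L))"
    using path_length_nth[OF assms(2), of "Suc k"] path_length[OF assms(2)] k by simp
  then have "(Suc k, p) \<in> points (slices L)"
    using k p path_length[OF assms(2)] by (simp add: points_def width_eq_outw)
  then have "same_component L (1, 0) (Suc k, p)" using assms(1) is_knot_diagram_iff by blast
  from same_component_colour[OF assms(2) this] p show "c \<in> {colour_at tr (1, 0)}"
    by (simp add: colour_at_def)
qed

text \<open>The indicator function of the component of the base point takes both truth
  values.\<close>

lemma non_knot_colouring:
  assumes "\<not> is_knot_diagram L"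
  obtains tr :: "bool list list" where "path (slices L) [] tr" "colours tr = UNIV"
proof -
  from assms obtain q where q: "q \<in> points (slices L)" "\<not> same_component L (1, 0) q"
    unfolding is_knot_diagram_iff by blast
  let ?tr = "colouring_of (same_component L (1, 0)) (slices L)"
  have *: "same_component L (1, 0) q' \<in> colours ?tr" if "q' \<in> points (slices L)" for q'
  proof -
    obtain k p where q': "q' = (k, p)" by force
    with that have kp: "k \<le> length (slices L)" "p < outw 0 (take k (slices L))"
      by (auto simp: points_def width_eq_outw)
    then obtain k' where k': "k = Suc k'" by (cases k) auto
    have "?tr ! k' = map (\<lambda>p. same_component L (1, 0) (k, p)) [0..<outw 0 (take k (slices L))]"
      using path_component(2)[OF kp(1), of "(1, 0)"] k' by simp
    then have "same_component L (1, 0) q' \<in> set (?tr ! k')" using kp(2) q' by auto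
    moreover have "?tr ! k' \<in> set ?tr" using kp(1) k' by (intro nth_mem) (simp add: colouring_of_def)
    ultimately show ?thesis by blast
  qed
  have "True \<in> colours ?tr" using *[OF point_1_0] by (simp add: same_component_def)
  moreover have "False \<in> colours ?tr" using *[OF q(1)] q(2) by simp
  ultimately have "colours ?tr = UNIV" by (auto simp: UNIV_bool)
  with path_component(1)[of L "(1, 0)"] show ?thesis by (rule that)
qed

section \<open>Colourings with a single colour\<close>

fun const_col :: "'c \<Rightarrow> nat \<Rightarrow> slice list \<Rightarrow> 'c list list" where
  "const_col c n [] = []"
| "const_col c n ((s, i) # ss) = replicate (n - ins s + outs s) c # const_col c (n - ins s + outs s) ss"

lemma length_const_col [simp]: "length (const_col c n ss) = length ss"
  by (induction c n ss rule: const_col.induct) auto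

lemma path_const_col: "fits n ss \<Longrightarrow> path ss (replicate n c) (const_col c n ss)"
proof (induction ss arbitrary: n)
  case (Cons a ss)
  from Cons.prems obtain s i m where a: "a = (s, i)" "n = m + ins s" "i \<le> m" "fits (m + outs s) ss"
    by (rule fits_ConsE)
  have "core s (replicate (ins s) c) (replicate (outs s) c)" by (cases s) (auto simp: numeral_2_eq_2)
  from cstepI[OF this, of "replicate i c" "replicate (m - i) c"] a(3)
  have "cstep (s, i) (replicate (m + ins s) c) (replicate (m + outs s) c)"
    by (simp add: ac_simps flip: replicate_add)
  with Cons.IH[OF a(4)] a show ?case by simp
qed simp

lemma const_col_unique:
  "path ss (replicate n c) tr \<Longrightarrow> colours tr \<subseteq> {c} \<Longrightarrow> tr = const_col c n ss"
proof (induction ss arbitrary: n tr)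
  case (Cons a ss)
  obtain s i where a: "a = (s, i)" by force
  with Cons.prems obtain st' tr' where *: "tr = st' # tr'" "cstep (s, i) (replicate n c) st'" "path ss st' tr'"
    by auto
  from *(2) obtain m where m: "length (replicate n c) = m + ins s" "i \<le> m" "length st' = m + outs s"
    by (rule cstep_fits)
  have "st' = replicate (m + outs s) c"
    using Cons.prems(2) * m(3) by (auto intro!: replicate_eqI)
  with Cons.IH[of "m + outs s" tr'] Cons.prems * m a show ?case by simp
qed simp

lemma sub_const_col: "fits n ss \<Longrightarrow> sub P ss (replicate n c) (const_col c n ss) = (if P c then ss else [])"
proof (induction ss arbitrary: n)
  case (Cons a ss)
  from Cons.prems obtain s i m where a: "a = (s, i)" "n = m + ins s" "i \<le> m" "fits (m + outs s) ss"
    by (rule fits_ConsE)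
  have core: "core s (replicate (ins s) c) (replicate (outs s) c)" by (cases s) (auto simp: numeral_2_eq_2)
  have "set (replicate (ins s) c) \<union> set (replicate (outs s) c) = {c}" by (cases s) auto
  then have "subslice P (s, i) (replicate (m + ins s) c) (replicate (m + outs s) c) = (if P c then [(s, i)] else [])"
    using subslice_local[OF core, of P "replicate i c" "replicate (m - i) c"] a(3)
    by (simp add: ac_simps flip: replicate_add)
  with Cons.IH[OF a(4)] a show ?case by simp
qed simp

lemma sub_empty:
  "path ss st tr \<Longrightarrow> \<forall>c \<in> set st \<union> colours tr. \<not> P c \<Longrightarrow> sub P ss st tr = []"
proof (induction ss arbitrary: st tr)
  case (Cons a ss)
  obtain s i where a: "a = (s, i)" by force
  with Cons.prems obtain st' tr' where *: "tr = st' # tr'" "cstep (s, i) st st'" "path ss st' tr'" by auto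
  from *(2) obtain x u u' y where c: "i = length x" "st = x @ u @ y" "st' = x @ u' @ y" "core s u u'"
    by (rule cstepE)
  obtain d where d: "d \<in> set u \<union> set u'" using c(4) by (cases s) fastforce+
  then have "\<not> P d" using Cons.prems(2) * c by auto
  with d have "\<not> (\<forall>c \<in> set u \<union> set u'. P c)" by blast
  then have "subslice P a st st' = []" using subslice_local[OF c(4), of P x y] a c by simp
  with Cons.IH[OF *(3)] Cons.prems * show ?case by auto
qed simp

section \<open>The state sum\<close>

lemma closed_sub:
  assumes "path ss [] tr" "closed ss"
  shows "closed (sub P ss [] tr)"
proof -
  have "last ([] # tr) = []" using path_fits[OF assms(1)] assms(2) by simp
  then show ?thesis using sub_fits[OF assms(1), of P] by simp
qed

lemma bij_betw_Collect_restrict: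
  assumes "bij_betw f {x. P x} {y. Q y}" "\<And>x. P x \<Longrightarrow> R x \<longleftrightarrow> S (f x)"
  shows "bij_betw f {x. P x \<and> R x} {y. Q y \<and> S y}"
  unfolding bij_betw_def
proof
  show "inj_on f {x. P x \<and> R x}" using assms(1) by (auto simp: bij_betw_def inj_on_def)
  have "f ` {x. P x} = {y. Q y}" using assms(1) by (simp add: bij_betw_def)
  then have "{y. Q y \<and> S y} = {y \<in> f ` {x. P x}. S y}" by auto
  then show "f ` {x. P x \<and> R x} = {y. Q y \<and> S y}" using assms(2) by auto
qed

lemma col_bij_reg_move:
  assumes "reg_move l r" "fits 0 (us @ l @ vs)" "fits 0 (us @ r @ vs)"
  shows "\<exists>f :: 'c list list \<Rightarrow> _. bij_betw f {tr. path (us @ l @ vs) [] tr} {tr. path (us @ r @ vs) [] tr} \<and>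
    (\<forall>tr. path (us @ l @ vs) [] tr \<longrightarrow> colours (f tr) = colours tr \<and>
       (\<exists>A F F' B. same_or_move F F' \<and> (\<forall>P. sub P (us @ l @ vs) [] tr = A P @ F P @ B P \<and>
          sub P (us @ r @ vs) [] (f tr) = A P @ F' P @ B P)))"
proof -
  have "col_equiv (same_or_move :: (('c \<Rightarrow> bool) \<Rightarrow> slice list) \<Rightarrow> _) (outw (length ([] :: 'c list)) us) l r"
    using assms by (intro col_equiv_reg_move) auto
  from col_bij[OF this, of vs] show ?thesis by simp
qed

lemma col_bij_curl:
  assumes "curl p l" "fits 0 (us @ l @ vs)"
  shows "\<exists>f :: 'c list list \<Rightarrow> _. bij_betw f {tr. path (us @ l @ vs) [] tr} {tr. path (us @ [] @ vs) [] tr} \<and>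
    (\<forall>tr. path (us @ l @ vs) [] tr \<longrightarrow> colours (f tr) = colours tr \<and>
       (\<exists>A F F' B. same_or_curl p F F' \<and> (\<forall>P. sub P (us @ l @ vs) [] tr = A P @ F P @ B P \<and>
          sub P (us @ [] @ vs) [] (f tr) = A P @ F' P @ B P)))"
proof -
  have "col_equiv (same_or_curl p :: (('c \<Rightarrow> bool) \<Rightarrow> slice list) \<Rightarrow> _) (outw (length ([] :: 'c list)) us) l []"
    using assms by (intro col_equiv_curl) auto
  from col_bij[OF this, of vs] show ?thesis by (simp only: list.set(1) Un_empty_left)
qed

text \<open>\<open>Ei\<close> plays the role of the inverse of the indeterminate \<open>E\<close>,
  as only non-positive powers of \<open>E\<close> occur on unlinked knots. The locale adds what is
  needed to divide by \<open>k!\<close> and to undo curls in either direction.\<close>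

locale state_sum = skein_function G w wi a ai
  for G :: "link_diagram \<Rightarrow> 'r::comm_ring_1" and w wi a ai +
  fixes z Ei :: 'r
  assumes torsion_free: "\<And>n x y. 0 < n \<Longrightarrow> of_nat n * x = of_nat n * (y :: 'r) \<Longrightarrow> x = y"
    and unknot: "G unknot = 1"
    and a_ai: "a * ai = 1"
begin

definition weight :: "nat \<Rightarrow> slice list \<Rightarrow> nat list list \<Rightarrow> 'r" where
  "weight k ss tr = (\<Prod>c<k. g (sub (\<lambda>d. d = c) ss [] tr))"

definition surj_cols :: "nat \<Rightarrow> slice list \<Rightarrow> nat list list set" where
  "surj_cols k ss = {tr. path ss [] tr \<and> colours tr = {..<k}}"

definition surj_sum :: "nat \<Rightarrow> slice list \<Rightarrow> 'r" where
  "surj_sum k ss = (\<Sum>tr \<in> surj_cols k ss. weight k ss tr)"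

definition num_bool_cols :: "slice list \<Rightarrow> nat" where
  "num_bool_cols ss = card {tr :: bool list list. path ss [] tr}"

lemma finite_surj_cols: "finite (surj_cols k ss)"
  by (rule finite_subset[OF _ finite_paths[of "{..<k}" ss "[]"]]) (auto simp: surj_cols_def)

lemma finite_bool_cols: "finite {tr :: bool list list. path ss [] tr}"
  using finite_paths[of "UNIV :: bool set" ss "[]"] by simp

lemma weight_permute:
  assumes "p permutes {..<k}"
  shows "weight k ss (map (map p) tr) = weight k ss tr"
proof -
  have "weight k ss (map (map p) tr) = (\<Prod>c<k. g (sub (\<lambda>d. d = inv p c) ss [] tr))"
    unfolding weight_def
  proof (rule prod.cong)
    fix c
    have "(\<lambda>d. p d = c) = (\<lambda>d. d = inv p c)"
      using permutes_inverses[OF assms] by metis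
    then show "g (sub (\<lambda>d. d = c) ss [] (map (map p) tr)) = g (sub (\<lambda>d. d = inv p c) ss [] tr)"
      using sub_map[of "\<lambda>d. d = c" ss p "[]" tr] by simp
  qed simp
  also have "\<dots> = weight k ss tr"
    unfolding weight_def
    using prod.permute[OF permutes_inv[OF assms], of "\<lambda>c. g (sub (\<lambda>d. d = c) ss [] tr)"]
    by (simp add: o_def)
  finally show ?thesis .
qed

text \<open>Renaming colours acts freely, since every colour is used. One orbit contributes
  \<open>k!\<close> equal weights and is then removed; the claim is stated for invariant sets
  \<open>X\<close> so that this induction goes through.\<close>

lemma fact_dvd_sum_weight:
  assumes "finite X" "X \<subseteq> surj_cols k ss"
    "\<And>p tr. p permutes {..<k} \<Longrightarrow> tr \<in> X \<Longrightarrow> map (map p) tr \<in> X"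
  shows "of_nat (fact k) dvd (\<Sum>tr \<in> X. weight k ss tr)"
  using assms
proof (induction X rule: finite_psubset_induct)
  case (psubset X)
  show ?case
  proof (cases "X = {}")
    case False
    then obtain t where t: "t \<in> X" by blast
    let ?S = "{p. p permutes {..<k}}" and ?f = "\<lambda>p. map (map p) t"
    have inj: "inj_on ?f ?S"
    proof (rule inj_onI)
      fix p p' assume p: "p \<in> ?S" "p' \<in> ?S" and eq: "?f p = ?f p'"
      have "p d = p' d" for d
      proof (cases "d < k")
        case True
        then have "d \<in> colours t" using t psubset.prems(1) by (auto simp: surj_cols_def)
        then obtain s where "s \<in> set t" "d \<in> set s" by blast
        moreover from this eq have "map p s = map p' s" by (simp add: map_eq_conv)
        ultimately show ?thesis by (simp add: map_eq_conv)
      next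
        case False
        then show ?thesis using p by (simp add: permutes_not_in)
      qed
      then show "p = p'" by blast
    qed
    have O: "?f ` ?S \<subseteq> X" using psubset.prems(2) t by auto
    have "t \<in> ?f ` ?S" using permutes_id[of "{..<k}"] by (intro image_eqI[of _ _ id]) auto
    then have less: "X - ?f ` ?S \<subset> X" using t by blast
    have "map (map p) tr \<in> X - ?f ` ?S" if p: "p permutes {..<k}" and tr: "tr \<in> X - ?f ` ?S" for p tr
    proof -
      have "map (map p) tr \<notin> ?f ` ?S"
      proof
        assume "map (map p) tr \<in> ?f ` ?S"
        then obtain p' where p': "p' permutes {..<k}" "map (map p) tr = map (map p') t" by blast
        have "map (map (inv p)) (map (map p) tr) = tr"
          by (simp add: o_def permutes_inverses[OF p])
        then have "tr = ?f (inv p \<circ> p')" using p'(2) by simp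
        moreover have "inv p \<circ> p' permutes {..<k}" using p'(1) permutes_inv[OF p] by (rule permutes_compose)
        ultimately show False using tr by blast
      qed
      then show ?thesis using psubset.prems(2)[OF p] tr by blast
    qed
    then have "of_nat (fact k) dvd (\<Sum>tr \<in> X - ?f ` ?S. weight k ss tr)"
      using psubset.IH[OF less] psubset.prems(1) by blast
    moreover have "(\<Sum>tr \<in> ?f ` ?S. weight k ss tr) = of_nat (fact k) * weight k ss t"
    proof -
      have "(\<Sum>tr \<in> ?f ` ?S. weight k ss tr) = (\<Sum>p \<in> ?S. weight k ss (?f p))"
        using sum.reindex[OF inj, of "weight k ss"] by simp
      also have "\<dots> = (\<Sum>p \<in> ?S. weight k ss t)" by (rule sum.cong) (simp_all add: weight_permute)
      also have "\<dots> = of_nat (fact k) * weight k ss t"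
        by (simp add: card_permutations[of "{..<k}" k])
      finally show ?thesis .
    qed
    moreover have "(\<Sum>tr \<in> X. weight k ss tr)
        = (\<Sum>tr \<in> X - ?f ` ?S. weight k ss tr) + (\<Sum>tr \<in> ?f ` ?S. weight k ss tr)"
      using sum.subset_diff[OF O psubset.hyps] by blast
    ultimately show ?thesis by simp
  qed simp
qed

text \<open>The sum over all partitions of the set of components into \<open>k\<close> blocks: permuting the colours acts
  freely on \<open>surj_cols k ss\<close>, and the quotient by \<open>k!\<close> is unique because the ring is torsion-free.\<close>

definition part_sum :: "nat \<Rightarrow> slice list \<Rightarrow> 'r" where
  "part_sum k ss = (SOME q. surj_sum k ss = of_nat (fact k) * q)"

lemma surj_sum_eq: "surj_sum k ss = of_nat (fact k) * part_sum k ss"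
proof -
  have "of_nat (fact k) dvd surj_sum k ss"
    unfolding surj_sum_def
  proof (rule fact_dvd_sum_weight)
    fix p tr assume p: "p permutes {..<k}" and tr: "tr \<in> surj_cols k ss"
    have "colours (map (map p) tr) = p ` colours tr" by auto
    also have "\<dots> = {..<k}" using tr permutes_image[OF p] by (simp add: surj_cols_def)
    finally show "map (map p) tr \<in> surj_cols k ss"
      using tr path_map[of ss "[]" tr p] by (simp add: surj_cols_def)
  qed (simp_all add: finite_surj_cols)
  then have "\<exists>q. surj_sum k ss = of_nat (fact k) * q" by (simp add: dvd_def)
  then show ?thesis unfolding part_sum_def by (rule someI_ex)
qed

lemma part_sum_eqI: "surj_sum k ss = of_nat (fact k) * x \<Longrightarrow> part_sum k ss = x"
  using torsion_free[of "fact k"] surj_sum_eq by simp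

text \<open>A diagram with \<open>c\<close> components has \<open>2 ^ c\<close> colourings by truth values.\<close>

definition num_comps :: "slice list \<Rightarrow> nat" where
  "num_comps ss = (LEAST c. num_bool_cols ss \<le> 2 ^ c)"

text \<open>On \<open>r\<close> unlinked knots, every partition into \<open>k\<close> blocks has the weight \<open>delta ^ (r - k)\<close> times the
  product of the values of the knots. The coefficients are such that the sum over all partitions is
  \<open>(delta * Ei) ^ (r - 1)\<close> times this product; see \<open>Stirling_expansion\<close> for \<open>x = z * wi * delta\<close> and
  \<open>y = delta * Ei\<close>.\<close>

definition coeff :: "nat \<Rightarrow> 'r" where
  "coeff k = (\<Prod>i = 1..<k. delta * Ei - of_nat i * (z * wi * delta))"

definition state_sum :: "slice list \<Rightarrow> 'r" where
  "state_sum ss = (\<Sum>k \<le> num_comps ss. (z * wi) ^ (num_comps ss - k) * coeff k * part_sum k ss)"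

lemma state_sum_scale:
  assumes "\<And>k. surj_sum k A = f * surj_sum k B" "num_bool_cols A = num_bool_cols B"
  shows "state_sum A = f * state_sum B"
proof -
  have "part_sum k A = f * part_sum k B" for k
    using assms(1)[of k] surj_sum_eq[of k B] by (intro part_sum_eqI) (simp add: ac_simps)
  then show ?thesis
    unfolding state_sum_def num_comps_def assms(2) sum_distrib_left
    by (intro sum.cong) (simp_all add: ac_simps)
qed

lemma surj_sum_transfer:
  assumes "bij_betw f {tr. path A [] tr} {tr. path B [] tr}"
    "\<And>tr. path A [] tr \<Longrightarrow> colours (f tr) = colours tr"
    "\<And>tr. tr \<in> surj_cols k A \<Longrightarrow> weight k A tr = c * weight k B (f tr)"
  shows "surj_sum k A = c * surj_sum k B"
proof -
  have "bij_betw f (surj_cols k A) (surj_cols k B)"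
    unfolding surj_cols_def using assms(1,2) by (intro bij_betw_Collect_restrict) auto
  then have "(\<Sum>tr \<in> surj_cols k A. c * weight k B (f tr)) = (\<Sum>tr \<in> surj_cols k B. c * weight k B tr)"
    by (rule sum.reindex_bij_betw)
  then show ?thesis unfolding surj_sum_def sum_distrib_left using assms(3) by simp
qed

lemma state_sum_reg_move:
  assumes "reg_move l r" "closed (us @ l @ vs)" "closed (us @ r @ vs)"
  shows "state_sum (us @ l @ vs) = state_sum (us @ r @ vs)"
proof -
  let ?A = "us @ l @ vs" and ?B = "us @ r @ vs"
  obtain f where "bij_betw f {tr :: bool list list. path ?A [] tr} {tr :: bool list list. path ?B [] tr}"
    using col_bij_reg_move[where ?'c = bool, OF assms(1), of us vs] assms(2,3) by blast
  then have "num_bool_cols ?A = num_bool_cols ?B"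
    unfolding num_bool_cols_def by (rule bij_betw_same_card)
  moreover have "surj_sum k ?A = 1 * surj_sum k ?B" for k
  proof -
    obtain f where f: "bij_betw f {tr :: nat list list. path ?A [] tr} {tr :: nat list list. path ?B [] tr}"
      and *: "\<And>tr. path ?A [] tr \<Longrightarrow> colours (f tr) = colours tr \<and>
       (\<exists>A F F' B. same_or_move F F' \<and> (\<forall>P. sub P ?A [] tr = A P @ F P @ B P \<and>
          sub P ?B [] (f tr) = A P @ F' P @ B P))"
      using col_bij_reg_move[where ?'c = nat, OF assms(1), of us vs] assms(2,3) by blast
    show ?thesis
    proof (rule surj_sum_transfer[OF f])
      fix tr assume "tr \<in> surj_cols k ?A"
      then have tr: "path ?A [] tr" "path ?B [] (f tr)"
        using f by (auto simp: surj_cols_def bij_betw_def)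
      from *[OF tr(1), THEN conjunct2] obtain A F F' B where "same_or_move F F' \<and>
        (\<forall>P. sub P ?A [] tr = A P @ F P @ B P \<and> sub P ?B [] (f tr) = A P @ F' P @ B P)" by (elim exE)
      then have F: "same_or_move F F'" "\<And>P. sub P ?A [] tr = A P @ F P @ B P"
        "\<And>P. sub P ?B [] (f tr) = A P @ F' P @ B P" by simp_all
      have "g (sub P ?A [] tr) = g (sub P ?B [] (f tr))" for P
      proof -
        have cl: "closed (sub P ?A [] tr)" "closed (sub P ?B [] (f tr))"
          using closed_sub[OF tr(1) assms(2)] closed_sub[OF tr(2) assms(3)] by blast+
        have "F P = F' P \<or> reg_move (F P) (F' P)" using F(1) by (simp add: same_or_move_def)
        then show ?thesis
        proof
          assume "F P = F' P"
          then show ?thesis unfolding F(2,3) by simp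
        next
          assume "reg_move (F P) (F' P)"
          from teq_move[OF this, of 0 "A P" "B P"] cl show ?thesis
            unfolding F(2,3) by (intro g_teq) blast
        qed
      qed
      then show "weight k ?A tr = 1 * weight k ?B (f tr)" unfolding weight_def by simp
    qed (use * in auto)
  qed
  ultimately show ?thesis using state_sum_scale[of ?A 1 ?B] by simp
qed

lemma state_sum_curl:
  assumes "curl p l" "closed (us @ l @ vs)"
  shows "state_sum (us @ l @ vs) = framing p * state_sum (us @ vs)"
proof -
  let ?A = "us @ l @ vs" and ?B = "us @ [] @ vs"
  have clB: "closed ?B" using assms curl_outw[OF assms(1), of "outw 0 us"] by simp
  obtain f where "bij_betw f {tr :: bool list list. path ?A [] tr} {tr :: bool list list. path ?B [] tr}"
    using col_bij_curl[where ?'c = bool, OF assms(1), of us vs] assms(2) by blast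
  then have "num_bool_cols ?A = num_bool_cols ?B"
    unfolding num_bool_cols_def by (rule bij_betw_same_card)
  moreover have "surj_sum k ?A = framing p * surj_sum k ?B" for k
  proof -
    obtain f where f: "bij_betw f {tr :: nat list list. path ?A [] tr} {tr :: nat list list. path ?B [] tr}"
      and *: "\<And>tr. path ?A [] tr \<Longrightarrow> colours (f tr) = colours tr \<and>
       (\<exists>A F F' B. same_or_curl p F F' \<and> (\<forall>P. sub P ?A [] tr = A P @ F P @ B P \<and>
          sub P ?B [] (f tr) = A P @ F' P @ B P))"
      using col_bij_curl[where ?'c = nat, OF assms(1), of us vs] assms(2) by blast
    show ?thesis
    proof (rule surj_sum_transfer[OF f])
      fix tr assume tr_in: "tr \<in> surj_cols k ?A"
      then have tr: "path ?A [] tr" "path ?B [] (f tr)"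
        using f by (auto simp: surj_cols_def bij_betw_def)
      from *[OF tr(1), THEN conjunct2] obtain A F F' B where "same_or_curl p F F' \<and>
        (\<forall>P. sub P ?A [] tr = A P @ F P @ B P \<and> sub P ?B [] (f tr) = A P @ F' P @ B P)" by (elim exE)
      then have F: "same_or_curl p F F'" "\<And>P. sub P ?A [] tr = A P @ F P @ B P"
        "\<And>P. sub P ?B [] (f tr) = A P @ F' P @ B P" by simp_all
      from F(1) obtain c where c: "\<And>P. if P c then curl p (F P) \<and> F' P = [] else F P = F' P"
        unfolding same_or_curl_def by blast
      let ?P = "\<lambda>c d. d = c"
      have curl: "curl p (F (?P c))" "F' (?P c) = []" using c[of "?P c"] by auto
      \<comment> \<open>The colour of the kink is among the \<open>k\<close> colours, because its
        sublink contains the kink and is not empty. So exactly one factor of the weight acquires the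
        framing factor.\<close>
      have "c < k"
      proof (rule ccontr)
        assume "\<not> c < k"
        then have "sub (?P c) ?A [] tr = []"
          using tr_in by (intro sub_empty[OF tr(1)]) (auto simp: surj_cols_def)
        then show False using curl(1) F(2)[of "?P c"] by (auto elim: curl.cases)
      qed
      have 1: "g (sub (?P c) ?A [] tr) = framing p * g (sub (?P c) ?B [] (f tr))"
        using g_curl[OF curl(1), of "A (?P c)" "B (?P c)"] closed_sub[OF tr(1) assms(2), of "?P c"]
        unfolding F(2,3) curl(2) by simp
      have 2: "g (sub (?P d) ?A [] tr) = g (sub (?P d) ?B [] (f tr))" if "d \<noteq> c" for d
        using c[of "?P d"] that unfolding F(2,3) by simp
      show "weight k ?A tr = framing p * weight k ?B (f tr)"
      proof -
        have fin: "finite {..<k}" "c \<in> {..<k}" using \<open>c < k\<close> by auto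
        show ?thesis
          unfolding weight_def prod.remove[OF fin] 1 using 2 by (simp add: ac_simps)
      qed
    qed (use * in auto)
  qed
  ultimately show ?thesis using state_sum_scale[of ?A "framing p" ?B] by simp
qed

end

subsection \<open>The skein relation at a mixed crossing\<close>

lemma path_cross_iff:
  "path (us @ (Cross p, i) # vs) [] tr \<longleftrightarrow>
    (\<exists>t1 x b c y t2. tr = t1 @ (x @ c # b # y) # t2 \<and> path us [] t1 \<and>
       last ([] # t1) = x @ b # c # y \<and> i = length x \<and> path vs (x @ c # b # y) t2)" (is "_ \<longleftrightarrow> ?R")
proof
  assume "path (us @ (Cross p, i) # vs) [] tr"
  then obtain t1 st' t2 where t: "tr = t1 @ st' # t2" "path us [] t1" "path vs st' t2"
    "cstep (Cross p, i) (last ([] # t1)) st'" unfolding path_append by auto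
  from t(4) obtain x u u' y where "i = length x" "last ([] # t1) = x @ u @ y" "st' = x @ u' @ y"
    "core (Cross p) u u'" by (rule cstepE)
  then obtain b c where "i = length x" "last ([] # t1) = x @ b # c # y" "st' = x @ c # b # y" by auto
  with t show ?R by blast
next
  assume ?R
  then obtain t1 x b c y t2 where *: "tr = t1 @ (x @ c # b # y) # t2" "path us [] t1"
    "last ([] # t1) = x @ b # c # y" "i = length x" "path vs (x @ c # b # y) t2" by blast
  have "path ((Cross p, i) # vs) (last ([] # t1)) ((x @ c # b # y) # t2)"
    unfolding *(3,4) path_pieces using *(5) by blast
  with * show "path (us @ (Cross p, i) # vs) [] tr" unfolding path_append by blast
qed

text \<open>Colourings of the complement of a crossing in which all four ends have the same colour.\<close>

definition merged_cols :: "slice list \<Rightarrow> nat \<Rightarrow> slice list \<Rightarrow> ('c list list \<times> 'c list list) set" where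
  "merged_cols us i vs = {(t1, t2). path us [] t1 \<and> path vs (last ([] # t1)) t2 \<and>
     (\<exists>x b y. last ([] # t1) = x @ b # b # y \<and> i = length x)}"

lemma path_parity: "path ss st tr \<Longrightarrow> even (cnt P st) \<longleftrightarrow> even (cnt P (last (st # tr)))"
proof (induction ss arbitrary: st tr)
  case (Cons a ss)
  obtain s i where a: "a = (s, i)" by force
  with Cons.prems obtain st' tr' where *: "tr = st' # tr'" "cstep (s, i) st st'" "path ss st' tr'" by auto
  from *(2) obtain x u u' y where c: "i = length x" "st = x @ u @ y" "st' = x @ u' @ y" "core s u u'"
    by (rule cstepE)
  have "even (cnt P u) \<longleftrightarrow> even (cnt P u')" using c(4) by (cases s) (auto split: if_splits)
  then have "even (cnt P st) \<longleftrightarrow> even (cnt P st')" using c by simp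
  with Cons.IH[OF *(3)] * show ?case by simp
qed simp

lemma last_zip_traces:
  "length tr = length ts \<Longrightarrow>
    last (map2 f st sv # map2 (map2 f) tr ts) = map2 f (last (st # tr)) (last (sv # ts))"
  by (induction tr ts arbitrary: st sv rule: list_induct2) auto

text \<open>The conjunction of two colourings by truth values is again a colouring, so at either end of the
  complement an even number of strands has the colour \<open>True\<close> in both.\<close>

lemma complement_parity:
  fixes x y x' y' :: "bool list"
  assumes "path us [] t1" "last ([] # t1) = x @ b # c # y" "path vs (x @ c # b # y) t2"
    and "path us [] s1" "last ([] # s1) = x' @ b' # c' # y'" "path vs (x' @ d' # e' # y') s2"
    and "length x = length x'" "outw (outw 0 us) vs = 0"
  shows "even (of_bool (b \<and> b') + of_bool (c \<and> c') :: nat) \<longleftrightarrow>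
    even (of_bool (c \<and> d') + of_bool (b \<and> e') :: nat)"
proof -
  let ?X = "map2 (\<and>) x x'" and ?Y = "map2 (\<and>) y y'"
  have len: "length (x @ b # c # y) = outw 0 us" "length (x' @ b' # c' # y') = outw 0 us"
    using path_fits[OF assms(1)] path_fits[OF assms(4)] unfolding assms(2,5) by simp_all
  have 1: "path us [] (map2 (map2 (\<and>)) t1 s1)" using path_zip[OF assms(1,4), of "(\<and>)"] by simp
  have "length t1 = length s1" using path_length assms(1,4) by metis
  then have "last ([] # map2 (map2 (\<and>)) t1 s1) = ?X @ (b \<and> b') # (c \<and> c') # ?Y"
    using last_zip_traces[of t1 s1 "(\<and>)" "[]" "[]"] assms(2,5,7) by simp
  with path_parity[OF 1, of id] have e1: "even (cnt id (?X @ (b \<and> b') # (c \<and> c') # ?Y))" by simp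
  have 2: "path vs (map2 (\<and>) (x @ c # b # y) (x' @ d' # e' # y')) (map2 (map2 (\<and>)) t2 s2)"
    using len by (intro path_zip[OF assms(3,6)]) simp
  have "length (last ((map2 (\<and>) (x @ c # b # y) (x' @ d' # e' # y')) # map2 (map2 (\<and>)) t2 s2)) = 0"
    using path_fits[OF 2] len assms(8) by simp
  with path_parity[OF 2, of id] have "even (cnt id (?X @ (c \<and> d') # (b \<and> e') # ?Y))"
    using assms(7) by simp
  with e1 show ?thesis by (auto simp: of_bool_def split: if_splits)
qed

text \<open>The given colouring separates the two strands of the crossing. Outside the crossing,
  each lower end must therefore be joined to the diagonally opposite upper end, and either smoothing
  connects all four ends. Parity yields this without tracing any arcs.\<close>

context
  fixes us vs :: "slice list" and i :: nat and t1 t2 :: "bool list list" and x y :: "bool list" and b c :: bool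
  assumes psi: "path us [] t1" "last ([] # t1) = x @ b # c # y" "path vs (x @ c # b # y) t2"
    "b \<noteq> c" "i = length x" and cl: "outw (outw 0 us) vs = 0"
begin

lemma merged_infinity:
  "{tr :: 'c list list. path (us @ vs) [] tr} = (\<lambda>(t1, t2). t1 @ t2) ` merged_cols us i vs"
proof (intro set_eqI iffI)
  fix tr :: "'c list list" assume "tr \<in> {tr. path (us @ vs) [] tr}"
  then obtain s1 s2 where s: "tr = s1 @ s2" "path us [] s1" "path vs (last ([] # s1)) s2"
    by (auto simp: path_append)
  have "Suc i < length (last ([] # s1))"
    using path_fits[OF s(2)] path_fits[OF psi(1)] psi(2,5) by simp
  then obtain x' b' c' y' where x': "last ([] # s1) = x' @ b' # c' # y'" "i = length x'" by (rule split_2)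
  have "b' = c'"
  proof (rule ccontr)
    assume ne: "b' \<noteq> c'"
    \<comment> \<open>Intersected with the separating colouring, the indicator of \<open>b'\<close>
      would have different parities at the two heights.\<close>
    let ?f = "\<lambda>q. q = b'"
    have "last ([] # map (map ?f) s1) = map ?f (last ([] # s1))" by (cases s1 rule: rev_cases) auto
    then have "even (of_bool (b \<and> True) + of_bool (c \<and> False) :: nat) \<longleftrightarrow>
        even (of_bool (c \<and> True) + of_bool (b \<and> False) :: nat)"
      using complement_parity[OF psi(1-3), of "map (map ?f) s1" "map ?f x'" True False "map ?f y'" True False
          "map (map ?f) s2"] path_map[OF s(2), of ?f] path_map[OF s(3), of ?f] x' psi(5) cl ne by simp
    then show False using psi(4) by (cases b; cases c) auto
  qed
  with s x' show "tr \<in> (\<lambda>(t1, t2). t1 @ t2) ` merged_cols us i vs"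
    unfolding merged_cols_def by force
next
  fix tr :: "'c list list" assume "tr \<in> (\<lambda>(t1, t2). t1 @ t2) ` merged_cols us i vs"
  then obtain s1 s2 where s: "tr = s1 @ s2" "(s1, s2) \<in> merged_cols us i vs" by (elim imageE) auto
  then have "path us [] s1" "path vs (last ([] # s1)) s2" by (simp_all add: merged_cols_def)
  with s(1) show "tr \<in> {tr. path (us @ vs) [] tr}" unfolding path_append mem_Collect_eq by blast
qed

lemma merged_zero:
  "{tr :: 'c list list. path (us @ (Cap, i) # (Cup, i) # vs) [] tr} =
    (\<lambda>(t1, t2). t1 @ (take i (last ([] # t1)) @ drop (i + 2) (last ([] # t1))) # last ([] # t1) # t2)
      ` merged_cols us i vs"
proof (intro set_eqI iffI)
  fix tr :: "'c list list" assume "tr \<in> {tr. path (us @ (Cap, i) # (Cup, i) # vs) [] tr}"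
  then obtain s1 s2 where s: "tr = s1 @ s2" "path us [] s1"
    "path ((Cap, i) # (Cup, i) # vs) (last ([] # s1)) s2"
    by (auto simp: path_append simp del: path.simps)
  have "Suc i < length (last ([] # s1))"
    using path_fits[OF s(2)] path_fits[OF psi(1)] psi(2,5) by simp
  then obtain x' b' c' y' where x': "last ([] # s1) = x' @ b' # c' # y'" "i = length x'" by (rule split_2)
  from s(3) obtain d' s3 where s2: "b' = c'" "s2 = (x' @ y') # (x' @ d' # d' # y') # s3"
    "path vs (x' @ d' # d' # y') s3" unfolding x' path_pieces by blast
  have "b' = d'"
  proof (rule ccontr)
    assume ne: "b' \<noteq> d'"
    let ?f = "\<lambda>q. q = b'"
    have "last ([] # map (map ?f) s1) = map ?f (last ([] # s1))" by (cases s1 rule: rev_cases) auto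
    then have "even (of_bool (b \<and> True) + of_bool (c \<and> True) :: nat) \<longleftrightarrow>
        even (of_bool (c \<and> False) + of_bool (b \<and> False) :: nat)"
      using complement_parity[OF psi(1-3), of "map (map ?f) s1" "map ?f x'" True True "map ?f y'" False False
          "map (map ?f) s3"] path_map[OF s(2), of ?f] path_map[OF s2(3), of ?f] x' s2(1) psi(5) cl ne by simp
    then show False using psi(4) by (cases b; cases c) auto
  qed
  then have "(s1, s3) \<in> merged_cols us i vs"
    unfolding merged_cols_def using s(2) s2 x' by auto
  moreover have "tr = s1 @ (take i (last ([] # s1)) @ drop (i + 2) (last ([] # s1))) # last ([] # s1) # s3"
    using s(1) s2 x' \<open>b' = d'\<close> by simp
  ultimately show "tr \<in> (\<lambda>(t1, t2). t1 @ (take i (last ([] # t1)) @ drop (i + 2) (last ([] # t1))) #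
      last ([] # t1) # t2) ` merged_cols us i vs" by force
next
  fix tr :: "'c list list"
  assume "tr \<in> (\<lambda>(t1, t2). t1 @ (take i (last ([] # t1)) @ drop (i + 2) (last ([] # t1))) #
      last ([] # t1) # t2) ` merged_cols us i vs"
  then obtain s1 s2 x' d y' where s: "tr = s1 @ (x' @ y') # (x' @ d # d # y') # s2" "path us [] s1"
    "last ([] # s1) = x' @ d # d # y'" "i = length x'" "path vs (x' @ d # d # y') s2"
    unfolding merged_cols_def by auto
  then have "path ((Cap, i) # (Cup, i) # vs) (last ([] # s1)) ((x' @ y') # (x' @ d # d # y') # s2)"
    unfolding s(3,4) path_pieces by blast
  with s show "tr \<in> {tr. path (us @ (Cap, i) # (Cup, i) # vs) [] tr}"
    unfolding path_append mem_Collect_eq by blast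
qed

end

definition same_at :: "nat \<Rightarrow> nat \<Rightarrow> 'c list list \<Rightarrow> bool" where
  "same_at k i tr \<longleftrightarrow> ([] # tr) ! k ! i = ([] # tr) ! k ! Suc i"

lemma state_at:
  "path us [] t1 \<Longrightarrow> ([] # t1 @ t2) ! length us = last ([] # t1)"
proof -
  assume "path us [] t1"
  then have "length us = length t1" by (simp add: path_length)
  then show ?thesis by (cases t1 rule: rev_cases) simp_all
qed

text \<open>With the two preceding descriptions, one set of colourings of the complement
  parametrizes the relevant colourings of all four diagrams of a quadruple.\<close>

lemma merged_crossing:
  "{tr :: 'c list list. path (us @ (Cross p, i) # vs) [] tr \<and> same_at (length us) i tr} =
    (\<lambda>(t1, t2). t1 @ last ([] # t1) # t2) ` merged_cols us i vs"
proof (intro set_eqI iffI)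
  fix tr :: "'c list list"
  assume "tr \<in> {tr. path (us @ (Cross p, i) # vs) [] tr \<and> same_at (length us) i tr}"
  then obtain t1 x b c y t2 where t: "tr = t1 @ (x @ c # b # y) # t2" "path us [] t1"
    "last ([] # t1) = x @ b # c # y" "i = length x" "path vs (x @ c # b # y) t2" "same_at (length us) i tr"
    unfolding path_cross_iff by blast
  then have "b = c"
    using state_at[OF t(2), of "(x @ c # b # y) # t2"] by (simp add: same_at_def nth_append)
  then have "(t1, t2) \<in> merged_cols us i vs" "tr = t1 @ last ([] # t1) # t2"
    using t unfolding merged_cols_def by auto
  then show "tr \<in> (\<lambda>(t1, t2). t1 @ last ([] # t1) # t2) ` merged_cols us i vs" by force
next
  fix tr :: "'c list list"
  assume "tr \<in> (\<lambda>(t1, t2). t1 @ last ([] # t1) # t2) ` merged_cols us i vs"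
  then obtain t1 t2 x b y where t: "tr = t1 @ (x @ b # b # y) # t2" "path us [] t1"
    "last ([] # t1) = x @ b # b # y" "i = length x" "path vs (x @ b # b # y) t2"
    unfolding merged_cols_def by auto
  moreover have "same_at (length us) i tr"
    using t state_at[OF t(2), of "(x @ b # b # y) # t2"] by (simp add: same_at_def nth_append)
  ultimately show "tr \<in> {tr. path (us @ (Cross p, i) # vs) [] tr \<and> same_at (length us) i tr}"
    unfolding path_cross_iff by blast
qed

text \<open>\<open>h\<close> inserts colour lists that are determined by those below; the point of
  division is recovered from the length of \<open>us\<close>.\<close>

lemma inj_merged:
  "inj_on (\<lambda>(t1, t2). t1 @ h t1 @ t2) (merged_cols us i vs)"
proof (rule inj_onI, clarify)
  fix t1 t2 s1 s2 :: "'a list list"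
  assume "(t1, t2) \<in> merged_cols us i vs" "(s1, s2) \<in> merged_cols us i vs"
    and eq: "t1 @ h t1 @ t2 = s1 @ h s1 @ s2"
  then have "path us [] t1" "path us [] s1" by (simp_all add: merged_cols_def)
  then have "length t1 = length s1" by (simp add: path_length)
  with eq have "t1 = s1" "h t1 @ t2 = h s1 @ s2"
    using append_eq_append_conv[of t1 s1 "h t1 @ t2" "h s1 @ s2"] by blast+
  then show "t1 = s1 \<and> t2 = s2" by auto
qed

lemma zip_cancel:
  "list_all2 (\<lambda>s t. length s = length t) ts tr \<Longrightarrow>
    map2 (map2 (\<noteq>)) ts (map2 (map2 (\<noteq>)) ts tr) = (tr :: bool list list)"
proof (induction rule: list_all2_induct)
  case (Cons s ts t tr)
  have "map2 (\<noteq>) s (map2 (\<noteq>) s t) = t" using Cons.hyps(1) by (induction s t rule: list_induct2) auto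
  with Cons.IH show ?case by simp
qed simp

lemma path_lengths:
  "path ss st tr \<Longrightarrow> path ss sv ts \<Longrightarrow> length st = length sv \<Longrightarrow>
    list_all2 (\<lambda>s t. length s = length t) tr ts"
  unfolding list_all2_conv_all_nth
proof (intro conjI allI impI)
  assume p: "path ss st tr" "path ss sv ts" "length st = length sv"
  then show "length tr = length ts" by (simp add: path_length)
  fix k assume "k < length tr"
  then have "Suc k \<le> length ss" using path_length[OF p(1)] by simp
  from path_length_nth[OF p(1) this] path_length_nth[OF p(2) this] p(3)
  show "length (tr ! k) = length (ts ! k)" by simp
qed

text \<open>Exclusive or with the separating colouring is an involution that exchanges the
  colourings which agree at the two strands with those which do not.\<close>

lemma card_same_at:
  fixes psi :: "bool list list"
  assumes psi: "path ss [] psi" "\<not> same_at k i psi" and k: "k < length ss" "Suc i < outw 0 (take k ss)"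
  shows "card {tr :: bool list list. path ss [] tr} = 2 * card {tr :: bool list list. path ss [] tr \<and> same_at k i tr}"
proof -
  let ?h = "map2 (map2 (\<noteq>)) psi"
  let ?S = "{tr :: bool list list. path ss [] tr \<and> same_at k i tr}"
    and ?D = "{tr :: bool list list. path ss [] tr \<and> \<not> same_at k i tr}"
  have h: "path ss [] (?h tr)" "same_at k i (?h tr) \<longleftrightarrow> \<not> same_at k i tr" "?h (?h tr) = tr"
    if tr: "path ss [] tr" for tr
  proof -
    show "path ss [] (?h tr)" using path_zip[OF psi(1) tr, of "(\<noteq>)"] by simp
    show "?h (?h tr) = tr" using path_lengths[OF psi(1) tr] by (intro zip_cancel) simp
    have len: "length psi = length ss" "length tr = length ss" using path_length psi(1) tr by metis+
    have "length (([] # psi) ! k) = outw 0 (take k ss)" "length (([] # tr) ! k) = outw 0 (take k ss)"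
      using path_length_nth[OF psi(1), of k] path_length_nth[OF tr, of k] k(1) by simp_all
    moreover have "([] # ?h tr) ! k = map2 (\<noteq>) (([] # psi) ! k) (([] # tr) ! k)"
      using len k(1) by (cases k) auto
    ultimately show "same_at k i (?h tr) \<longleftrightarrow> \<not> same_at k i tr"
      using k(2) psi(2) unfolding same_at_def by auto
  qed
  have "bij_betw ?h ?S ?D" using h by (intro bij_betwI[of _ _ _ ?h]) auto
  then have eq: "card ?S = card ?D" by (rule bij_betw_same_card)
  have fin: "finite {tr :: bool list list. path ss [] tr}"
    using finite_paths[of "UNIV :: bool set" ss "[]"] by simp
  have "card (?S \<union> ?D) = card ?S + card ?D"
    by (rule card_Un_disjoint) (use finite_subset[OF _ fin] in auto)
  moreover have "{tr :: bool list list. path ss [] tr} = ?S \<union> ?D" by blast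
  ultimately have "card {tr :: bool list list. path ss [] tr} = card ?S + card ?D" by (simp only:)
  then show ?thesis unfolding eq by (simp only: mult_2)
qed

lemma sub_crossing:
  assumes "path us [] t1" "last ([] # t1) = x @ b # c # y"
  shows "sub P (us @ (Cross p, length x) # vs) [] (t1 @ (x @ c # b # y) # t2)
    = sub P us [] t1 @ (if P b \<and> P c then [(Cross p, cnt P x)] else []) @ sub P vs (x @ c # b # y) t2"
  using path_length[OF assms(1)] assms(2) by (simp add: sub_append)

lemma sub_cap_cup:
  assumes "path us [] t1" "last ([] # t1) = x @ b # b # y"
  shows "sub P (us @ (Cap, length x) # (Cup, length x) # vs) [] (t1 @ (x @ y) # (x @ b # b # y) # t2)
    = sub P us [] t1 @ (if P b then [(Cap, cnt P x), (Cup, cnt P x)] else []) @ sub P vs (x @ b # b # y) t2"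
  using path_length[OF assms(1)] assms(2) by (simp add: sub_append)

lemma two_Least_power:
  assumes "0 < n"
  shows "(LEAST c. 2 * n \<le> 2 ^ c) = Suc (LEAST c. n \<le> (2::nat) ^ c)"
proof -
  have "(LEAST c. 2 * n \<le> 2 ^ c) = Suc (LEAST c. 2 * n \<le> 2 ^ Suc c)"
  proof (rule Least_Suc)
    show "2 * n \<le> 2 ^ (2 * n)" using less_exp[of "2 * n"] by simp
  qed (use assms in simp)
  then show ?thesis by simp
qed

section \<open>The state sums of a mixed Conway quadruple\<close>

context state_sum
begin

text \<open>Each of the \<open>2 ^ k\<close> sets of colours induces a different colouring by truth
  values.\<close>

lemma surj_cols_le:
  assumes "tr \<in> surj_cols k ss"
  shows "k \<le> num_comps ss"
proof -
  let ?h = "\<lambda>S. map (map (\<lambda>c. c \<in> S)) tr"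
  have "inj_on ?h (Pow {..<k})"
  proof (rule inj_onI)
    fix S S' assume S: "S \<in> Pow {..<k}" "S' \<in> Pow {..<k}" and eq: "?h S = ?h S'"
    have "c \<in> S \<longleftrightarrow> c \<in> S'" if "c < k" for c
    proof -
      from that assms have "c \<in> colours tr" by (auto simp: surj_cols_def)
      then obtain s where "s \<in> set tr" "c \<in> set s" by blast
      with eq show ?thesis by (simp add: map_eq_conv)
    qed
    with S show "S = S'" by blast
  qed
  moreover have "?h ` Pow {..<k} \<subseteq> {tr :: bool list list. path ss [] tr}"
    using path_map[of ss "[]" tr] assms by (auto simp: surj_cols_def)
  ultimately have "card (Pow {..<k}) \<le> num_bool_cols ss"
    unfolding num_bool_cols_def using finite_bool_cols by (rule card_inj_on_le)
  also have "\<dots> \<le> 2 ^ num_comps ss"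
    unfolding num_comps_def by (rule LeastI[of _ "num_bool_cols ss"]) (simp add: less_imp_le)
  finally show ?thesis by (simp add: card_Pow)
qed

lemma part_sum_0: "num_comps ss < k \<Longrightarrow> part_sum k ss = 0"
  using surj_cols_le[of _ k ss] by (intro part_sum_eqI) (force simp: surj_sum_def intro: sum.neutral)

context
  fixes us vs :: "slice list" and i :: nat
  assumes cl: "closed (us @ (Cross Pos, i) # vs)"
begin

lemma closed_smoothings:
  "closed (us @ (Cross p, i) # vs)" "closed (us @ (Cap, i) # (Cup, i) # vs)" "closed (us @ vs)"
proof -
  have "Suc (Suc i) \<le> outw 0 us" using cl by auto
  then have "Suc (Suc (outw 0 us - 2)) = outw 0 us" by arith
  with cl show "closed (us @ (Cross p, i) # vs)" "closed (us @ (Cap, i) # (Cup, i) # vs)" "closed (us @ vs)"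
    by auto
qed

text \<open>All four ends carry one colour \<open>b\<close>, so the quadruple is visible only in the
  factor of \<open>b\<close>, where it is a quadruple of sublinks to which the skein relation of
  \<open>G\<close> applies.\<close>

lemma weight_merged:
  assumes "(t1, t2) \<in> merged_cols us i vs" "colours (t1 @ t2) = {..<k}"
  defines "s \<equiv> last ([] # t1)"
  shows "weight k (us @ (Cross Pos, i) # vs) (t1 @ s # t2) - weight k (us @ (Cross Neg, i) # vs) (t1 @ s # t2)
    = w * (weight k (us @ (Cap, i) # (Cup, i) # vs) (t1 @ (take i s @ drop (i + 2) s) # s # t2)
      - weight k (us @ vs) (t1 @ t2))"
proof -
  let ?A = "\<lambda>p. us @ (Cross p, i) # vs" and ?L0 = "us @ (Cap, i) # (Cup, i) # vs"
  from assms(1) obtain x b y where t: "path us [] t1" "path vs s t2" "s = x @ b # b # y" "i = length x"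
    unfolding merged_cols_def s_def by auto
  have s: "last ([] # t1) = x @ b # b # y" using t(3) s_def by simp
  have "b \<in> colours t1" using s by (cases t1 rule: rev_cases) auto
  with assms(2) have b: "finite {..<k}" "b \<in> {..<k}" by auto
  define U where "U c = sub (\<lambda>d. d = c) us [] t1" for c
  define V where "V c = sub (\<lambda>d. d = c) vs s t2" for c
  define j where "j = cnt (\<lambda>d. d = b) x"
  have A: "sub (\<lambda>d. d = c) (?A p) [] (t1 @ s # t2) = U c @ (if b = c then [(Cross p, j)] else []) @ V c" for p c
    using sub_crossing[OF t(1) s, of "\<lambda>d. d = c" p vs t2] t(3,4) by (auto simp: U_def V_def j_def)
  have Z: "sub (\<lambda>d. d = c) ?L0 [] (t1 @ (take i s @ drop (i + 2) s) # s # t2)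
      = U c @ (if b = c then [(Cap, j), (Cup, j)] else []) @ V c" for c
    using sub_cap_cup[OF t(1) s, of "\<lambda>d. d = c" vs t2] t(3,4) by (auto simp: U_def V_def j_def)
  have I: "sub (\<lambda>d. d = c) (us @ vs) [] (t1 @ t2) = U c @ V c" for c
    using sub_append[of t1 us "\<lambda>d. d = c" vs "[]" t2] path_length[OF t(1)] by (simp add: U_def V_def s_def)
  have rest: "(\<Prod>c \<in> {..<k} - {b}. g (U c @ (if b = c then X else []) @ V c))
      = (\<Prod>c \<in> {..<k} - {b}. g (U c @ V c))" for X
    by (rule prod.cong) auto
  have "path (?A Pos) [] (t1 @ s # t2)" unfolding path_cross_iff using t s by blast
  from closed_sub[OF this cl, of "\<lambda>d. d = b"] have "closed (U b @ (Cross Pos, j) # V b)" unfolding A by simp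
  from g_skein[OF this]
  have "g (U b @ (Cross Pos, j) # V b) - g (U b @ (Cross Neg, j) # V b)
    = w * (g (U b @ (Cap, j) # (Cup, j) # V b) - g (U b @ V b))" .
  moreover have "weight k (?A p) (t1 @ s # t2) = g (U b @ (Cross p, j) # V b) * (\<Prod>c \<in> {..<k} - {b}. g (U c @ V c))" for p
    unfolding weight_def A prod.remove[OF b] rest by simp
  moreover have "weight k ?L0 (t1 @ (take i s @ drop (i + 2) s) # s # t2)
      = g (U b @ (Cap, j) # (Cup, j) # V b) * (\<Prod>c \<in> {..<k} - {b}. g (U c @ V c))"
    unfolding weight_def Z prod.remove[OF b] rest by simp
  moreover have "weight k (us @ vs) (t1 @ t2) = g (U b @ V b) * (\<Prod>c \<in> {..<k} - {b}. g (U c @ V c))"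
    unfolding weight_def I prod.remove[OF b] ..
  ultimately show ?thesis by (simp flip: left_diff_distrib add: mult.assoc[symmetric])
qed

text \<open>A crossing between different colours appears in no sublink of a single colour, so its
  type is invisible.\<close>

lemma weight_different:
  assumes "path (us @ (Cross p, i) # vs) [] tr" "\<not> same_at (length us) i tr"
  shows "weight k (us @ (Cross Pos, i) # vs) tr = weight k (us @ (Cross Neg, i) # vs) tr"
proof -
  from assms(1) obtain x b c y t1 t2 where t: "tr = t1 @ (x @ c # b # y) # t2" "path us [] t1"
    "last ([] # t1) = x @ b # c # y" "i = length x" unfolding path_cross_iff by blast
  then have "b \<noteq> c"
    using assms(2) state_at[OF t(2), of "(x @ c # b # y) # t2"] by (auto simp: same_at_def nth_append)
  then have "(b = d \<and> c = d) = False" for d by blast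
  then show ?thesis
    unfolding weight_def t(1,4) sub_crossing[OF t(2,3)] by (simp only: if_False)
qed

context
  fixes psi :: "bool list list"
  assumes psi: "path (us @ (Cross Pos, i) # vs) [] psi" "\<not> same_at (length us) i psi"
begin

lemma merged_smoothings:
  "{tr :: 'c list list. path (us @ vs) [] tr} = (\<lambda>(t1, t2). t1 @ t2) ` merged_cols us i vs"
  "{tr :: 'c list list. path (us @ (Cap, i) # (Cup, i) # vs) [] tr} =
    (\<lambda>(t1, t2). t1 @ (take i (last ([] # t1)) @ drop (i + 2) (last ([] # t1))) # last ([] # t1) # t2)
      ` merged_cols us i vs"
proof -
  from psi(1) obtain x b c y t1 t2 where t: "psi = t1 @ (x @ c # b # y) # t2" "path us [] t1"
    "last ([] # t1) = x @ b # c # y" "i = length x" "path vs (x @ c # b # y) t2"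
    unfolding path_cross_iff by blast
  then have "b \<noteq> c"
    using psi(2) state_at[OF t(2), of "(x @ c # b # y) # t2"] by (auto simp: same_at_def nth_append)
  moreover have "outw (outw 0 us) vs = 0" using closed_smoothings(3) by simp
  ultimately show "{tr :: 'c list list. path (us @ vs) [] tr} = (\<lambda>(t1, t2). t1 @ t2) ` merged_cols us i vs"
    "{tr :: 'c list list. path (us @ (Cap, i) # (Cup, i) # vs) [] tr} =
    (\<lambda>(t1, t2). t1 @ (take i (last ([] # t1)) @ drop (i + 2) (last ([] # t1))) # last ([] # t1) # t2)
      ` merged_cols us i vs"
    using merged_infinity[OF t(2,3,5)] merged_zero[OF t(2,3,5)] t(4) by blast+
qed

text \<open>What remains after the cancellation is reindexed over the set \<open>?M\<close> of
  surjective colourings of the complement; there \<open>weight_merged\<close> applies term by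
  term.\<close>

lemma surj_sum_skein:
  "surj_sum k (us @ (Cross Pos, i) # vs) - surj_sum k (us @ (Cross Neg, i) # vs)
    = w * (surj_sum k (us @ (Cap, i) # (Cup, i) # vs) - surj_sum k (us @ vs))"
proof -
  let ?A = "\<lambda>p. us @ (Cross p, i) # vs" and ?L0 = "us @ (Cap, i) # (Cup, i) # vs"
  let ?s = "\<lambda>t1. last ([] # t1) :: nat list"
  let ?M = "{(t1, t2) \<in> merged_cols us i vs. colours (t1 @ t2) = {..<k}}"
  let ?fA = "\<lambda>(t1, t2). t1 @ ?s t1 # t2" and ?fI = "\<lambda>(t1, t2). t1 @ t2"
    and ?f0 = "\<lambda>(t1, t2). t1 @ (take i (?s t1) @ drop (i + 2) (?s t1)) # ?s t1 # t2"
  have cols: "colours (t1 @ ?s t1 # t2) = colours (t1 @ t2)"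
    "colours (t1 @ (take i (?s t1) @ drop (i + 2) (?s t1)) # ?s t1 # t2) = colours (t1 @ t2)"
    if "(t1, t2) \<in> merged_cols us i vs" for t1 t2
  proof -
    have "?s t1 \<in> set t1" using that unfolding merged_cols_def by (cases t1 rule: rev_cases) auto
    then have "set (?s t1) \<subseteq> colours t1" by blast
    then show "colours (t1 @ ?s t1 # t2) = colours (t1 @ t2)"
      "colours (t1 @ (take i (?s t1) @ drop (i + 2) (?s t1)) # ?s t1 # t2) = colours (t1 @ t2)"
      using set_take_subset[of i "?s t1"] set_drop_subset[of "i + 2" "?s t1"] by auto
  qed
  have img: "{tr \<in> f ` A. colours tr = {..<k}} = f ` {t \<in> A. colours (f t) = {..<k}}"
    for f :: "nat list list \<times> nat list list \<Rightarrow> nat list list" and A by blast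
  have M: "{t \<in> merged_cols us i vs. colours (f t) = {..<k}} = ?M"
    if f: "\<And>t1 t2. (t1, t2) \<in> merged_cols us i vs \<Longrightarrow> colours (f (t1, t2)) = colours (t1 @ t2)" for f
  proof (rule set_eqI)
    fix t :: "nat list list \<times> nat list list"
    obtain t1 t2 where t: "t = (t1, t2)" by force
    show "t \<in> {t \<in> merged_cols us i vs. colours (f t) = {..<k}} \<longleftrightarrow> t \<in> ?M"
      unfolding mem_Collect_eq t prod.case by (rule conj_cong[OF refl]) (simp only: f)
  qed
  have sI: "surj_cols k (us @ vs) = ?fI ` ?M"
  proof -
    have "surj_cols k (us @ vs) = {tr \<in> ?fI ` merged_cols us i vs. colours tr = {..<k}}"
      unfolding surj_cols_def merged_smoothings(1)[symmetric] by blast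
    also have "\<dots> = ?fI ` ?M" unfolding img by (subst M) (simp_all only: prod.case)
    finally show ?thesis .
  qed
  have s0: "surj_cols k ?L0 = ?f0 ` ?M"
  proof -
    have "surj_cols k ?L0 = {tr \<in> ?f0 ` merged_cols us i vs. colours tr = {..<k}}"
      unfolding surj_cols_def merged_smoothings(2)[symmetric] by blast
    also have "\<dots> = ?f0 ` ?M" unfolding img by (subst M) (simp_all only: prod.case cols)
    finally show ?thesis .
  qed
  have sA: "{tr \<in> surj_cols k (?A p). same_at (length us) i tr} = ?fA ` ?M" for p
  proof -
    have "{tr \<in> surj_cols k (?A p). same_at (length us) i tr}
        = {tr \<in> ?fA ` merged_cols us i vs. colours tr = {..<k}}"
      unfolding surj_cols_def merged_crossing[of us p, symmetric] by blast
    also have "\<dots> = ?fA ` ?M" unfolding img by (subst M) (simp_all only: prod.case cols)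
    finally show ?thesis .
  qed
  have inj: "inj_on ?fA ?M" "inj_on ?fI ?M" "inj_on ?f0 ?M"
    using inj_merged[of "\<lambda>t1. [?s t1]" us i vs] inj_merged[of "\<lambda>_. []" us i vs]
      inj_merged[of "\<lambda>t1. [take i (?s t1) @ drop (i + 2) (?s t1), ?s t1]" us i vs]
    by (auto elim!: inj_on_subset)
  have split: "surj_sum k (?A p) = (\<Sum>(t1, t2) \<in> ?M. weight k (?A p) (t1 @ ?s t1 # t2)) +
      (\<Sum>tr \<in> {tr \<in> surj_cols k (?A p). \<not> same_at (length us) i tr}. weight k (?A p) tr)" for p
  proof -
    have "surj_sum k (?A p) = (\<Sum>tr \<in> {tr \<in> surj_cols k (?A p). same_at (length us) i tr}. weight k (?A p) tr) +
      (\<Sum>tr \<in> {tr \<in> surj_cols k (?A p). \<not> same_at (length us) i tr}. weight k (?A p) tr)"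
      unfolding surj_sum_def using finite_surj_cols[of k "?A p"]
      by (subst sum.union_disjoint[symmetric]) (auto intro!: sum.cong)
    then show ?thesis unfolding sA sum.reindex[OF inj(1)] by (simp add: o_def case_prod_beta)
  qed
  have "surj_cols k (?A p) = surj_cols k (?A q)" for p q
    unfolding surj_cols_def path_cross_iff ..
  then have "(\<Sum>tr \<in> {tr \<in> surj_cols k (?A Pos). \<not> same_at (length us) i tr}. weight k (?A Pos) tr)
     = (\<Sum>tr \<in> {tr \<in> surj_cols k (?A Neg). \<not> same_at (length us) i tr}. weight k (?A Neg) tr)"
    using weight_different[of Neg _ k] by (intro sum.cong) (auto simp: surj_cols_def)
  then have "surj_sum k (?A Pos) - surj_sum k (?A Neg)
    = (\<Sum>(t1, t2) \<in> ?M. weight k (?A Pos) (t1 @ ?s t1 # t2) - weight k (?A Neg) (t1 @ ?s t1 # t2))"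
    unfolding split by (simp add: sum_subtractf case_prod_beta)
  also have "\<dots> = (\<Sum>t \<in> ?M. w * (weight k ?L0 (?f0 t) - weight k (us @ vs) (?fI t)))"
  proof (rule sum.cong[OF refl])
    fix t :: "nat list list \<times> nat list list" assume "t \<in> ?M"
    then obtain t1 t2 where t: "t = (t1, t2)" "(t1, t2) \<in> merged_cols us i vs" "colours (t1 @ t2) = {..<k}"
      by blast
    from weight_merged[OF t(2,3)]
    show "(case t of (t1, t2) \<Rightarrow> weight k (?A Pos) (t1 @ ?s t1 # t2) - weight k (?A Neg) (t1 @ ?s t1 # t2))
      = w * (weight k ?L0 (?f0 t) - weight k (us @ vs) (?fI t))"
      unfolding t(1) prod.case .
  qed
  also have "\<dots> = w * ((\<Sum>t \<in> ?M. weight k ?L0 (?f0 t)) - (\<Sum>t \<in> ?M. weight k (us @ vs) (?fI t)))"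
    by (simp only: sum_distrib_left[symmetric] sum_subtractf)
  also have "\<dots> = w * (surj_sum k ?L0 - surj_sum k (us @ vs))"
    unfolding surj_sum_def sI s0 sum.reindex[OF inj(2)] sum.reindex[OF inj(3)] by (simp only: o_def)
  finally show ?thesis .
qed

text \<open>The diagram with the crossing has twice as many colourings by truth values as either
  smoothing, since only one half of them agree at the crossing.\<close>

lemma num_comps_skein:
  "num_comps (us @ (Cross p, i) # vs) = Suc (num_comps (us @ vs))"
  "num_comps (us @ (Cap, i) # (Cup, i) # vs) = num_comps (us @ vs)"
proof -
  let ?M = "merged_cols us i vs :: (bool list list \<times> _) set"
  have 1: "num_bool_cols (us @ vs) = card ?M"
    unfolding num_bool_cols_def merged_smoothings(1)
    using inj_merged[of "\<lambda>_. [] :: bool list list" us i vs] by (simp add: card_image)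
  have 2: "num_bool_cols (us @ (Cap, i) # (Cup, i) # vs) = card ?M"
    unfolding num_bool_cols_def merged_smoothings(2)
    using inj_merged[of "\<lambda>t1 :: bool list list. [take i (last ([] # t1)) @ drop (i + 2) (last ([] # t1)), last ([] # t1)]" us i vs]
    by (simp add: card_image)
  have path: "path (us @ (Cross p, i) # vs) [] psi" using psi(1) unfolding path_cross_iff .
  have "Suc i < outw 0 (take (length us) (us @ (Cross p, i) # vs))" using cl by auto
  then have "num_bool_cols (us @ (Cross p, i) # vs)
      = 2 * card {tr :: bool list list. path (us @ (Cross p, i) # vs) [] tr \<and> same_at (length us) i tr}"
    unfolding num_bool_cols_def by (intro card_same_at[OF path psi(2)]) simp_all
  also have "card {tr :: bool list list. path (us @ (Cross p, i) # vs) [] tr \<and> same_at (length us) i tr} = card ?M"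
    unfolding merged_crossing using inj_merged[of "\<lambda>t1 :: bool list list. [last ([] # t1)]" us i vs] by (simp add: card_image)
  finally have 3: "num_bool_cols (us @ (Cross p, i) # vs) = 2 * card ?M" .
  have "path (us @ vs) [] (const_col True 0 (us @ vs))"
    using path_const_col[of 0 "us @ vs" True] closed_smoothings(3) by simp
  then have "0 < num_bool_cols (us @ vs)"
    unfolding num_bool_cols_def using finite_bool_cols by (auto simp: card_gt_0_iff)
  then show "num_comps (us @ (Cross p, i) # vs) = Suc (num_comps (us @ vs))"
    unfolding num_comps_def 1 3 by (rule two_Least_power)
  show "num_comps (us @ (Cap, i) # (Cup, i) # vs) = num_comps (us @ vs)"
    unfolding num_comps_def 1 2 ..
qed

lemma state_sum_skein:
  "state_sum (us @ (Cross Pos, i) # vs) - state_sum (us @ (Cross Neg, i) # vs)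
    = z * (state_sum (us @ (Cap, i) # (Cup, i) # vs) - state_sum (us @ vs))"
proof -
  let ?A = "\<lambda>p. us @ (Cross p, i) # vs" and ?L0 = "us @ (Cap, i) # (Cup, i) # vs" and ?I = "us @ vs"
  define c where "c = num_comps ?I"
  have part: "part_sum k (?A Pos) - part_sum k (?A Neg) = w * (part_sum k ?L0 - part_sum k ?I)" for k
  proof (rule torsion_free[of "fact k"])
    show "of_nat (fact k) * (part_sum k (?A Pos) - part_sum k (?A Neg))
        = of_nat (fact k) * (w * (part_sum k ?L0 - part_sum k ?I))"
      using surj_sum_skein[of k] unfolding surj_sum_eq by (simp add: algebra_simps)
  qed simp
  have "state_sum (?A Pos) - state_sum (?A Neg)
      = (\<Sum>k \<le> Suc c. (z * wi) ^ (Suc c - k) * coeff k * (part_sum k (?A Pos) - part_sum k (?A Neg)))"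
    unfolding state_sum_def num_comps_skein c_def
    by (simp add: right_diff_distrib del: sum.atMost_Suc flip: sum_subtractf)
  also have "\<dots> = (\<Sum>k \<le> Suc c. (z * wi) ^ (Suc c - k) * coeff k * (w * (part_sum k ?L0 - part_sum k ?I)))"
    unfolding part ..
  \<comment> \<open>The term with \<open>Suc c\<close> blocks drops out, because the smoothings have
    only \<open>c\<close> components.\<close>
  also have "\<dots> = (\<Sum>k \<le> c. (z * wi) ^ (Suc c - k) * coeff k * (w * (part_sum k ?L0 - part_sum k ?I)))"
    using part_sum_0[of ?L0 "Suc c"] part_sum_0[of ?I "Suc c"] num_comps_skein(2) by (simp add: c_def)
  also have "\<dots> = (\<Sum>k \<le> c. z * ((z * wi) ^ (c - k) * coeff k * part_sum k ?L0
      - (z * wi) ^ (c - k) * coeff k * part_sum k ?I))"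
  proof (rule sum.cong)
    fix k assume "k \<in> {..c}"
    then have "(z * wi) ^ (Suc c - k) * coeff k * (w * (part_sum k ?L0 - part_sum k ?I))
        = (w * wi) * (z * ((z * wi) ^ (c - k) * coeff k * (part_sum k ?L0 - part_sum k ?I)))"
      by (simp add: Suc_diff_le ac_simps)
    then show "(z * wi) ^ (Suc c - k) * coeff k * (w * (part_sum k ?L0 - part_sum k ?I))
        = z * ((z * wi) ^ (c - k) * coeff k * part_sum k ?L0 - (z * wi) ^ (c - k) * coeff k * part_sum k ?I)"
      unfolding w by (simp add: right_diff_distrib)
  qed simp
  also have "\<dots> = z * (state_sum ?L0 - state_sum ?I)"
    unfolding state_sum_def num_comps_skein(2) c_def by (simp add: sum_subtractf flip: sum_distrib_left)
  finally show ?thesis .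
qed

end

end

end

subsection \<open>Unions of unlinked knots\<close>

text \<open>Surjections onto \<open>A\<close>, sorted by their first entry \<open>x\<close>: the
  rest either still attains \<open>x\<close> or it does not, and this is the recurrence of the
  Stirling numbers.\<close>

lemma card_lists_set_eq:
  "finite A \<Longrightarrow> card {f. length f = r \<and> set f = A} = fact (card A) * Stirling r (card A)"
proof (induction r arbitrary: A)
  case 0
  show ?case
  proof (cases "A = {}")
    case True
    then have "{f :: 'a list. length f = 0 \<and> set f = A} = {[]}" by auto
    with True show ?thesis by simp
  next
    case False
    then have "{f :: 'a list. length f = 0 \<and> set f = A} = {}" by auto
    moreover obtain k where "card A = Suc k" using 0 False by (cases "card A") auto
    ultimately show ?thesis by simp
  qed
next
  case (Suc r)
  let ?N = "\<lambda>A. {f :: 'a list. length f = r \<and> set f = A}"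
  have eq: "{f :: 'a list. length f = Suc r \<and> set f = A} = (\<Union>x \<in> A. (#) x ` (?N A \<union> ?N (A - {x})))"
  proof (intro set_eqI iffI)
    fix f assume "f \<in> {f. length f = Suc r \<and> set f = A}"
    then obtain x f' where f: "f = x # f'" "length f' = r" "A = insert x (set f')" by (auto simp: length_Suc_conv)
    then have "f' \<in> ?N A \<union> ?N (A - {x})" by auto
    with f show "f \<in> (\<Union>x \<in> A. (#) x ` (?N A \<union> ?N (A - {x})))" by blast
  next
    fix f assume "f \<in> (\<Union>x \<in> A. (#) x ` (?N A \<union> ?N (A - {x})))"
    then obtain x f' where f: "x \<in> A" "f = x # f'" "length f' = r" "set f' = A \<or> set f' = A - {x}" by blast
    then have "insert x (set f') = A" by blast
    with f show "f \<in> {f. length f = Suc r \<and> set f = A}" by simp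
  qed
  have fin: "finite (?N B)" if "finite B" for B
    using finite_lists_length_eq[OF that, of r] by (rule finite_subset[rotated]) auto
  have "card {f :: 'a list. length f = Suc r \<and> set f = A} = (\<Sum>x \<in> A. card ((#) x ` (?N A \<union> ?N (A - {x}))))"
    unfolding eq using Suc.prems fin by (intro card_UN_disjoint) auto
  also have "\<dots> = (\<Sum>x \<in> A. fact (card A) * Stirling r (card A) + fact (card A - 1) * Stirling r (card A - 1))"
  proof (rule sum.cong)
    fix x assume x: "x \<in> A"
    have "card ((#) x ` (?N A \<union> ?N (A - {x}))) = card (?N A \<union> ?N (A - {x}))" by (rule card_image) simp
    also have "\<dots> = card (?N A) + card (?N (A - {x}))"
      using Suc.prems fin x by (intro card_Un_disjoint) auto
    finally show "card ((#) x ` (?N A \<union> ?N (A - {x})))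
        = fact (card A) * Stirling r (card A) + fact (card A - 1) * Stirling r (card A - 1)"
      using Suc.IH[of A] Suc.IH[of "A - {x}"] Suc.prems x by (simp add: card_Diff_singleton)
  qed simp
  also have "\<dots> = fact (card A) * Stirling (Suc r) (card A)"
    by (cases "card A") (simp_all add: algebra_simps)
  finally show ?case .
qed

text \<open>The homogeneous form of the expansion of \<open>y ^ Suc n\<close> in falling factorials
  of step \<open>x\<close>, with one factor \<open>y\<close> removed from both sides; hence the
  products start at 1 instead of 0. The proof follows the recurrence of the Stirling numbers and
  needs no division.\<close>

lemma Stirling_expansion:
  fixes x y :: "'a::comm_ring_1"
  shows "(\<Sum>k \<le> Suc n. x ^ (Suc n - k) * (\<Prod>i = 1..<k. y - of_nat i * x) * of_nat (Stirling (Suc n) k)) = y ^ n"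
proof (induction n)
  case 0
  then show ?case by simp
next
  case (Suc n)
  let ?r = "Suc n"
  define e where "e k = (\<Prod>i = 1..<k. y - of_nat i * x)" for k
  \<comment> \<open>At \<open>k = 0\<close> the product does not gain the factor \<open>y\<close>,
    but there the Stirling number is 0.\<close>
  have e: "e (Suc k) * of_nat (Stirling ?r k) = (y - of_nat k * x) * e k * of_nat (Stirling ?r k)" for k
    by (cases k) (simp_all add: e_def prod.atLeastLessThan_Suc)
  have 1: "(\<Sum>k \<le> ?r. x ^ (?r - k) * e (Suc k) * of_nat (Suc k * Stirling ?r (Suc k)))
      = (\<Sum>k \<le> ?r. x * (x ^ (?r - k) * (of_nat k * e k * of_nat (Stirling ?r k))))"
  proof -
    have "(\<Sum>k \<le> ?r. x ^ (?r - k) * e (Suc k) * of_nat (Suc k * Stirling ?r (Suc k)))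
        = (\<Sum>k \<le> Suc ?r. x ^ (Suc ?r - k) * e k * of_nat (k * Stirling ?r k))"
      by (subst sum.atMost_Suc_shift[of _ ?r]) simp
    also have "\<dots> = (\<Sum>k \<le> ?r. x ^ (Suc ?r - k) * e k * of_nat (k * Stirling ?r k))"
      by (subst sum.atMost_Suc) (simp del: Stirling.simps)
    also have "\<dots> = (\<Sum>k \<le> ?r. x * (x ^ (?r - k) * (of_nat k * e k * of_nat (Stirling ?r k))))"
      by (rule sum.cong) (simp_all add: Suc_diff_le ac_simps del: Stirling.simps)
    finally show ?thesis .
  qed
  have "(\<Sum>k \<le> Suc ?r. x ^ (Suc ?r - k) * e k * of_nat (Stirling (Suc ?r) k))
      = (\<Sum>k \<le> ?r. x ^ (?r - k) * e (Suc k) * of_nat (Stirling (Suc ?r) (Suc k)))"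
    by (subst sum.atMost_Suc_shift) simp
  also have "\<dots> = (\<Sum>k \<le> ?r. x ^ (?r - k) * e (Suc k) * of_nat (Suc k * Stirling ?r (Suc k)))
      + (\<Sum>k \<le> ?r. x ^ (?r - k) * (e (Suc k) * of_nat (Stirling ?r k)))"
    unfolding Stirling.simps(4)[of ?r] of_nat_add by (simp only: distrib_left sum.distrib mult.assoc)
  also have "\<dots> = (\<Sum>k \<le> ?r. y * (x ^ (?r - k) * e k * of_nat (Stirling ?r k)))"
    unfolding 1 e sum.distrib[symmetric] by (rule sum.cong) (simp_all add: algebra_simps del: Stirling.simps)
  also have "\<dots> = y * y ^ n" using Suc.IH unfolding e_def sum_distrib_left[symmetric] by simp
  finally show ?case unfolding e_def by simp
qed

section \<open>Colourings of split unions of knots\<close>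

definition union_col :: "slice list list \<Rightarrow> 'c list \<Rightarrow> 'c list list" where
  "union_col Ks f = concat (map2 (\<lambda>K c. const_col c 0 K) Ks f)"

lemma colours_const_col:
  assumes "closed K" "K \<noteq> []"
  shows "colours (const_col c 0 K) = {c}"
proof -
  have "colours (const_col c n K) \<subseteq> {c}" for n
    by (induction c n K rule: const_col.induct) auto
  moreover obtain i K' where "K = (Cup, i) # K'"
    using assms by (cases K; cases "hd K"; cases "fst (hd K)") auto
  ultimately show ?thesis by auto
qed

lemma path_union:
  assumes "\<And>K. K \<in> set Ks \<Longrightarrow> closed K \<and> (\<forall>tr :: 'c list list. path K [] tr \<longrightarrow> (\<exists>c. colours tr \<subseteq> {c}))"
  shows "path (concat Ks) [] (tr :: 'c list list) \<longleftrightarrow> (\<exists>f. length f = length Ks \<and> tr = union_col Ks f)"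
  using assms
proof (induction Ks arbitrary: tr)
  case (Cons K Ks)
  have K: "closed K" "\<And>tr :: 'c list list. path K [] tr \<Longrightarrow> \<exists>c. colours tr \<subseteq> {c}" using Cons.prems[of K] by auto
  have end_nil: "last ([] # t) = []" if "path K [] t" for t :: "'c list list" using path_fits[OF that] K(1) by simp
  have const_col: "path K [] (const_col c 0 K)" for c :: 'c using path_const_col[of 0 K c] K(1) by simp
  have IH: "path (concat Ks) [] t \<longleftrightarrow> (\<exists>f. length f = length Ks \<and> t = union_col Ks f)" for t :: "'c list list"
    by (rule Cons.IH) (rule Cons.prems, simp)
  show ?case
  proof
    assume "path (concat (K # Ks)) [] tr"
    then obtain t1 t2 where t: "tr = t1 @ t2" "path K [] t1" "path (concat Ks) (last ([] # t1)) t2"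
      by (auto simp: path_append simp del: last.simps)
    obtain c where "colours t1 \<subseteq> {c}" using K(2)[OF t(2)] by blast
    then have "t1 = const_col c 0 K" using const_col_unique[of K 0 c t1] t(2) by simp
    moreover obtain f where "length f = length Ks" "t2 = union_col Ks f"
      using IH t(3) end_nil[OF t(2)] by auto
    ultimately show "\<exists>f. length f = length (K # Ks) \<and> tr = union_col (K # Ks) f"
      using t(1) by (intro exI[of _ "c # f"]) (simp add: union_col_def)
  next
    assume "\<exists>f. length f = length (K # Ks) \<and> tr = union_col (K # Ks) f"
    then obtain c f where f: "length f = length Ks" "tr = const_col c 0 K @ union_col Ks f"
      by (auto simp: length_Suc_conv union_col_def)
    have "path (concat Ks) (last ([] # const_col c 0 K)) (union_col Ks f)"
      unfolding end_nil[OF const_col] IH using f(1) by blast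
    with f(2) const_col[of c] show "path (concat (K # Ks)) [] tr"
      unfolding concat.simps path_append by blast
  qed
qed (simp add: union_col_def)

lemma sub_union:
  "length f = length Ks \<Longrightarrow> \<forall>K \<in> set Ks. closed K \<Longrightarrow>
    sub P (concat Ks) [] (union_col Ks f) = concat (map fst (filter (\<lambda>(K, c). P c) (zip Ks f)))"
proof (induction f Ks rule: list_induct2)
  case (Cons c f K Ks)
  have "path K [] (const_col c 0 K)" using path_const_col[of 0 K c] Cons.prems by simp
  from path_fits[OF this] have "last ([] # const_col c 0 K) = []" using Cons.prems by simp
  moreover have "sub P K [] (const_col c 0 K) = (if P c then K else [])"
    using sub_const_col[of 0 K P c] Cons.prems by simp
  ultimately show ?case
    using Cons by (simp add: union_col_def sub_append del: last.simps)
qed (simp add: union_col_def)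

lemma colours_union:
  "length f = length Ks \<Longrightarrow> \<forall>K \<in> set Ks. closed K \<and> K \<noteq> [] \<Longrightarrow> colours (union_col Ks f) = set f"
proof (induction f Ks rule: list_induct2)
  case (Cons c f K Ks)
  then show ?case using colours_const_col[of K c] by (simp add: union_col_def)
qed (simp add: union_col_def)

lemma inj_union:
  assumes "\<forall>K \<in> set Ks. closed K \<and> K \<noteq> []"
  shows "inj_on (union_col Ks) {f. length f = length Ks}"
proof (rule inj_onI)
  fix f f' :: "'c list"
  assume "f \<in> {f. length f = length Ks}" "f' \<in> {f. length f = length Ks}" "union_col Ks f = union_col Ks f'"
  then have "length f = length Ks" "length f' = length Ks" "union_col Ks f = union_col Ks f'" by auto
  then show "f = f'"
    using assms
  proof (induction f Ks arbitrary: f' rule: list_induct2)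
    case (Cons c f K Ks)
    from Cons.prems(1) obtain c' g where g: "f' = c' # g" "length g = length Ks" by (auto simp: length_Suc_conv)
    have eq: "const_col c 0 K = const_col c' 0 K" "union_col Ks f = union_col Ks g"
      using Cons.prems(2) g(1) by (simp_all add: union_col_def)
    have "{c} = {c'}" using eq(1) colours_const_col[of K] Cons.prems(3) by (metis list.set_intros(1))
    with Cons.IH[OF g(2) eq(2)] Cons.prems(3) g show ?case by simp
  qed simp
qed

lemma sum_length_filter:
  fixes ps :: "('b \<times> nat) list"
  shows "set (map snd ps) \<subseteq> {..<k} \<Longrightarrow> (\<Sum>c<k. length (filter (\<lambda>p. snd p = c) ps)) = length ps"
proof (induction ps)
  case (Cons p ps)
  have "(\<Sum>c<k. length (filter (\<lambda>p. snd p = c) (p # ps)))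
      = (\<Sum>c<k. (if snd p = c then 1 else 0) + length (filter (\<lambda>p. snd p = c) ps))"
    by (rule sum.cong) auto
  also have "\<dots> = 1 + length ps"
  proof -
    have "(\<Sum>c<k. if snd p = c then 1 else 0) = (1 :: nat)"
      using Cons.prems by (subst sum.delta') auto
    with Cons show ?thesis by (simp only: sum.distrib) simp
  qed
  finally show ?case by simp
qed simp

lemma prod_prod_list_filter:
  fixes h :: "'b \<Rightarrow> 'r::comm_monoid_mult" and ps :: "('b \<times> nat) list"
  shows "set (map snd ps) \<subseteq> {..<k} \<Longrightarrow>
    (\<Prod>c<k. prod_list (map (\<lambda>p. h (fst p)) (filter (\<lambda>p. snd p = c) ps))) = prod_list (map (\<lambda>p. h (fst p)) ps)"
proof (induction ps)
  case (Cons p ps)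
  have "(\<Prod>c<k. prod_list (map (\<lambda>p. h (fst p)) (filter (\<lambda>p. snd p = c) (p # ps))))
      = (\<Prod>c<k. (if snd p = c then h (fst p) else 1) * prod_list (map (\<lambda>p. h (fst p)) (filter (\<lambda>p. snd p = c) ps)))"
    by (rule prod.cong) auto
  also have "\<dots> = h (fst p) * prod_list (map (\<lambda>p. h (fst p)) ps)"
  proof -
    have "(\<Prod>c<k. if snd p = c then h (fst p) else 1) = h (fst p)"
      using Cons.prems by (subst prod.delta') auto
    moreover have "set (map snd ps) \<subseteq> {..<k}" using Cons.prems by simp
    ultimately show ?thesis unfolding prod.distrib by (simp only: Cons.IH)
  qed
  finally show ?case by (simp only: list.map prod_list.Cons)
qed simp

context state_sum
begin

text \<open>A block of \<open>j\<close> knots contributes \<open>delta ^ (j - 1)\<close>. No block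
  is empty, as all \<open>k\<close> colours occur, so the exponents add up to
  \<open>length Ks - k\<close>.\<close>

lemma weight_union:
  assumes f: "length f = length Ks" "set f = {..<k}" and Ks: "Ks \<noteq> []"
  shows "weight k (concat (map slices Ks)) (union_col (map slices Ks) f)
    = delta ^ (length Ks - k) * prod_list (map G Ks)"
proof -
  define ps where "ps = zip Ks f"
  define m where "m c = filter (\<lambda>p. snd p = c) ps" for c
  have cl: "closed (slices K)" for K using is_link_diagram_slices is_link_diagram_iff by blast
  have ps: "set (map snd ps) = {..<k}" "length ps = length Ks" "map fst ps = Ks"
    using f by (simp_all add: ps_def)
  have m: "m c \<noteq> []" if "c < k" for c
  proof -
    from that ps(1) have "c \<in> snd ` set ps" by simp
    then show ?thesis unfolding m_def by (auto simp: filter_empty_conv)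
  qed
  have "sub (\<lambda>d. d = c) (concat (map slices Ks)) [] (union_col (map slices Ks) f)
      = concat (map slices (map fst (m c)))" for c
  proof -
    have "filter (\<lambda>(K, d). d = c) (zip (map slices Ks) f) = map (\<lambda>(K, d). (slices K, d)) (m c)"
      unfolding m_def ps_def zip_map1 filter_map by (simp add: o_def case_prod_beta)
    then show ?thesis
      using sub_union[of f "map slices Ks" "\<lambda>d. d = c"] f(1) cl by (simp add: case_prod_beta o_def)
  qed
  then have "weight k (concat (map slices Ks)) (union_col (map slices Ks) f)
      = (\<Prod>c<k. g (concat (map slices (map fst (m c)))))" unfolding weight_def by simp
  also have "\<dots> = (\<Prod>c<k. delta ^ (length (m c) - 1) * prod_list (map (\<lambda>p. G (fst p)) (m c)))"
    using g_concat[OF unknot, of "map fst (m _)"] m by (intro prod.cong) (auto simp: o_def)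
  also have "\<dots> = delta ^ (\<Sum>c<k. length (m c) - 1) * (\<Prod>c<k. prod_list (map (\<lambda>p. G (fst p)) (m c)))"
    by (simp add: prod.distrib power_sum)
  also have "(\<Sum>c<k. length (m c) - 1) = (\<Sum>c<k. length (m c)) - (\<Sum>c<k. 1)"
    using m by (intro sum_subtractf_nat) (simp add: Suc_le_eq)
  also have "(\<Sum>c<k. length (m c)) = length Ks"
    using sum_length_filter[of ps k] ps by (simp add: m_def)
  also have "(\<Prod>c<k. prod_list (map (\<lambda>p. G (fst p)) (m c))) = prod_list (map G Ks)"
    using prod_prod_list_filter[of ps k G] ps(1) unfolding m_def ps(3)[symmetric] by (simp add: o_def)
  finally show ?thesis by simp
qed

text \<open>Each knot carries a single colour, so the surjective colourings are the surjections from
  the list of knots to the colours, all of the same weight.\<close>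

lemma state_sum_union:
  assumes knots: "\<forall>K \<in> set Ks. is_knot_diagram K" and Ks: "Ks \<noteq> []"
  shows "state_sum (concat (map slices Ks)) = Ei ^ (length Ks - 1) * g (concat (map slices Ks))"
proof -
  let ?S = "concat (map slices Ks)" and ?K = "map slices Ks" and ?r = "length Ks"
  have cl: "\<forall>K \<in> set ?K. closed K \<and> K \<noteq> []"
    using is_link_diagram_slices is_link_diagram_iff by auto
  have path: "path ?S [] tr \<longleftrightarrow> (\<exists>f. length f = ?r \<and> tr = union_col ?K f)" for tr :: "'c list list"
  proof -
    have "closed K \<and> (\<forall>tr :: 'c list list. path K [] tr \<longrightarrow> (\<exists>c. colours tr \<subseteq> {c}))" if "K \<in> set ?K" for K
      using cl that knots knot_colouring by fastforce
    from path_union[of ?K tr, OF this] show ?thesis by simp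
  qed
  have nb: "num_bool_cols ?S = 2 ^ ?r"
  proof -
    have "{tr :: bool list list. path ?S [] tr} = union_col ?K ` {f. length f = ?r}" using path by auto
    moreover have "inj_on (union_col ?K) {f :: bool list. length f = ?r}" using inj_union[OF cl] by simp
    moreover have "card {f :: bool list. length f = ?r} = 2 ^ ?r"
      using card_lists_length_eq[of "UNIV :: bool set" ?r] by simp
    ultimately show ?thesis unfolding num_bool_cols_def by (simp add: card_image)
  qed
  then have nc: "num_comps ?S = ?r"
    unfolding num_comps_def nb by (intro Least_equality) (auto dest: power_le_imp_le_exp[rotated])
  have ps: "part_sum k ?S = of_nat (Stirling ?r k) * (delta ^ (?r - k) * prod_list (map G Ks))" for k
  proof (rule part_sum_eqI)
    have sc: "surj_cols k ?S = union_col ?K ` {f. length f = ?r \<and> set f = {..<k}}"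
      unfolding surj_cols_def path using colours_union[OF _ cl] by auto
    have inj: "inj_on (union_col ?K) {f :: nat list. length f = ?r \<and> set f = {..<k}}"
      using inj_union[OF cl] by (rule inj_on_subset) auto
    have "surj_sum k ?S = (\<Sum>f \<in> {f. length f = ?r \<and> set f = {..<k}}. weight k ?S (union_col ?K f))"
      unfolding surj_sum_def sc sum.reindex[OF inj] by simp
    also have "\<dots> = (\<Sum>f \<in> {f. length f = ?r \<and> set f = {..<k}}. delta ^ (?r - k) * prod_list (map G Ks))"
      using weight_union[OF _ _ Ks] by (intro sum.cong) auto
    also have "\<dots> = of_nat (fact k) * (of_nat (Stirling ?r k) * (delta ^ (?r - k) * prod_list (map G Ks)))"
      by (simp add: card_lists_set_eq mult.assoc)
    finally show "surj_sum k ?S = of_nat (fact k) * (of_nat (Stirling ?r k) * (delta ^ (?r - k) * prod_list (map G Ks)))" .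
  qed
  obtain n where n: "?r = Suc n" using Ks by (cases Ks) auto
  have "state_sum ?S = (\<Sum>k \<le> ?r. (z * wi * delta) ^ (?r - k) * coeff k * of_nat (Stirling ?r k)) * prod_list (map G Ks)"
    unfolding state_sum_def nc ps sum_distrib_right
    by (rule sum.cong) (simp_all add: power_mult_distrib ac_simps)
  also have "\<dots> = (delta * Ei) ^ n * prod_list (map G Ks)"
    using Stirling_expansion[where n = n and x = "z * wi * delta" and y = "delta * Ei"] unfolding coeff_def n by simp
  also have "\<dots> = Ei ^ (?r - 1) * g ?S"
    unfolding g_concat[OF unknot Ks] n by (simp add: power_mult_distrib ac_simps)
  finally show ?thesis .
qed

section \<open>The state sum satisfies both rules\<close>

definition state_sum_link :: "link_diagram \<Rightarrow> 'r" where
  "state_sum_link L = state_sum (slices L)"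

lemma state_sum_link_invariant: "regular_isotopy_invariant state_sum_link"
  unfolding regular_isotopy_invariant_def regular_isotopic_def
proof (intro allI impI)
  fix L L' assume "equivclp (local_move (sup planar_move (sup reidemeister2 reidemeister3))) L L'"
  then show "state_sum_link L = state_sum_link L'"
  proof (induction rule: equivclp_induct)
    case (step L' L'')
    have "state_sum_link K = state_sum_link K'"
      if lm: "local_move (sup planar_move (sup reidemeister2 reidemeister3)) K K'" for K K'
    proof -
      from lm obtain us l r vs where *: "reg_move l r" "slices K = us @ l @ vs" "slices K' = us @ r @ vs"
        unfolding local_move_def reg_move_def by blast
      have "closed (slices K)" "closed (slices K')"
        using is_link_diagram_slices is_link_diagram_iff by blast+
      then show ?thesis unfolding state_sum_link_def * by (intro state_sum_reg_move *(1))
    qed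
    with step show ?case by metis
  qed simp
qed

lemma state_sum_link_skein:
  assumes "conway_quadruple k Lp Lm L0 Linf" "mixed_crossing Lp k"
  shows "state_sum_link Lp - state_sum_link Lm = z * (state_sum_link L0 - state_sum_link Linf)"
proof -
  from assms(1) obtain us i vs where us: "length us = k" "slices Lp = us @ (Cross Pos, i) # vs"
    "slices Lm = us @ (Cross Neg, i) # vs" "slices L0 = us @ (Cap, i) # (Cup, i) # vs" "slices Linf = us @ vs"
    unfolding conway_quadruple_def by auto
  from assms(2) obtain c j tr where tr: "slices Lp ! k = (Cross c, j)" "path (slices Lp) [] tr"
    "([] # tr) ! k ! j" "\<not> ([] # tr) ! k ! Suc j" by (rule mixed_crossing_colouring)
  have "closed (us @ (Cross Pos, i) # vs)"
    using is_link_diagram_slices[of Lp] is_link_diagram_iff us(2) by metis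
  moreover have "\<not> same_at (length us) i tr" using tr us(1,2) by (auto simp: same_at_def)
  moreover have "path (us @ (Cross Pos, i) # vs) [] tr" using tr(2) us(2) by simp
  ultimately show ?thesis
    unfolding state_sum_link_def us(2-) by (intro state_sum_skein[where psi = tr])
qed

text \<open>Under every move, the first one included, both sides change by the same factor. That
  this factor is a unit is used for the moves that are performed backwards in an isotopy.\<close>

lemma state_sum_link_unlinked:
  assumes "unlinked_knots r K" "1 \<le> r"
  shows "state_sum_link K = Ei ^ (r - 1) * G K"
proof -
  let ?R = "local_move (sup planar_move (sup reidemeister1 (sup reidemeister2 reidemeister3)))"
  from assms obtain Ks S where S: "length Ks = r" "\<forall>K \<in> set Ks. is_knot_diagram K"
    "slices S = concat (map slices Ks)" "isotopic K S" unfolding unlinked_knots_def by blast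
  have move: "\<exists>f f'. f' * f = 1 \<and> state_sum_link L = f * state_sum_link L' \<and> G L = f * G L'"
    if "?R L L'" for L L'
  proof -
    from that obtain us l r vs where *: "reg_move l r \<or> reidemeister1 l r" "slices L = us @ l @ vs" "slices L' = us @ r @ vs"
      unfolding local_move_def reg_move_def by auto
    have cl: "closed (us @ l @ vs)" "closed (us @ r @ vs)"
      using is_link_diagram_slices[of L] is_link_diagram_slices[of L'] is_link_diagram_iff * by metis+
    have G: "G L = g (us @ l @ vs)" "G L' = g (us @ r @ vs)" unfolding *(2,3)[symmetric] by simp_all
    from *(1) show ?thesis
    proof
      assume m: "reg_move l r"
      have "G L = G L'" unfolding G using teq_move[OF m, of 0 us vs] cl by (intro g_teq) blast
      moreover have "state_sum_link L = state_sum_link L'"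
        unfolding state_sum_link_def * using m cl by (rule state_sum_reg_move)
      ultimately show ?thesis by (intro exI[of _ 1]) simp
    next
      assume "reidemeister1 l r"
      then obtain c where c: "curl c l" "r = []" by cases
      have "framing (switch c) * framing c = 1" using a_ai by (cases c) (simp_all add: mult.commute)
      moreover have "G L = framing c * G L'" using g_curl[OF c(1) cl(1)] G c(2) by simp
      moreover have "state_sum_link L = framing c * state_sum_link L'"
        using state_sum_curl[OF c(1) cl(1)] * c(2) by (simp add: state_sum_link_def)
      ultimately show ?thesis by blast
    qed
  qed
  have "Ks \<noteq> []" using S(1) assms(2) by auto
  from state_sum_union[OF S(2) this] have start: "state_sum_link S = Ei ^ (r - 1) * G S"
    using S(1) S(3)[symmetric] by (simp add: state_sum_link_def)
  have "equivclp ?R S K" using S(4) unfolding isotopic_def by (rule equivclp_sym)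
  then show ?thesis
  proof (induction rule: equivclp_induct)
    case base
    show ?case by (rule start)
  next
    case (step L L')
    have IH: "state_sum_link L = Ei ^ (r - 1) * G L" using step by blast
    from step(2) show ?case
    proof
      assume "?R L L'"
      then obtain f f' where f: "f' * f = 1" "state_sum_link L = f * state_sum_link L'" "G L = f * G L'"
        using move by blast
      have "f' * (f * state_sum_link L') = f' * (f * (Ei ^ (r - 1) * G L'))"
        using IH f by (simp add: ac_simps)
      then show ?thesis unfolding mult.assoc[symmetric] f(1) by simp
    next
      assume "?R L' L"
      then obtain f f' where "state_sum_link L' = f * state_sum_link L" "G L' = f * G L"
        using move by blast
      with IH show ?thesis by (simp add: ac_simps)
    qed
  qed
qed

end

section \<open>Uniqueness\<close>

text \<open>Moves the strands of colour \<open>True\<close> to the right, on top of those of colour \<open>False\<close>.\<close>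

fun unshuffle :: "nat \<Rightarrow> bool list \<Rightarrow> slice list" where
  "unshuffle k [] = []"
| "unshuffle k (b # st) = unshuffle (Suc k) st @ (if b then over_right k (k + cnt Not st) else [])"

lemma cnt_le: "cnt P st \<le> length st"
  by (rule length_filter_le)

declare length_filter_le [simp del]

lemma fits_unshuffle:
  "k + length st \<le> n \<Longrightarrow> fits n (unshuffle k st) \<and> outw n (unshuffle k st) = n"
proof (induction st arbitrary: k)
  case (Cons b st)
  then show ?case using cnt_le[of Not st] by simp
qed simp

lemma shift_unshuffle: "shift d (unshuffle k st) = unshuffle (k + d) st"
  by (induction st arbitrary: k) (simp_all add: ac_simps)

lemma commute_unshuffle:
  assumes "k + ins t + length st \<le> n"
  shows "teq n ((t, k) # unshuffle (k + outs t) st) (unshuffle (k + ins t) st @ [(t, k)])"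
  using teq_commute_right[of "length st" "unshuffle 0 st" k t n] fits_unshuffle[of 0 st "length st"] assms
  by (simp add: shift_unshuffle ac_simps)

text \<open>The same for none (\<open>j = 0\<close>) or two adjacent over-strands passing \<open>m\<close> strands.\<close>

definition over_block :: "nat \<Rightarrow> nat \<Rightarrow> nat \<Rightarrow> slice list" where
  "over_block j k m = (if j = 0 then [] else over_right (Suc k) (Suc k + m) @ over_right k (k + m))"

lemma fits_over_block: "k + j + m \<le> n \<Longrightarrow> j = 0 \<or> j = 2 \<Longrightarrow>
    fits n (over_block j k m) \<and> outw n (over_block j k m) = n"
  by (auto simp: over_block_def)

text \<open>Instead of one strand passing all others before the second one starts, both pass the
  first of the others and then go on together. The crossings that exchange heights are far
  apart.\<close>

lemma over_block_Suc:
  assumes "k + j + Suc m \<le> n" "j = 0 \<or> j = 2"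
  shows "teq n (over_block j k (Suc m)) (over_block j k 1 @ over_block j (Suc k) m)"
proof (cases "j = 0")
  case False
  with assms have n: "k + Suc m + 2 \<le> n" by auto
  have "over_block j k (Suc m) = [(Cross Neg, Suc k)] @ (over_right (k + 2) (k + 2 + m) @ [(Cross Neg, k)]) @
      over_right (Suc k) (Suc k + m)"
    using False over_right_split[of "Suc k" "Suc (Suc k)" "Suc k + Suc m"] over_right_split[of k "Suc k" "k + Suc m"]
    by (simp add: over_block_def)
  also have "teq n \<dots> ([(Cross Neg, Suc k)] @ ((Cross Neg, k) # over_right (k + 2) (k + 2 + m)) @
      over_right (Suc k) (Suc k + m))"
  proof (intro teq_ctx)
    show "teq (outw n [(Cross Neg, Suc k)]) (over_right (k + 2) (k + 2 + m) @ [(Cross Neg, k)])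
        ((Cross Neg, k) # over_right (k + 2) (k + 2 + m))"
      using teq_sym[OF teq_commute_right[of "Suc m" "over_right 0 m" k "Cross Neg" n]] n by (simp add: ac_simps)
  qed (use n in simp)
  also have "\<dots> = over_block j k 1 @ over_block j (Suc k) m"
    using False by (simp add: over_block_def)
  finally show ?thesis .
qed (simp add: over_block_def)

text \<open>A piece formed by the upper strands moves past a strand below them. If it is a crossing,
  the third move applies whatever its type is, as the strand below meets both upper strands in
  crossings \<open>Neg\<close>.\<close>

lemma over_block_slide1:
  assumes "k + Suc (ins t) \<le> n"
  shows "teq n ((t, k) # over_block (outs t) k 1) (over_block (ins t) k 1 @ [(t, Suc k)])"
proof (cases t)
  case Cup
  have "teq n ([] @ [(Cup, k), (Cross Neg, Suc k)] @ [(Cross Neg, k)])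
      ([] @ [(Cup, Suc k), (Cross Pos, k)] @ [(Cross Neg, k)])"
    using teq_turn_cup[of k n Neg] assms Cup by (intro teq_ctx) auto
  also have "teq n \<dots> ([(Cup, Suc k)] @ [(Cross Pos, k), (Cross Neg, k)] @ [])" by simp
  also have "teq n \<dots> ([(Cup, Suc k)] @ [] @ [])"
    using teq_r2[of k "n + 2" Pos] assms Cup by (intro teq_ctx) auto
  finally show ?thesis using Cup by (simp add: over_block_def)
next
  case Cap
  have "teq n ([(Cross Neg, Suc k)] @ [(Cross Neg, k), (Cap, Suc k)] @ [])
      ([(Cross Neg, Suc k)] @ [(Cross Pos, Suc k), (Cap, k)] @ [])"
    using teq_turn_cap[of k n Pos] assms Cap by (intro teq_ctx) (auto intro: teq_sym)
  also have "teq n \<dots> ([] @ [(Cross Neg, Suc k), (Cross Pos, Suc k)] @ [(Cap, k)])" by simp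
  also have "teq n \<dots> ([] @ [] @ [(Cap, k)])"
    using teq_r2[of "Suc k" n Neg] assms Cap by (intro teq_ctx) auto
  finally show ?thesis using Cap by (auto simp: over_block_def intro: teq_sym)
next
  case (Cross c)
  then show ?thesis using teq_r3[of Neg c Neg k n] assms by (simp add: over_block_def)
qed

lemma over_block_slide:
  assumes "k + m + ins t \<le> n"
  shows "teq n ((t, k) # over_block (outs t) k m) (over_block (ins t) k m @ [(t, k + m)])"
  using assms
proof (induction m arbitrary: k)
  case 0
  then show ?case by (simp add: over_block_def)
next
  case (Suc m)
  obtain M where n: "n = M + ins t" and M: "k + Suc m \<le> M"
    using Suc.prems le_Suc_ex[of "k + Suc m + ins t" n] by (auto simp: ac_simps)
  define n' where "n' = M + outs t"
  have j: "ins t = 0 \<or> ins t = 2" "outs t = 0 \<or> outs t = 2" by (cases t; simp)+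
  have fo: "fits n' (over_block (outs t) k (Suc m))" "fits n' (over_block (outs t) k 1)"
      "outw n' (over_block (outs t) k 1) = n'" "fits n' (over_block (outs t) (Suc k) m)"
    using fits_over_block[of k "outs t" "Suc m" n'] fits_over_block[of k "outs t" 1 n']
      fits_over_block[of "Suc k" "outs t" m n'] j M by (simp_all add: n'_def)
  have fi: "fits n (over_block (ins t) k 1)" "outw n (over_block (ins t) k 1) = n"
      "fits n (over_block (ins t) (Suc k) m)" "outw n (over_block (ins t) (Suc k) m) = n"
    using fits_over_block[of k "ins t" 1 n] fits_over_block[of "Suc k" "ins t" m n] j M by (simp_all add: n)
  have "teq n ((t, k) # over_block (outs t) k (Suc m))
      ((t, k) # over_block (outs t) k 1 @ over_block (outs t) (Suc k) m)"
  proof (rule teq_Cons)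
    have "n - ins t + outs t = n'" by (simp add: n n'_def)
    then show "teq (n - ins t + outs t) (over_block (outs t) k (Suc m))
        (over_block (outs t) k 1 @ over_block (outs t) (Suc k) m)"
      using over_block_Suc[of k "outs t" m n'] j(2) M by (simp only:) (simp add: n'_def)
  qed (use n M in simp)
  also have "\<dots> = ([] @ ((t, k) # over_block (outs t) k 1) @ over_block (outs t) (Suc k) m)" by simp
  also have "teq n \<dots> ([] @ (over_block (ins t) k 1 @ [(t, Suc k)]) @ over_block (outs t) (Suc k) m)"
    using over_block_slide1[of k t n] fo n M unfolding n'_def by (intro teq_ctx) (auto simp: fits_Cons_add outw_Cons_add)
  also have "\<dots> = (over_block (ins t) k 1 @ ((t, Suc k) # over_block (outs t) (Suc k) m))" by simp
  also have "teq n \<dots> (over_block (ins t) k 1 @ (over_block (ins t) (Suc k) m @ [(t, Suc k + m)]))"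
    using Suc.IH[of "Suc k"] Suc.prems fi by (intro teq_prepend) auto
  also have "\<dots> = ((over_block (ins t) k 1 @ over_block (ins t) (Suc k) m) @ [(t, k + Suc m)])" by simp
  also have "teq n \<dots> (over_block (ins t) k (Suc m) @ [(t, k + Suc m)])"
    using over_block_Suc[of k "ins t" m n] j Suc.prems fi n
    by (intro teq_append) (auto simp: fits_Cons_add intro: teq_sym)
  finally show ?case .
qed

text \<open>What is left of a piece once the strands are sorted: it sits among the strands of its
  own colour, those of colour \<open>False\<close> coming first, and a crossing between the colours
  is used up by the sorting.\<close>

definition split_slice :: "nat \<Rightarrow> piece \<Rightarrow> bool list \<Rightarrow> bool list \<Rightarrow> bool list \<Rightarrow> bool list \<Rightarrow> slice list" where
  "split_slice k t x u u' y =
     (if \<forall>b \<in> set u \<union> set u'. \<not> b then [(t, k + cnt Not x)]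
      else if \<forall>b \<in> set u \<union> set u'. b then [(t, k + cnt Not (x @ u @ y) + cnt id x)] else [])"

lemma core_bool_cases:
  assumes "core t u u'"
  obtains "u = replicate (ins t) False" "u' = replicate (outs t) False"
  | "u = replicate (ins t) True" "u' = replicate (outs t) True"
  | b p where "t = Cross p" "u = [b, \<not> b]" "u' = [\<not> b, b]"
proof (cases t)
  case Cup
  then obtain c where "u = []" "u' = [c, c]" using assms by auto
  then show ?thesis using that(1,2) Cup by (cases c) (auto simp: numeral_2_eq_2)
next
  case Cap
  then obtain c where "u' = []" "u = [c, c]" using assms by auto
  then show ?thesis using that(1,2) Cap by (cases c) (auto simp: numeral_2_eq_2)
next
  case (Cross p)
  then obtain c d where "u = [c, d]" "u' = [d, c]" using assms by auto
  then show ?thesis using that Cross by (cases c; cases d) (auto simp: numeral_2_eq_2)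
qed

lemma split_slice_True:
  assumes "u = replicate (ins t) True" "u' = replicate (outs t) True"
  shows "split_slice k t x u u' y = [(t, k + cnt Not (x @ u @ y) + cnt id x)]"
proof -
  have "ins t \<noteq> 0 \<or> outs t \<noteq> 0" by (cases t) auto
  then have "True \<in> set u \<union> set u'" using assms by auto
  then have 1: "\<not> (\<forall>b \<in> set u \<union> set u'. \<not> b)" by (metis (full_types))
  have 2: "\<forall>b \<in> set u \<union> set u'. b" by (simp add: assms ball_Un set_replicate_conv_if)
  show ?thesis unfolding split_slice_def if_not_P[OF 1] if_P[OF 2] ..
qed

lemma split_slice_False:
  assumes "u = replicate (ins t) False" "u' = replicate (outs t) False"
  shows "split_slice k t x u u' y = [(t, k + cnt Not x)]"
proof -
  have 1: "\<forall>b \<in> set u \<union> set u'. \<not> b" by (simp add: assms ball_Un set_replicate_conv_if)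
  show ?thesis unfolding split_slice_def if_P[OF 1] ..
qed

lemma split_slice_mixed: "split_slice k t x [b, \<not> b] [\<not> b, b] y = []"
  by (cases b) (simp_all add: split_slice_def)

lemma unshuffle_False: "unshuffle k (replicate j False @ y) = unshuffle (k + j) y"
  by (induction j arbitrary: k) simp_all

lemma unshuffle_True:
  "j = 0 \<or> j = 2 \<Longrightarrow> unshuffle k (replicate j True @ y) = unshuffle (k + j) y @ over_block j k (cnt Not y)"
  by (auto simp: numeral_2_eq_2 over_block_def)

lemma ins_outs_cases: "ins t = 0 \<or> ins t = 2" "outs t = 0 \<or> outs t = 2"
  by (cases t; simp)+

text \<open>The condition \<open>over\<close> says that the strand of colour \<open>True\<close> is
  on top wherever it crosses one of colour \<open>False\<close>: at \<open>Neg\<close> the strand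
  from the lower left is on top. The piece at the left margin is the base case of
  \<open>unshuffle_step\<close>.\<close>

lemma unshuffle_step_Nil:
  assumes core: "core t u u'" and over: "\<And>p b. t = Cross p \<Longrightarrow> u = [b, \<not> b] \<Longrightarrow> p = Neg \<longleftrightarrow> b"
    and n: "k + length (u @ y) \<le> n"
  shows "teq n ((t, k) # unshuffle k (u' @ y)) (unshuffle k (u @ y) @ split_slice k t [] u u' y)"
proof -
  have len: "length u = ins t" "length u' = outs t" using core_length[OF core] by auto
  have ct: "teq n ((t, k) # unshuffle (k + outs t) y) (unshuffle (k + ins t) y @ [(t, k)])"
    using commute_unshuffle[of k t y n] n len by simp
  obtain M where e: "n = M + ins t" and M: "k + length y \<le> M"
    using n len le_Suc_ex[of "k + (ins t + length y)" n] by (auto simp: ac_simps)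
  have fu: "fits n (unshuffle (k + ins t) y)" "outw n (unshuffle (k + ins t) y) = n"
    "fits (M + outs t) (unshuffle (k + outs t) y)"
    "outw (M + outs t) (unshuffle (k + outs t) y) = M + outs t"
    using fits_unshuffle[of "k + ins t" y n] fits_unshuffle[of "k + outs t" y "M + outs t"] n len M
    by simp_all
  have m: "cnt Not y \<le> length y" by (rule cnt_le)
  from core show ?thesis
  proof (cases rule: core_bool_cases)
    case 1
    show ?thesis unfolding split_slice_False[OF 1] unfolding 1 unshuffle_False using ct by simp
  next
    case 2
    have "teq n ((t, k) # unshuffle k (u' @ y))
        ([] @ ((t, k) # unshuffle (k + outs t) y) @ over_block (outs t) k (cnt Not y))"
      using 2 ins_outs_cases(2) by (simp add: unshuffle_True)
    also have "teq n \<dots> ([] @ (unshuffle (k + ins t) y @ [(t, k)]) @ over_block (outs t) k (cnt Not y))"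
    proof (intro teq_ctx)
      show "fits n ([] @ ((t, k) # unshuffle (k + outs t) y) @ over_block (outs t) k (cnt Not y))"
        using fu fits_over_block[of k "outs t" "cnt Not y" "M + outs t"] ins_outs_cases(2) m M
        by (simp add: e fits_Cons_add outw_Cons_add)
    qed (use ct in simp)
    also have "\<dots> = unshuffle (k + ins t) y @ ((t, k) # over_block (outs t) k (cnt Not y))" by simp
    also have "teq n \<dots> (unshuffle (k + ins t) y @ (over_block (ins t) k (cnt Not y) @ [(t, k + cnt Not y)]))"
      using over_block_slide[of k "cnt Not y" t n] fu m M e by (intro teq_prepend) auto
    also have "\<dots> = unshuffle k (u @ y) @ split_slice k t [] u u' y"
      unfolding split_slice_True[OF 2] unfolding 2(1) using ins_outs_cases(1)
      by (simp add: unshuffle_True filter_replicate)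
    finally show ?thesis .
  next
    case (3 b p)
    then have p: "p = Neg \<longleftrightarrow> b" using over by blast
    have n2: "Suc (k + cnt Not y) < n" using e m M 3 by simp
    let ?m = "cnt Not y"
    have sp: "split_slice k t [] u u' y = []" unfolding 3 by (rule split_slice_mixed)
    have ct': "teq n ((Cross p, k) # unshuffle (k + 2) y) (unshuffle (k + 2) y @ [(Cross p, k)])"
      using ct 3 by simp
    show ?thesis
    proof (cases b)
      \<comment> \<open>The crossing is already the first step of a passage to the right and becomes
        part of it.\<close>
      case True
      then have "teq n ((t, k) # unshuffle k (u' @ y))
          (((Cross p, k) # unshuffle (k + 2) y) @ over_right (Suc k) (Suc k + ?m))"
        using 3 by simp
      also have "teq n \<dots> ((unshuffle (k + 2) y @ [(Cross p, k)]) @ over_right (Suc k) (Suc k + ?m))"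
        using ct' fu n2 3 by (intro teq_append) auto
      also have "\<dots> = unshuffle k (u @ y) @ split_slice k t [] u u' y"
        using over_right_split[of k "Suc k" "Suc k + ?m"] 3 True p sp by simp
      finally show ?thesis .
    next
      \<comment> \<open>The upper strand would cross the same strand to the left and then back to
        the right; the second move cancels both crossings.\<close>
      case False
      then have "teq n ((t, k) # unshuffle k (u' @ y))
          (((Cross p, k) # unshuffle (k + 2) y) @ over_right k (Suc k + ?m))"
        using 3 by simp
      also have "teq n \<dots> ((unshuffle (k + 2) y @ [(Cross p, k)]) @ over_right k (Suc k + ?m))"
        using ct' fu n2 3 by (intro teq_append) auto
      also have "\<dots> = unshuffle (k + 2) y @ [(Cross Pos, k), (Cross Neg, k)] @ over_right (Suc k) (Suc k + ?m)"
        using over_right_split[of k "Suc k" "Suc k + ?m"] False p by (cases p) simp_all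
      also have "teq n \<dots> (unshuffle (k + 2) y @ [] @ over_right (Suc k) (Suc k + ?m))"
        using teq_r2[of k n Pos] fu n2 3 by (intro teq_ctx) auto
      also have "\<dots> = unshuffle k (u @ y) @ split_slice k t [] u u' y" using 3 False sp by simp
      finally show ?thesis .
    qed
  qed
qed

text \<open>Induction over the strands to the left of the piece. The passage of a strand of colour
  \<open>True\<close> is drawn across a piece of colour \<open>False\<close> by
  \<open>over_right_slide\<close>, while a piece of colour \<open>True\<close> ends up to the right
  of the whole passage and commutes with it.\<close>

lemma unshuffle_step:
  assumes core: "core t u u'" and over: "\<And>p b. t = Cross p \<Longrightarrow> u = [b, \<not> b] \<Longrightarrow> p = Neg \<longleftrightarrow> b"
    and n: "k + length (x @ u @ y) \<le> n"
  shows "teq n ((t, k + length x) # unshuffle k (x @ u' @ y))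
    (unshuffle k (x @ u @ y) @ split_slice k t x u u' y)"
  using n
proof (induction x arbitrary: k)
  case Nil
  then show ?case using unshuffle_step_Nil[OF core over, of k y n] by simp
next
  case (Cons b x)
  let ?N = "cnt Not (x @ u @ y)" and ?N' = "cnt Not (x @ u' @ y)"
  let ?R = "if b then over_right k (k + ?N) else []" and ?R' = "if b then over_right k (k + ?N') else []"
  have len: "length u = ins t" "length u' = outs t" using core_length[OF core] by auto
  have le: "?N \<le> length (x @ u @ y)" "?N' \<le> length (x @ u' @ y)" "cnt id x \<le> length x" by (rule cnt_le)+
  have N_id: "cnt Not z + cnt id z = length z" for z :: "bool list" by (induction z) auto
  obtain M where e: "n = M + ins t" and M: "Suc k + length x + length y \<le> M"
    using Cons.prems len le_Suc_ex[of "k + length ((b # x) @ u @ y)" n] by (auto simp: ac_simps)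
  have fu: "fits n (unshuffle (Suc k) (x @ u @ y))" "outw n (unshuffle (Suc k) (x @ u @ y)) = n"
    "fits (M + outs t) (unshuffle (Suc k) (x @ u' @ y))"
    "outw (M + outs t) (unshuffle (Suc k) (x @ u' @ y)) = M + outs t"
    using fits_unshuffle[of "Suc k" "x @ u @ y" n]
      fits_unshuffle[of "Suc k" "x @ u' @ y" "M + outs t"] e len M by simp_all
  have last: "teq n (split_slice (Suc k) t x u u' y @ ?R') (?R @ split_slice k t (b # x) u u' y)"
  proof (cases b)
    case False
    have "split_slice (Suc k) t x u u' y = split_slice k t (False # x) u u' y"
      unfolding split_slice_def by (intro if_cong) simp_all
    then show ?thesis using False by simp
  next
    case b: True
    from core show ?thesis
    proof (cases rule: core_bool_cases)
      case 1
      let ?q = "k + cnt Not x + cnt Not y"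
      have "?N = cnt Not x + cnt Not y + ins t" "?N' = cnt Not x + cnt Not y + outs t"
        using 1 by simp_all
      moreover have "teq n ((t, Suc (k + cnt Not x)) # over_right k (?q + outs t))
          (over_right k (?q + ins t) @ [(t, k + cnt Not x)])"
        using e M cnt_le[of Not x] cnt_le[of Not y] by (intro over_right_slide) auto
      ultimately show ?thesis using b unfolding split_slice_False[OF 1] by (simp add: ac_simps)
    next
      case 2
      have N: "?N = cnt Not x + cnt Not y" "?N' = ?N" using 2 by simp_all
      have "Suc (k + ?N) + cnt id x + ins t \<le> n" using e M N N_id[of x] cnt_le[of Not y] by simp
      from teq_commute_left[OF _ this, of "over_right k (k + ?N)"]
      have "teq n ((t, Suc (k + ?N) + cnt id x) # over_right k (k + ?N))
          (over_right k (k + ?N) @ [(t, Suc (k + ?N) + cnt id x)])" by simp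
      with N(1) b show ?thesis unfolding split_slice_True[OF 2] N(2) by (simp add: ac_simps)
    next
      case (3 c p)
      then have "?N' = ?N" by simp
      moreover have "split_slice j t z u u' y = []" for j z unfolding 3 by (rule split_slice_mixed)
      ultimately show ?thesis by simp
    qed
  qed
  have fR': "fits (M + outs t) ?R'"
    using le len M by simp
  have "teq n ((t, k + length (b # x)) # unshuffle k ((b # x) @ u' @ y))
      (((t, Suc k + length x) # unshuffle (Suc k) (x @ u' @ y)) @ ?R')" by simp
  also have "teq n \<dots> ((unshuffle (Suc k) (x @ u @ y) @ split_slice (Suc k) t x u u' y) @ ?R')"
  proof (intro teq_append Cons.IH)
    show "fits (outw n ((t, Suc k + length x) # unshuffle (Suc k) (x @ u' @ y))) ?R'"
      using fR' fu(4) unfolding e outw_Cons_add by simp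
  qed (use Cons.prems in simp)
  also have "\<dots> = unshuffle (Suc k) (x @ u @ y) @ (split_slice (Suc k) t x u u' y @ ?R')" by simp
  also have "teq n \<dots> (unshuffle (Suc k) (x @ u @ y) @ (?R @ split_slice k t (b # x) u u' y))"
    using last fu(1,2) by (intro teq_prepend) auto
  also have "\<dots> = unshuffle k ((b # x) @ u @ y) @ split_slice k t (b # x) u u' y" by simp
  finally show ?case .
qed

text \<open>The number of crossings between the two colours at which \<open>False\<close> is on top.\<close>

fun bad_slice :: "slice \<Rightarrow> bool list \<Rightarrow> nat" where
  "bad_slice (Cross p, i) st = of_bool (st ! i \<noteq> st ! Suc i \<and> (p = Neg) \<noteq> st ! i)"
| "bad_slice _ st = 0"

fun bad :: "slice list \<Rightarrow> bool list \<Rightarrow> bool list list \<Rightarrow> nat" where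
  "bad (a # ss) st (st' # tr) = bad_slice a st + bad ss st' tr"
| "bad _ _ _ = 0"

text \<open>The sorting is pushed downwards through one slice after the other. A closed diagram has
  nothing to sort at either end, so there the claim says that it is regularly isotopic to its two
  one-coloured sublinks stacked on each other.\<close>

lemma teq_split:
  "path ss st tr \<Longrightarrow> bad ss st tr = 0 \<Longrightarrow>
    teq (length st) (ss @ unshuffle 0 (last (st # tr)))
      (unshuffle 0 st @ sub Not ss st tr @ shift (cnt Not (last (st # tr))) (sub id ss st tr))"
proof (induction ss arbitrary: st tr)
  case (Cons a ss)
  obtain t i where a: "a = (t, i)" by force
  with Cons.prems obtain st' tr' where *: "tr = st' # tr'" "cstep (t, i) st st'" "path ss st' tr'" by auto
  from *(2) obtain x u u' y where c: "i = length x" "st = x @ u @ y" "st' = x @ u' @ y" "core t u u'"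
    by (rule cstepE)
  let ?l = "last (st' # tr')" and ?F = "sub Not ss st' tr'" and ?T = "sub id ss st' tr'"
  let ?S = "shift (cnt Not ?l) ?T"
  have bad: "bad_slice a st = 0" "bad ss st' tr' = 0" using Cons.prems(2) * by simp_all
  have over: "p = Neg \<longleftrightarrow> b" if "t = Cross p" "u = [b, \<not> b]" for p b
    using bad(1) a c that by (auto simp: of_bool_def nth_append split: if_splits)
  have step: "teq (length st) ((t, i) # unshuffle 0 st') (unshuffle 0 st @ split_slice 0 t x u u' y)"
    using unshuffle_step[OF c(4) over, of 0 x y "length st"] c by simp
  have len: "length u = ins t" "length u' = outs t" using core_length[OF c(4)] by auto
  have n: "length st = (length x + length y) + ins t" "length st' = (length x + length y) + outs t"
    using c len by simp_all
  have subN: "subslice Not (t, i) st st' = (if \<forall>b \<in> set u \<union> set u'. \<not> b then [(t, cnt Not x)] else [])"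
    and subT: "subslice id (t, i) st st' = (if \<forall>b \<in> set u \<union> set u'. id b then [(t, cnt id x)] else [])"
    unfolding c(1-3) by (rule subslice_local[OF c(4)])+
  have fF: "fits (cnt Not st') ?F" "outw (cnt Not st') ?F = cnt Not ?l"
    and fT: "fits (cnt id st') ?T" "outw (cnt id st') ?T = cnt id ?l"
    using sub_fits[OF *(3), of Not] sub_fits[OF *(3), of id] by blast+
  have cnt_id: "cnt Not z + cnt id z = length z" for z :: "bool list" by (induction z) auto
  have fF': "fits (length st') ?F" "outw (length st') ?F = cnt Not ?l + cnt id st'"
    using fits_more[OF fF(1), of "cnt id st'"] fF(2) cnt_id[of st'] by simp_all
  have fS': "fits (cnt Not ?l + cnt id st') ?S" using fits_shift[OF fT(1), of "cnt Not ?l"] by simp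
  have fFS: "fits (length st') (?F @ ?S)" using fF' fS' by simp
  have fu: "fits (length z) (unshuffle 0 z)" "outw (length z) (unshuffle 0 z) = length z" for z
    using fits_unshuffle[of 0 z "length z"] by simp_all
  have IH: "teq (length st') (ss @ unshuffle 0 ?l) (unshuffle 0 st' @ ?F @ ?S)"
    using Cons.IH[OF *(3) bad(2)] .
  have "teq (length st) ((t, i) # ss @ unshuffle 0 ?l) ((t, i) # unshuffle 0 st' @ ?F @ ?S)"
  proof (rule teq_Cons)
    have "length st - ins t + outs t = length st'" using n by simp
    then show "teq (length st - ins t + outs t) (ss @ unshuffle 0 ?l) (unshuffle 0 st' @ ?F @ ?S)"
      using IH by (simp only:)
  qed (use c len in simp)
  also have "\<dots> = ((t, i) # unshuffle 0 st') @ (?F @ ?S)" by simp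
  also have "teq (length st) \<dots> ((unshuffle 0 st @ split_slice 0 t x u u' y) @ (?F @ ?S))"
  proof (rule teq_append[OF step])
    have "outw (length st) ((t, i) # unshuffle 0 st') = length st'"
      unfolding n(1) outw_Cons_add using fu(2)[of st'] n(2) by simp
    then show "fits (outw (length st) ((t, i) # unshuffle 0 st')) (?F @ ?S)" using fFS by simp
  qed
  also have "\<dots> = unshuffle 0 st @ (split_slice 0 t x u u' y @ ?F @ ?S)" by simp
  also have "teq (length st) \<dots> (unshuffle 0 st @ (subslice Not (t, i) st st' @ ?F @
      shift (cnt Not ?l) (subslice id (t, i) st st' @ ?T)))"
  proof (rule teq_prepend)
    have "teq (length st) (split_slice 0 t x u u' y @ ?F @ ?S)
        (subslice Not (t, i) st st' @ ?F @ shift (cnt Not ?l) (subslice id (t, i) st st' @ ?T))"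
      using c(4)
    proof (cases rule: core_bool_cases)
      case 1
      have T: "subslice id (t, i) st st' = []"
      proof -
        have "ins t \<noteq> 0 \<or> outs t \<noteq> 0" by (cases t) auto
        then have "False \<in> set u \<union> set u'" using 1 by auto
        then have "\<not> (\<forall>b \<in> set u \<union> set u'. id b)" by (metis id_apply)
        then show ?thesis unfolding subT by (rule if_not_P)
      qed
      have N: "\<forall>b \<in> set u \<union> set u'. \<not> b" by (simp add: 1 ball_Un set_replicate_conv_if)
      have "subslice Not (t, i) st st' = [(t, cnt Not x)]" unfolding subN using N by (rule if_P)
      then show ?thesis unfolding T split_slice_False[OF 1] by simp
    next
      case 2
      have N: "subslice Not (t, i) st st' = []"
      proof -
        have "ins t \<noteq> 0 \<or> outs t \<noteq> 0" by (cases t) auto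
        then have "True \<in> set u \<union> set u'" using 2 by auto
        then have "\<not> (\<forall>b \<in> set u \<union> set u'. \<not> b)" by (metis (full_types))
        then show ?thesis unfolding subN by (rule if_not_P)
      qed
      have T: "\<forall>b \<in> set u \<union> set u'. id b" by (simp add: 2 ball_Un set_replicate_conv_if)
      have S: "subslice id (t, i) st st' = [(t, cnt id x)]" unfolding subT using T by (rule if_P)
      have cN: "cnt Not st = cnt Not x + cnt Not y" "cnt Not st' = cnt Not x + cnt Not y"
        using c 2 by simp_all
      have "cnt Not st + cnt id x + ins t \<le> length st"
        using cN cnt_id[of x] cnt_le[of Not y] n(1) by simp
      \<comment> \<open>The piece of colour \<open>True\<close> lies to the right of the whole
        sublink of colour \<open>False\<close> and is raised past it to join its own part.\<close>
      then have ct: "teq (length st) ((t, cnt Not st' + cnt id x) # ?F) (?F @ [(t, cnt Not ?l + cnt id x)])"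
        using teq_commute_left[OF fF(1), of "cnt id x" t "length st"] fF(2) cN by simp
      have "teq (length st) (((t, cnt Not st' + cnt id x) # ?F) @ ?S) ((?F @ [(t, cnt Not ?l + cnt id x)]) @ ?S)"
      proof (rule teq_append[OF ct])
        have "outw (length st) ((t, cnt Not st' + cnt id x) # ?F) = cnt Not ?l + cnt id st'"
          unfolding n(1) outw_Cons_add using fF'(2) n(2) by simp
        then show "fits (outw (length st) ((t, cnt Not st' + cnt id x) # ?F)) ?S" using fS' by simp
      qed
      then show ?thesis unfolding N S split_slice_True[OF 2] using cN c(2) by (simp add: add.commute)
    next
      case (3 b p)
      have "subslice Not (t, i) st st' = []" "subslice id (t, i) st st' = []"
        unfolding subN subT using 3 by (cases b; simp)+
      then show ?thesis using 3 split_slice_mixed[of 0 t x b y] by simp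
    qed
    then show "teq (outw (length st) (unshuffle 0 st)) (split_slice 0 t x u u' y @ ?F @ ?S)
        (subslice Not (t, i) st st' @ ?F @ shift (cnt Not ?l) (subslice id (t, i) st st' @ ?T))"
      unfolding fu(2) .
  qed (rule fu(1))
  finally show ?case
  proof -
    have "last (st # tr) = ?l" using *(1) by simp
    moreover have "sub P (a # ss) st tr = subslice P (t, i) st st' @ sub P ss st' tr'" for P
      unfolding a *(1) by (rule sub.simps)
    moreover assume "teq (length st) ((t, i) # ss @ unshuffle 0 ?l) (unshuffle 0 st @ subslice Not (t, i) st st' @
      ?F @ shift (cnt Not ?l) (subslice id (t, i) st st' @ ?T))"
    ultimately show ?thesis by (simp only: a append_assoc append_Cons)
  qed
qed simp

section \<open>Reduction to unlinked knots\<close>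

lemma bad_crossing:
  assumes "path ss st tr" "bad ss st tr \<noteq> 0"
  obtains us p i vs t1 t2 where "ss = us @ (Cross p, i) # vs" "tr = t1 @ t2" "length t1 = length us"
    "last (st # t1) ! i \<noteq> last (st # t1) ! Suc i" "bad (us @ (Cross (switch p), i) # vs) st tr < bad ss st tr"
proof -
  from assms have "\<exists>us p i vs t1 t2. ss = us @ (Cross p, i) # vs \<and> tr = t1 @ t2 \<and> length t1 = length us \<and>
    last (st # t1) ! i \<noteq> last (st # t1) ! Suc i \<and> bad (us @ (Cross (switch p), i) # vs) st tr < bad ss st tr"
  proof (induction ss arbitrary: st tr)
    case (Cons a ss)
    then obtain st' tr' where *: "tr = st' # tr'" "path ss st' tr'" by auto
    show ?case
    proof (cases "bad ss st' tr' = 0")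
      case True
      with Cons.prems(2) * have "bad_slice a st \<noteq> 0" by simp
      then obtain p i where a: "a = (Cross p, i)" "st ! i \<noteq> st ! Suc i" "(p = Neg) \<noteq> st ! i"
        by (cases a; cases "fst a") (auto split: if_splits simp: of_bool_def)
      then have "bad ((Cross (switch p), i) # ss) st tr < bad (a # ss) st tr"
        using * True by (cases p) auto
      with a show ?thesis by (intro exI[of _ "[]"] exI[of _ p] exI[of _ i] exI[of _ ss] exI[of _ "[]"] exI[of _ tr]) auto
    next
      case False
      from Cons.IH[OF *(2) this] obtain us p i vs t1 t2 where IH: "ss = us @ (Cross p, i) # vs" "tr' = t1 @ t2"
        "length t1 = length us" "last (st' # t1) ! i \<noteq> last (st' # t1) ! Suc i"
        "bad (us @ (Cross (switch p), i) # vs) st' tr' < bad ss st' tr'" by blast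
      then show ?thesis
        using * by (intro exI[of _ "a # us"] exI[of _ p] exI[of _ i] exI[of _ vs] exI[of _ "st' # t1"] exI[of _ t2]) auto
    qed
  qed simp
  then show ?thesis using that by blast
qed

lemma sub_nonempty:
  assumes "path ss st tr" "cnt P st = 0" "c \<in> colours tr" "P c"
  shows "sub P ss st tr \<noteq> []"
  using assms
proof (induction ss arbitrary: st tr)
  case (Cons a ss)
  obtain s i where a: "a = (s, i)" by force
  with Cons.prems(1) obtain st' tr' where *: "tr = st' # tr'" "cstep (s, i) st st'" "path ss st' tr'" by auto
  from *(2) obtain x u u' y where d: "i = length x" "st = x @ u @ y" "st' = x @ u' @ y" "core s u u'"
    by (rule cstepE)
  show ?case
  proof (cases "\<forall>c \<in> set u \<union> set u'. P c")
    case True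
    then have "subslice P (s, i) st st' = [(s, cnt P x)]"
      unfolding d(1-3) subslice_local[OF d(4)] by (rule if_P)
    then show ?thesis using * a by simp
  next
    case False
    then have "cnt P u = cnt P u'" using core_cnt[OF d(4), of P] unfolding if_not_P[OF False] by simp
    then have 0: "cnt P st' = 0" using Cons.prems(2) d by simp
    then have "\<not> (c \<in> set st')" using Cons.prems(4) by (auto simp: filter_empty_conv)
    then have "c \<in> colours tr'" using Cons.prems(3) * by auto
    from Cons.IH[OF *(3) 0 this Cons.prems(4)] show ?thesis using * by simp
  qed
qed simp

definition crossings :: "slice list \<Rightarrow> nat" where
  "crossings ss = length (filter (\<lambda>(s, i). \<exists>p. s = Cross p) ss)"

lemma crossings_simps [simp]:
  "crossings [] = 0" "crossings (us @ vs) = crossings us + crossings vs"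
  "crossings ((Cross p, i) # ss) = Suc (crossings ss)"
  "crossings ((Cup, i) # ss) = crossings ss" "crossings ((Cap, i) # ss) = crossings ss"
  by (simp_all add: crossings_def)

text \<open>A slice involves at least one strand, so it survives in at most one of the two
  sublinks.\<close>

lemma crossings_sub:
  "path ss st tr \<Longrightarrow>
    crossings (sub Not ss st tr) + crossings (sub id ss st tr) \<le> crossings ss \<and>
    length (sub Not ss st tr) + length (sub id ss st tr) \<le> length ss"
proof (induction ss arbitrary: st tr)
  case (Cons a ss)
  obtain s i where a: "a = (s, i)" by force
  with Cons.prems obtain st' tr' where *: "tr = st' # tr'" "cstep (s, i) st st'" "path ss st' tr'" by auto
  from *(2) obtain x u u' y where d: "i = length x" "st = x @ u @ y" "st' = x @ u' @ y" "core s u u'"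
    by (rule cstepE)
  have "set u \<union> set u' \<noteq> {}" using d(4) by (cases s) auto
  then obtain b where b: "b \<in> set u \<union> set u'" by (metis all_not_in_conv)
  have "subslice Not (s, i) st st' = [] \<or> subslice id (s, i) st st' = []"
    unfolding d(1-3) subslice_local[OF d(4)] using b by (cases b) (auto split: if_splits)
  moreover have "crossings (subslice P (s, i) st st') \<le> crossings [a] \<and> length (subslice P (s, i) st st') \<le> 1" for P
    by (cases s) (simp_all add: a)
  ultimately have "crossings (subslice Not a st st') + crossings (subslice id a st st') \<le> crossings [a]"
    "length (subslice Not a st st') + length (subslice id a st st') \<le> 1"
    unfolding a by (metis add.right_neutral add_0 crossings_simps(1) list.size(3))+
  moreover have "crossings (a # ss) = crossings [a] + crossings ss" using crossings_simps(2)[of "[a]" ss] by simp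
  moreover have "sub P (a # ss) st tr = subslice P a st st' @ sub P ss st' tr'" for P
    unfolding *(1) by (rule sub.simps)
  moreover have "length (a # ss) = 1 + length ss" by simp
  ultimately show ?case
    using Cons.IH[OF *(3)] by (simp only: crossings_simps(2) length_append) linarith
qed simp

lemma path_switch: "path (us @ (Cross p, i) # vs) st tr \<longleftrightarrow> path (us @ (Cross q, i) # vs) st tr"
  unfolding path_append by (simp add: cstep.simps)

lemma closed_slices: "closed (slices L)" and slices_nonempty: "slices L \<noteq> []"
  using is_link_diagram_slices[of L] unfolding is_link_diagram_iff by blast+

lemma closed_concat: "closed (concat (map slices Ls))"
proof (induction Ls)
  case (Cons L Ls)
  then show ?case using closed_slices[of L] by simp
qed simp

lemma length_concat_slices: "length Ls \<le> length (concat (map slices Ls))"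
proof (induction Ls)
  case (Cons L Ls)
  moreover have "1 \<le> length (slices L)" using slices_nonempty[of L] by (simp add: Suc_le_eq)
  ultimately show ?case by simp
qed simp

lemma path_appendI:
  "path us st t1 \<Longrightarrow> last (st # t1) = s \<Longrightarrow> path vs s t2 \<Longrightarrow> path (us @ vs) st (t1 @ t2)"
  unfolding path_append by blast

text \<open>The other summands are given a constant colour. The extended colouring still separates
  the two strands, which makes the crossing mixed in the whole union.\<close>

lemma conway_mixed_stack:
  fixes t1 t2 :: "bool list list"
  assumes p: "closed p" and q: "closed q" and cl: "closed (us @ (Cross Pos, i) # vs)"
    and tr: "path (us @ (Cross Pos, i) # vs) [] (t1 @ t2)" "length t1 = length us"
      "last ([] # t1) ! i \<noteq> last ([] # t1) ! Suc i"
  shows "conway_quadruple (length (p @ us)) (Diagram (p @ (us @ (Cross Pos, i) # vs) @ q))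
      (Diagram (p @ (us @ (Cross Neg, i) # vs) @ q)) (Diagram (p @ (us @ (Cap, i) # (Cup, i) # vs) @ q))
      (Diagram (p @ (us @ vs) @ q)) \<and>
    mixed_crossing (Diagram (p @ (us @ (Cross Pos, i) # vs) @ q)) (length (p @ us))"
proof -
  have us: "us \<noteq> []" "Suc (Suc i) \<le> outw 0 us" using cl by auto
  then have "Suc (Suc (outw 0 us - 2)) = outw 0 us" by arith
  with p q cl us have ld: "is_link_diagram (p @ (us @ (Cross Pos, i) # vs) @ q)"
      "is_link_diagram (p @ (us @ (Cross Neg, i) # vs) @ q)"
      "is_link_diagram (p @ (us @ (Cap, i) # (Cup, i) # vs) @ q)" "is_link_diagram (p @ (us @ vs) @ q)"
    by (auto simp: is_link_diagram_iff)
  have "conway_quadruple (length (p @ us)) (Diagram (p @ (us @ (Cross Pos, i) # vs) @ q))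
      (Diagram (p @ (us @ (Cross Neg, i) # vs) @ q)) (Diagram (p @ (us @ (Cap, i) # (Cup, i) # vs) @ q))
      (Diagram (p @ (us @ vs) @ q))"
    unfolding conway_quadruple_def ld[THEN slices_Diagram]
    by (intro exI[of _ "p @ us"] exI[of _ i] exI[of _ "vs @ q"]) simp
  moreover have "mixed_crossing (Diagram (p @ (us @ (Cross Pos, i) # vs) @ q)) (length (p @ us))"
  proof (rule mixed_crossingI)
    let ?P = "const_col False 0 p" and ?Q = "const_col False 0 q"
    have P: "path p [] ?P" "path q [] ?Q" using path_const_col[of 0 p False] path_const_col[of 0 q False] p q by simp_all
    have lP: "last ([] # ?P) = []" using path_fits[OF P(1)] p by simp
    have lT: "last ([] # t1 @ t2) = []" using path_fits[OF tr(1)] cl by simp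
    have "path ((us @ (Cross Pos, i) # vs) @ q) [] ((t1 @ t2) @ ?Q)"
      by (rule path_appendI[OF tr(1) lT P(2)])
    then have "path (p @ (us @ (Cross Pos, i) # vs) @ q) [] (?P @ (t1 @ t2) @ ?Q)"
      by (rule path_appendI[OF P(1) lP])
    then show "path (slices (Diagram (p @ (us @ (Cross Pos, i) # vs) @ q))) [] (?P @ (t1 @ t2) @ ?Q)"
      using ld(1) by simp
    show "slices (Diagram (p @ (us @ (Cross Pos, i) # vs) @ q)) ! length (p @ us) = (Cross Pos, i)"
      "length (p @ us) < length (slices (Diagram (p @ (us @ (Cross Pos, i) # vs) @ q)))"
      using ld(1) by (simp_all add: nth_append)
    have "t1 \<noteq> []" using tr(2) us(1) by auto
    then obtain s t where t1: "t1 = t @ [s]" by (cases t1 rule: rev_cases) auto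
    have len: "length (p @ us) = Suc (length (?P @ t))" using t1 tr(2) by simp
    have split: "?P @ (t1 @ t2) @ ?Q = (?P @ t) @ s # (t2 @ ?Q)" by (simp add: t1)
    have "([] # ?P @ (t1 @ t2) @ ?Q) ! length (p @ us) = s"
      unfolding len split by (simp only: nth_Cons_Suc nth_append_length)
    then show "([] # ?P @ (t1 @ t2) @ ?Q) ! length (p @ us) ! i \<noteq> ([] # ?P @ (t1 @ t2) @ ?Q) ! length (p @ us) ! Suc i"
      using tr(3) t1 by simp
  qed
  ultimately show ?thesis ..
qed

text \<open>To be applied to the difference of two solutions. The claim is generalized to split
  unions, since separating the upper sublink produces one. The first measure, the number of
  crossings, drops under smoothing, is kept by switching and does not grow when a diagram is
  separated; the second one drops when a summand is replaced by two.\<close>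

theorem mixed_skein_vanishes:
  fixes E :: "link_diagram \<Rightarrow> 'r::comm_ring_1"
  assumes inv: "regular_isotopy_invariant E"
    and skein: "\<And>k Lp Lm L0 Linf. conway_quadruple k Lp Lm L0 Linf \<Longrightarrow> mixed_crossing Lp k \<Longrightarrow>
      E Lp - E Lm = z * (E L0 - E Linf)"
    and unlinked: "\<And>r K. 1 \<le> r \<Longrightarrow> unlinked_knots r K \<Longrightarrow> E K = 0"
  shows "E L = 0"
proof -
  let ?c = "\<lambda>Ls. concat (map slices Ls)"
  have "on_list E (?c Ls) = 0" if "Ls \<noteq> []" for Ls
    using that
  proof (induction Ls rule: wf_induct_rule[OF wf_measures[of "[\<lambda>Ls. crossings (?c Ls), \<lambda>Ls. length (?c Ls) - length Ls]"]])
    case (1 Ls)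
    have IH: "on_list E (?c Ls') = 0"
      if "Ls' \<noteq> []" "crossings (?c Ls') < crossings (?c Ls) \<or> crossings (?c Ls') = crossings (?c Ls) \<and>
        length (?c Ls') - length Ls' < length (?c Ls) - length Ls" for Ls'
      by (rule 1(1)) (use that in auto)
    show ?case
    proof (cases "\<forall>L \<in> set Ls. is_knot_diagram L")
      case True
      have ld: "is_link_diagram (?c Ls)"
        using closed_concat[of Ls] 1(2) slices_nonempty by (cases Ls) (auto simp: is_link_diagram_iff)
      have "unlinked_knots (length Ls) (Diagram (?c Ls))"
        unfolding unlinked_knots_def
        by (intro exI[of _ Ls] exI[of _ "Diagram (?c Ls)"]) (use True ld in \<open>simp add: isotopic_def\<close>)
      then show ?thesis using unlinked[of "length Ls"] 1(2) ld by (simp add: on_list_def Suc_le_eq)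
    next
      case False
      then obtain L where L: "L \<in> set Ls" "\<not> is_knot_diagram L" by blast
      from L(1) obtain Ps Qs where Ls: "Ls = Ps @ L # Qs" by (meson split_list)
      from L(2) obtain tr where tr: "path (slices L) [] tr" "colours tr = (UNIV :: bool set)"
        by (rule non_knot_colouring)
      have cP: "closed (?c Ps)" and cQ: "closed (?c Qs)" by (rule closed_concat)+
      have "on_list E (?c Ps @ ss @ ?c Qs) = 0"
        if "closed ss" "crossings ss = crossings (slices L)" "length ss = length (slices L)" "path ss [] tr" for ss
        using that
      \<comment> \<open>Switching a crossing does not affect which colourings are admissible, so
        \<open>tr\<close> stays fixed while the wrong crossings are switched one by one.\<close>
      proof (induction "bad ss [] tr" arbitrary: ss rule: less_induct)
        case (less ss)
        show ?case
        proof (cases "bad ss [] tr = 0")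
          case True
          let ?F = "sub Not ss [] tr" and ?T = "sub id ss [] tr"
          have "last ([] # tr) = []" using path_fits[OF less.prems(4)] less.prems(1) by simp
          then have eq: "teq 0 ss (?F @ ?T)" using teq_split[OF less.prems(4) True] by simp
          have ne: "?F \<noteq> []" "?T \<noteq> []"
            using sub_nonempty[OF less.prems(4), of Not False] sub_nonempty[OF less.prems(4), of id True] tr(2)
            by simp_all
          then have ld: "is_link_diagram ?F" "is_link_diagram ?T"
            using closed_sub[OF less.prems(4,1)] by (simp_all add: is_link_diagram_iff)
          let ?Ls = "Ps @ Diagram ?F # Diagram ?T # Qs"
          have c: "?c ?Ls = ?c Ps @ (?F @ ?T) @ ?c Qs" using ld by simp
          have "on_list E (?c Ps @ ss @ ?c Qs) = on_list E (?c ?Ls)"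
            unfolding c
          proof (rule on_list_teq[OF inv], rule teq_ctx)
            show "teq (outw 0 (?c Ps)) ss (?F @ ?T)" using eq cP by simp
            show "fits 0 (?c Ps @ ss @ ?c Qs)" using cP cQ less.prems(1) by simp
          qed
          also have "\<dots> = 0"
          proof (rule IH)
            \<comment> \<open>This bound ensures that the truncated difference in the second measure
              really decreases.\<close>
            have "length ?Ls \<le> length (?c ?Ls)" by (rule length_concat_slices)
            then show "crossings (?c ?Ls) < crossings (?c Ls) \<or> crossings (?c ?Ls) = crossings (?c Ls) \<and>
                length (?c ?Ls) - length ?Ls < length (?c Ls) - length Ls"
              using crossings_sub[OF less.prems(4)] less.prems(2,3) unfolding c Ls by simp linarith
          qed simp
          finally show ?thesis .
        next
          case False
          from bad_crossing[OF less.prems(4) False] obtain us p i vs t1 t2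
            where b: "ss = us @ (Cross p, i) # vs" "tr = t1 @ t2" "length t1 = length us"
              "last ([] # t1) ! i \<noteq> last ([] # t1) ! Suc i"
              "bad (us @ (Cross (switch p), i) # vs) [] tr < bad ss [] tr" by blast
          have us: "us \<noteq> []" "Suc (Suc i) \<le> outw 0 us" using less.prems(1) b(1) by auto
          then have "Suc (Suc (outw 0 us - 2)) = outw 0 us" by arith
          then have cl: "closed (us @ (Cross d, i) # vs)" "closed (us @ (Cap, i) # (Cup, i) # vs)"
            "closed (us @ vs)" for d using less.prems(1) b(1) us by auto
          have path: "path (us @ (Cross d, i) # vs) [] (t1 @ t2)" for d
            using less.prems(4) unfolding b(1,2) by (rule path_switch[THEN iffD1])
          let ?e = "\<lambda>ss. on_list E (?c Ps @ ss @ ?c Qs)"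
          have ld: "is_link_diagram (?c Ps @ (us @ (Cross d, i) # vs) @ ?c Qs)"
            "is_link_diagram (?c Ps @ (us @ (Cap, i) # (Cup, i) # vs) @ ?c Qs)"
            "is_link_diagram (?c Ps @ (us @ vs) @ ?c Qs)" for d
            using cl us cP cQ by (auto simp: is_link_diagram_iff)
          have smaller: "?e ss' = 0" if "closed ss'" "ss' \<noteq> []" "crossings ss' < crossings (slices L)" for ss'
          proof -
            have "is_link_diagram ss'" using that by (simp add: is_link_diagram_iff)
            then show ?thesis using IH[of "Ps @ Diagram ss' # Qs"] that(3) by (simp add: Ls)
          qed
          have "crossings (us @ vs) < crossings (slices L)"
            "crossings (us @ (Cap, i) # (Cup, i) # vs) < crossings (slices L)"
            using less.prems(2) b(1) by simp_all
          with smaller[OF cl(2)] smaller[OF cl(3)] us(1)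
          have "?e (us @ (Cap, i) # (Cup, i) # vs) = 0" "?e (us @ vs) = 0" by blast+
          moreover have "?e (us @ (Cross Pos, i) # vs) - ?e (us @ (Cross Neg, i) # vs)
              = z * (?e (us @ (Cap, i) # (Cup, i) # vs) - ?e (us @ vs))"
            unfolding on_list_def if_P[OF ld(1)] if_P[OF ld(2)] if_P[OF ld(3)]
            using conway_mixed_stack[OF cP cQ cl(1) path b(3,4)] by (intro skein) blast+
          ultimately have same: "?e (us @ (Cross Pos, i) # vs) = ?e (us @ (Cross Neg, i) # vs)" by simp
          have "?e (us @ (Cross (switch p), i) # vs) = 0"
            using b(5) cl(1) path less.prems(2,3) b(1,2) by (intro less.hyps) simp_all
          with same show ?thesis unfolding b(1) by (cases p) simp_all
        qed
      qed
      from this[of "slices L"] show ?thesis using closed_slices[of L] tr(1) by (simp add: Ls)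
    qed
  qed
  from this[of "[L]"] show ?thesis by simp
qed

section \<open>Laurent polynomials\<close>

text \<open>Describing the embedding by coefficients makes additivity a comparison of coefficients;
  multiplicativity then reduces to monomials.\<close>

lemma lookup_embed_wa:
  "Poly_Mapping.lookup (embed_wa p) (n, i, j, k) = (if n = 0 \<and> k = 0 then Poly_Mapping.lookup p (i, j) else 0)"
proof -
  have "Poly_Mapping.lookup (embed_wa p) (n, i, j, k) =
      (\<Sum>x \<in> Poly_Mapping.keys p. if x = (i, j) then (if n = 0 \<and> k = 0 then Poly_Mapping.lookup p (i, j) else 0) else 0)"
    unfolding embed_wa_def lookup_sum
    by (rule sum.cong) (auto simp: lookup_single when_def split: if_splits)
  also have "\<dots> = (if n = 0 \<and> k = 0 then Poly_Mapping.lookup p (i, j) else 0)"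
    by (simp add: in_keys_iff)
  finally show ?thesis .
qed

lemma embed_wa_add: "embed_wa (p + q) = embed_wa p + embed_wa q"
  by (rule poly_mapping_eqI) (auto simp: lookup_add lookup_embed_wa split: prod.splits)

lemma embed_wa_single: "embed_wa (Poly_Mapping.single (i, j) c) = Poly_Mapping.single (0, i, j, 0) c"
  by (rule poly_mapping_eqI) (auto simp: lookup_single lookup_embed_wa when_def split: if_splits)

lemma embed_wa_0: "embed_wa 0 = 0"
  by (rule poly_mapping_eqI) (auto simp: lookup_embed_wa)

lemma embed_wa_sum: "embed_wa (sum f A) = (\<Sum>x \<in> A. embed_wa (f x))"
  by (induction A rule: infinite_finite_induct) (simp_all add: embed_wa_0 embed_wa_add)

lemma embed_wa_diff: "embed_wa (p - q) = embed_wa p - embed_wa q"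
  using embed_wa_add[of "p - q" q] by (simp add: algebra_simps)

lemma embed_wa_single_mult:
  "embed_wa (Poly_Mapping.single x c * Poly_Mapping.single y d) =
    embed_wa (Poly_Mapping.single x c) * embed_wa (Poly_Mapping.single y d)"
  by (cases x; cases y) (simp add: mult_single embed_wa_single)

lemma embed_wa_mult: "embed_wa (p * q) = embed_wa p * embed_wa q"
proof -
  let ?m = "\<lambda>p x. Poly_Mapping.single x (Poly_Mapping.lookup p x)"
  have s: "p = (\<Sum>x \<in> Poly_Mapping.keys p. ?m p x)" for p :: poly_wa
    by (rule poly_mapping_eqI) (simp add: lookup_sum lookup_single when_def in_keys_iff)
  have "embed_wa ((\<Sum>x \<in> Poly_Mapping.keys p. ?m p x) * (\<Sum>y \<in> Poly_Mapping.keys q. ?m q y))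
      = embed_wa (\<Sum>x \<in> Poly_Mapping.keys p. ?m p x) * embed_wa (\<Sum>y \<in> Poly_Mapping.keys q. ?m q y)"
    unfolding sum_product embed_wa_sum embed_wa_single_mult ..
  then show ?thesis using s[of p] s[of q] by simp
qed

lemma embed_wa_1: "embed_wa 1 = 1"
  using embed_wa_single[of 0 0 1] by (simp flip: single_one zero_prod_def)

lemma lookup_of_nat_mult:
  "Poly_Mapping.lookup (of_nat n * (p :: 'a::comm_monoid_add \<Rightarrow>\<^sub>0 int)) x = int n * Poly_Mapping.lookup p x"
  by (induction n) (simp_all add: lookup_add algebra_simps)

lemma poly_torsion_free:
  fixes p q :: "'a::comm_monoid_add \<Rightarrow>\<^sub>0 int"
  assumes "0 < n" "of_nat n * p = of_nat n * q"
  shows "p = q"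
proof (rule poly_mapping_eqI)
  fix x
  have "int n * Poly_Mapping.lookup p x = int n * Poly_Mapping.lookup q x"
    using assms(2) by (simp flip: lookup_of_nat_mult)
  with assms(1) show "Poly_Mapping.lookup p x = Poly_Mapping.lookup q x" by simp
qed

lemma E_pow_neg: "E_pow (- 1) ^ n = E_pow (- int n)"
proof (induction n)
  case 0
  show ?case by (simp add: E_pow_def single_one flip: zero_prod_def)
next
  case (Suc n)
  then show ?case by (simp add: E_pow_def mult_single)
qed

theorem theorem2:
  fixes T :: "link_diagram \<Rightarrow> poly_wa"
  assumes "is_dubrovnik T"
  shows "\<exists>!D :: link_diagram \<Rightarrow> poly_zwaE.
    regular_isotopy_invariant D \<and>
    (\<forall>k Lp Lm L0 Linf. conway_quadruple k Lp Lm L0 Linf \<and> mixed_crossing Lp k \<longrightarrow>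
       D Lp - D Lm = indet_z * (D L0 - D Linf)) \<and>
    (\<forall>r K. 1 \<le> r \<and> unlinked_knots r K \<longrightarrow> D K = E_pow (1 - int r) * embed_wa (T K))"
    (is "\<exists>!D. ?P D")
proof -
  let ?wi = "Poly_Mapping.single (- 1, 0) 1 :: poly_wa"
  have T: "regular_isotopy_invariant T"
    "\<And>k Lp Lm L0 Linf. conway_quadruple k Lp Lm L0 Linf \<Longrightarrow> T Lp - T Lm = indet_w * (T L0 - T Linf)"
    "\<And>L L'. local_move (\<lambda>ss ss'. curl Neg ss \<and> ss' = []) L L' \<Longrightarrow> T L = a_pow 1 * T L'"
    "\<And>L L'. local_move (\<lambda>ss ss'. curl Pos ss \<and> ss' = []) L L' \<Longrightarrow> T L = a_pow (- 1) * T L'"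
    "T unknot = 1"
    using assms unfolding is_dubrovnik_def by blast+
  \<comment> \<open>The state sum involves \<open>z\<close> and \<open>E\<close>, so the values of
    \<open>T\<close> are first carried into the larger ring by the embedding.\<close>
  interpret state_sum "\<lambda>L. embed_wa (T L)" "embed_wa indet_w" "embed_wa ?wi" "embed_wa (a_pow 1)"
    "embed_wa (a_pow (- 1))" indet_z "E_pow (- 1)"
  proof
    show "regular_isotopy_invariant (\<lambda>L. embed_wa (T L))"
      using T(1) unfolding regular_isotopy_invariant_def by metis
    show "embed_wa (T Lp) - embed_wa (T Lm) = embed_wa indet_w * (embed_wa (T L0) - embed_wa (T Linf))"
      if "conway_quadruple k Lp Lm L0 Linf" for k Lp Lm L0 Linf
      using T(2)[OF that] by (simp flip: embed_wa_diff embed_wa_mult)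
    show "embed_wa (T L) = embed_wa (a_pow 1) * embed_wa (T L')"
      if "local_move (\<lambda>ss ss'. curl Neg ss \<and> ss' = []) L L'" for L L'
      using T(3)[OF that] by (simp flip: embed_wa_mult)
    show "embed_wa (T L) = embed_wa (a_pow (- 1)) * embed_wa (T L')"
      if "local_move (\<lambda>ss ss'. curl Pos ss \<and> ss' = []) L L'" for L L'
      using T(4)[OF that] by (simp flip: embed_wa_mult)
    show "embed_wa indet_w * embed_wa ?wi = 1"
      by (simp add: indet_w_def embed_wa_1 mult_single single_one flip: embed_wa_mult zero_prod_def)
    show "embed_wa (a_pow 1) * embed_wa (a_pow (- 1)) = 1"
      by (simp add: a_pow_def embed_wa_1 mult_single single_one flip: embed_wa_mult zero_prod_def)
    show "embed_wa (T unknot) = 1" using T(5) embed_wa_1 by simp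
  qed (rule poly_torsion_free)
  show ?thesis
  proof (rule ex1I[of _ state_sum_link])
    show "?P state_sum_link"
    proof (intro conjI allI impI; (elim conjE)?)
      show "regular_isotopy_invariant state_sum_link" by (rule state_sum_link_invariant)
    next
      fix k Lp Lm L0 Linf
      assume "conway_quadruple k Lp Lm L0 Linf" "mixed_crossing Lp k"
      then show "state_sum_link Lp - state_sum_link Lm = indet_z * (state_sum_link L0 - state_sum_link Linf)"
        by (rule state_sum_link_skein)
    next
      fix r K assume r: "1 \<le> r" "unlinked_knots r K"
      have "E_pow (- 1) ^ (r - 1) = E_pow (1 - int r)" using r(1) by (simp add: E_pow_neg of_nat_diff)
      with state_sum_link_unlinked[OF r(2,1)]
      show "state_sum_link K = E_pow (1 - int r) * embed_wa (T K)" by simp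
    qed
  next
    fix D assume D: "?P D"
    note inv = conjunct1[OF D]
    note skein = conjunct1[OF conjunct2[OF D], rule_format, OF conjI]
    note unl = conjunct2[OF conjunct2[OF D], rule_format, OF conjI]
    \<comment> \<open>Both solutions have the same values on unlinked knots, and the skein rule is
      linear, so the difference satisfies the homogeneous rules.\<close>
    have "D L - state_sum_link L = 0" for L
    proof (rule mixed_skein_vanishes[where z = indet_z])
      show "regular_isotopy_invariant (\<lambda>L. D L - state_sum_link L)"
        using inv state_sum_link_invariant unfolding regular_isotopy_invariant_def by metis
      show "D Lp - state_sum_link Lp - (D Lm - state_sum_link Lm)
          = indet_z * (D L0 - state_sum_link L0 - (D Linf - state_sum_link Linf))"
        if "conway_quadruple k Lp Lm L0 Linf" "mixed_crossing Lp k" for k Lp Lm L0 Linf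
        using skein[OF that] state_sum_link_skein[OF that] by (simp add: algebra_simps)
      show "D K - state_sum_link K = 0" if "1 \<le> r" "unlinked_knots r K" for r K
        using unl[OF that] state_sum_link_unlinked[OF that(2,1)] that(1)
        by (simp add: E_pow_neg of_nat_diff)
    qed
    then show "D = state_sum_link" by (simp add: fun_eq_iff)
  qed
qed

end
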